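(* Let $\Omega\subset\mathbb{R}^d$ be a conforming multipatch domain with patches $\Omega^{(r)}=\mathbf{F}^{(r)}((0,1)^d)$, $r=1,\dots,N_{\mathrm{patch}}$, where $\mathbf{F}^{(r)}\in C^1([0,1]^d)$ and $\det(D\mathbf{F}^{(r)}(\boldsymbol{x}))>0$ for all $\boldsymbol{x}\in[0,1]^d$ and all $r$. Let $V_h$ be the continuous multipatch isogeometric space with basis $\{B_l\}_{l\in\mathcal{J}}$, with quasi-uniform knot vectors of mesh-size $h$, let $[\mathbf{M}]_{i,j}=\int_\Omega B_i(\boldsymbol{x})B_j(\boldsymbol{x})\,d\boldsymbol{x}$, $i,j\in\mathcal{J}$, and let $$\boldsymbol{\mathcal{M}}_{\mathrm{ad}}^{-1}=\sum_{r=1}^{N_{\mathrm{patch}}}{\mathbf{R}^{(r)}}^T{\boldsymbol{\mathcal{M}}^{(r)}}^{-1}\mathbf{R}^{(r)}$$ be the (inverse of the) Additive Schwarz preconditioner (all objects as defined in the context). Then there exists a constant $C$, independent of $h$ and $N_{\mathrm{adj}}$, such that $$\kappa\left(\boldsymbol{\mathcal{M}}_{\mathrm{ad}}^{-\frac12}\,\mathbf{M}\,\boldsymbol{\mathcal{M}}_{\mathrm{ad}}^{-\frac12}\right)\le C\,N_{\mathrm{adj}}^2 ,$$ where $N_{\mathrm{adj}}=\max_{l\in\mathcal{J}}n_l$ denotes the maximum number of adjacent patches, $n_l$ being the patch multiplicity of the global index $l$.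
   Context: **B-splines.** For each patch $r$ and direction $k=1,\dots,d$ there is an open knot vector $0=\xi_1=\dots=\xi_{p+1}<\xi_{p+2}\le\dots\le\xi_m<\xi_{m+1}=\dots=\xi_{m+p+1}=1$ with interior knots of multiplicity at most $p$ ($p\ge1$ is the same for all patches and directions; knots and $m$ may depend on $r$). The mesh-size $h$ is the maximal length of a knot span, and quasi-uniformity holds: every nonempty knot span has length at least $\alpha h$, with $\alpha>0$ independent of $h$. $\{\widehat B^{(r)}_i\}_{i=1}^{N^{(r)}_{\mathrm{dof}}}$ are the tensor-product B-splines of degree $p$ on $[0,1]^d$ (products of univariate B-splines given by the Cox–De Boor recursion), and $B^{(r)}_i=\widehat B^{(r)}_i\circ(\mathbf{F}^{(r)})^{-1}$, $\mathcal{S}^{(r)}_h=\mathrm{span}\{B^{(r)}_i\}$. **Multipatch domain.** $\Omega$ is open, $\overline\Omega=\bigcup_r\overline{\Omega^{(r)}}$, the patches are disjoint, and each $\mathbf{F}^{(r)}$ is an (invertible) spline parametrization, which does not change when $h$ is refined. For $r\ne s$ set $\Gamma_{rs}=\partial\Omega^{(r)}\cap\partial\Omega^{(s)}$. Conformity assumption: (1) every nonempty $\Gamma_{rs}$ is either a vertex, or the image of a full edge, or the image of a full face, for both parametric domains; (2) for each $B^{(r)}_i$ with $\mathrm{supp}(B^{(r)}_i)\cap\Gamma_{rs}\ne\emptyset$ there is $B^{(s)}_j$ with $B^{(r)}_i|_{\Gamma_{rs}}=B^{(s)}_j|_{\Gamma_{rs}}$. **Global space.** $V_h=\{v\in C^0(\Omega):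 v|_{\Omega^{(r)}}\in\mathcal{S}^{(r)}_h,\ r=1,\dots,N_{\mathrm{patch}}\}$. The maps $G^{(r)}:\{1,\dots,N^{(r)}_{\mathrm{dof}}\}\to\mathcal{J}=\{1,\dots,\dim V_h\}$ (each injective, jointly surjective) are such that, for $r\neq s$, $G^{(r)}(i)=G^{(s)}(j)$ if and only if $\Gamma_{rs}\ne\emptyset$ and $B^{(r)}_i|_{\Gamma_{rs}}=B^{(s)}_j|_{\Gamma_{rs}}$ with this common trace not identically zero. For $l\in\mathcal{J}$, $\mathcal{J}_l=\{(r,i):G^{(r)}(i)=l\}$, $n_l=\#\mathcal{J}_l$, and $B_l(\boldsymbol{x})=B^{(r)}_i(\boldsymbol{x})$ if $\boldsymbol{x}\in\overline{\Omega^{(r)}}$ and $(r,i)\in\mathcal{J}_l$, and $B_l(\boldsymbol{x})=0$ otherwise. The $B_l$ are a basis of $V_h$. $\mathcal{J}^{(r)}\subset\mathcal{J}$ is the image of $G^{(r)}$; it is used to index the local bases $\widehat B^{(r)}_i$, $B^{(r)}_i$. **Preconditioner.** $\mathbf{R}^{(r)}$ is the rectangular matrix restricting a coefficient vector $(u_l)_{l\in\mathcal{J}}$ to $(u_l)_{l\in\mathcal{J}^{(r)}}$. With $[\widehat{\mathbf{M}}^{(r)}]_{i,j}=\int_{(0,1)^d}\widehat B^{(r)}_i\widehat B^{(r)}_j\,d\boldsymbol{x}$, $[\mathbf{M}^{(r)}]_{i,j}=\int_{\Omega^{(r)}}B^{(r)}_iB^{(r)}_j\,d\boldsymbol{x}$,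 and $\widehat{\mathbf{D}}^{(r)}=\mathrm{diag}(\widehat{\mathbf{M}}^{(r)})$, $\mathbf{D}^{(r)}=\mathrm{diag}(\mathbf{M}^{(r)})$ (diagonal parts), set $$\boldsymbol{\mathcal{M}}^{(r)}=(\mathbf{D}^{(r)})^{\frac12}(\widehat{\mathbf{D}}^{(r)})^{-\frac12}\,\widehat{\mathbf{M}}^{(r)}\,(\widehat{\mathbf{D}}^{(r)})^{-\frac12}(\mathbf{D}^{(r)})^{\frac12}.$$ $\boldsymbol{\mathcal{M}}_{\mathrm{ad}}^{-1/2}$ is the symmetric positive definite square root of $\boldsymbol{\mathcal{M}}_{\mathrm{ad}}^{-1}$, and $\kappa(\mathbf{A})=\lambda_{\max}(\mathbf{A})/\lambda_{\min}(\mathbf{A})$. *)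

theory Defs
  imports
    "HOL-Analysis.Analysis"
    "Jordan_Normal_Form.Gauss_Jordan_Elimination"
    "Jordan_Normal_Form.Spectral_Radius"
begin

text \<open>Points of \<open>\<real>\<^sup>d\<close> have type \<^typ>\<open>real ^ 'd\<close>; the space dimension is the cardinality of \<open>'d\<close>,
  and coordinate directions are the elements of \<open>'d\<close>.  Matrices, whose size varies with the mesh,
  are those of \<^theory>\<open>Jordan_Normal_Form.Matrix\<close>.  All index sets start at 0.\<close>

section \<open>Univariate and tensor-product B-splines\<close>

text \<open>A knot vector is the list \<open>\<xi>\<^sub>0, \<dots>, \<xi>\<^bsub>m+p\<^esub>\<close>; \<open>m\<close> is the number of B-splines.\<close>

definition num_bsplines :: "nat \<Rightarrow> real list \<Rightarrow> nat" where
  "num_bsplines p \<xi> = length \<xi> - p - 1"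

definition open_knot_vector :: "nat \<Rightarrow> real list \<Rightarrow> bool" where
  "open_knot_vector p \<xi> \<longleftrightarrow>
     (let m = num_bsplines p \<xi> in
        2 * p + 2 \<le> length \<xi> \<and> sorted \<xi> \<and>
        (\<forall>i\<le>p. \<xi> ! i = 0 \<and> \<xi> ! (m + i) = 1) \<and>
        \<xi> ! p < \<xi> ! (p + 1) \<and> \<xi> ! (m - 1) < \<xi> ! m \<and>
        (\<forall>t. 0 < t \<and> t < 1 \<longrightarrow> count_list \<xi> t \<le> p))"

text \<open>Cox--De Boor recursion.  Quotients with denominator 0 are 0 by convention.
  The last nonempty knot span is closed on the right, so that the B-splines on \<open>[0,1]\<close> are
  left-continuous at 1 (the last one has the value 1 there) and have the correct traces.\<close>

fun bspline :: "real list \<Rightarrow> nat \<Rightarrow> nat \<Rightarrow> real \<Rightarrow> real" where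
  "bspline \<xi> 0 i x =
     (if \<xi> ! i \<le> x \<and> x < \<xi> ! (i + 1) \<or>
         \<xi> ! i < x \<and> x = \<xi> ! (i + 1) \<and> x = last \<xi> then 1 else 0)"
| "bspline \<xi> (Suc q) i x =
     (x - \<xi> ! i) / (\<xi> ! (i + q + 1) - \<xi> ! i) * bspline \<xi> q i x
   + (\<xi> ! (i + q + 2) - x) / (\<xi> ! (i + q + 2) - \<xi> ! (i + 1)) * bspline \<xi> q (i + 1) x"

definition multi_indices :: "nat \<Rightarrow> ('d::finite \<Rightarrow> real list) \<Rightarrow> ('d \<Rightarrow> nat) set" where
  "multi_indices p \<Xi> = {I. \<forall>k. I k < num_bsplines p (\<Xi> k)}"

definition tensor_bspline ::
    "nat \<Rightarrow> ('d::finite \<Rightarrow> real list) \<Rightarrow> ('d \<Rightarrow> nat) \<Rightarrow> real ^ 'd \<Rightarrow> real" where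
  "tensor_bspline p \<Xi> I x = (\<Prod>k\<in>UNIV. bspline (\<Xi> k) p (I k) (vec_nth x k))"

definition spline_map :: "(real ^ 'd::finite \<Rightarrow> real ^ 'd) \<Rightarrow> bool" where
  "spline_map f \<longleftrightarrow>
     (\<exists>q \<Xi> c. (\<forall>k. open_knot_vector q (\<Xi> k)) \<and>
        (\<forall>x\<in>cbox 0 1. f x = (\<Sum>I\<in>multi_indices q \<Xi>. tensor_bspline q \<Xi> I x *\<^sub>R c I)))"

section \<open>Parametrizations and multipatch domains\<close>

text \<open>The derivative within the closed cube is unique, also at boundary points.\<close>

definition jacobian :: "(real ^ 'd::finite \<Rightarrow> real ^ 'd) \<Rightarrow> real ^ 'd \<Rightarrow> real ^ 'd ^ 'd" where
  "jacobian f x = matrix (frechet_derivative f (at x within cbox 0 1))"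

definition C1_on_cube :: "(real ^ 'd::finite \<Rightarrow> real ^ 'd) \<Rightarrow> bool" where
  "C1_on_cube f \<longleftrightarrow> f differentiable_on cbox 0 1 \<and> continuous_on (cbox 0 1) (jacobian f)"

definition jac_det :: "(real ^ 'd::finite \<Rightarrow> real ^ 'd) \<Rightarrow> real ^ 'd \<Rightarrow> real" where
  "jac_det f x = Determinants.det (jacobian f x)"

record ('d::finite) geometry =
  npatch :: nat
  param :: "nat \<Rightarrow> real ^ 'd \<Rightarrow> real ^ 'd"
  domain :: "(real ^ 'd) set"

definition patch :: "('d::finite) geometry \<Rightarrow> nat \<Rightarrow> (real ^ 'd) set" where
  "patch g r = param g r ` box 0 1"

definition interface :: "('d::finite) geometry \<Rightarrow> nat \<Rightarrow> nat \<Rightarrow> (real ^ 'd) set" where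
  "interface g r s = frontier (patch g r) \<inter> frontier (patch g s)"

text \<open>A nonempty proper face of the closed cube is a vertex, an edge, a face, or (if \<open>d > 3\<close>)
  one of the analogous faces of intermediate or higher dimension.\<close>

definition proper_cube_face :: "(real ^ 'd::finite) set \<Rightarrow> bool" where
  "proper_cube_face S \<longleftrightarrow> S face_of cbox 0 1 \<and> S \<noteq> {} \<and> S \<noteq> cbox 0 1"

text \<open>\<open>patch g r \<subseteq> domain g\<close> has to be required: the closure condition alone would allow the domain to
  be a patch with a closed nowhere dense set (possibly of positive measure) removed.\<close>

definition multipatch_domain :: "('d::finite) geometry \<Rightarrow> bool" where
  "multipatch_domain g \<longleftrightarrow>
     0 < npatch g \<and>
     open (domain g) \<and> closure (domain g) = (\<Union>r<npatch g. closure (patch g r)) \<and>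
     (\<forall>r<npatch g. patch g r \<subseteq> domain g) \<and>
     (\<forall>r<npatch g. \<forall>s<npatch g. r \<noteq> s \<longrightarrow> patch g r \<inter> patch g s = {}) \<and>
     (\<forall>r<npatch g. spline_map (param g r) \<and> inj_on (param g r) (cbox 0 1)) \<and>
     (\<forall>r<npatch g. \<forall>s<npatch g. r \<noteq> s \<and> interface g r s \<noteq> {} \<longrightarrow>
        (\<exists>S T. proper_cube_face S \<and> proper_cube_face T \<and>
           interface g r s = param g r ` S \<and> interface g r s = param g s ` T))"

definition jac_dets :: "('d::finite) geometry \<Rightarrow> real set" where
  "jac_dets g = {jac_det (param g r) x | r x. r < npatch g \<and> x \<in> cbox 0 1}"

section \<open>The multipatch isogeometric space\<close>

text \<open>\<open>knots r k\<close> is the knot vector of patch \<open>r\<close> in direction \<open>k\<close>; \<open>numbering r\<close> is an (arbitrary)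
  enumeration of the multi-indices of patch \<open>r\<close>; \<open>ndim\<close> is the number of global indices,
  and \<open>loc_glob r\<close> is the map \<open>G\<^sup>(\<^sup>r\<^sup>)\<close>.\<close>

record ('d::finite) discretization =
  knots :: "nat \<Rightarrow> 'd \<Rightarrow> real list"
  numbering :: "nat \<Rightarrow> nat \<Rightarrow> 'd \<Rightarrow> nat"
  ndim :: nat
  loc_glob :: "nat \<Rightarrow> nat \<Rightarrow> nat"

definition ndof :: "nat \<Rightarrow> ('d::finite) discretization \<Rightarrow> nat \<Rightarrow> nat" where
  "ndof p V r = (\<Prod>k\<in>UNIV. num_bsplines p (knots V r k))"

definition ref_basis :: "nat \<Rightarrow> ('d::finite) discretization \<Rightarrow> nat \<Rightarrow> nat \<Rightarrow> real ^ 'd \<Rightarrow> real" where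
  "ref_basis p V r i = tensor_bspline p (knots V r) (numbering V r i)"

definition loc_basis ::
    "nat \<Rightarrow> ('d::finite) geometry \<Rightarrow> 'd discretization \<Rightarrow> nat \<Rightarrow> nat \<Rightarrow> real ^ 'd \<Rightarrow> real" where
  "loc_basis p g V r i x =
     (if x \<in> param g r ` cbox 0 1
      then ref_basis p V r i (inv_into (cbox 0 1) (param g r) x) else 0)"

definition span_lengths :: "real list \<Rightarrow> real set" where
  "span_lengths \<xi> = {\<xi> ! (i + 1) - \<xi> ! i | i. i + 1 < length \<xi>}"

definition all_span_lengths :: "('d::finite) geometry \<Rightarrow> 'd discretization \<Rightarrow> real set" where
  "all_span_lengths g V = (\<Union>r<npatch g. \<Union>k. span_lengths (knots V r k))"

definition mesh_size :: "('d::finite) geometry \<Rightarrow> 'd discretization \<Rightarrow> real" where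
  "mesh_size g V = Max (all_span_lengths g V)"

definition quasi_uniform :: "real \<Rightarrow> ('d::finite) geometry \<Rightarrow> 'd discretization \<Rightarrow> bool" where
  "quasi_uniform \<alpha> g V \<longleftrightarrow>
     (\<forall>s\<in>all_span_lengths g V. s \<noteq> 0 \<longrightarrow> \<alpha> * mesh_size g V \<le> s)"

definition eq_trace ::
    "nat \<Rightarrow> ('d::finite) geometry \<Rightarrow> 'd discretization \<Rightarrow> nat \<Rightarrow> nat \<Rightarrow> nat \<Rightarrow> nat \<Rightarrow> bool" where
  "eq_trace p g V r i s j \<longleftrightarrow>
     (\<forall>x\<in>interface g r s. loc_basis p g V r i x = loc_basis p g V s j x)"

definition index_pairs ::
    "nat \<Rightarrow> ('d::finite) geometry \<Rightarrow> 'd discretization \<Rightarrow> nat \<Rightarrow> (nat \<times> nat) set" where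
  "index_pairs p g V l = {(r, i). r < npatch g \<and> i < ndof p V r \<and> loc_glob V r i = l}"

definition N_adj :: "nat \<Rightarrow> ('d::finite) geometry \<Rightarrow> 'd discretization \<Rightarrow> nat" where
  "N_adj p g V = Max ((\<lambda>l. card (index_pairs p g V l)) ` {..<ndim V})"

text \<open>Under conformity the value does not depend on the chosen pair.\<close>

definition glob_basis ::
    "nat \<Rightarrow> ('d::finite) geometry \<Rightarrow> 'd discretization \<Rightarrow> nat \<Rightarrow> real ^ 'd \<Rightarrow> real" where
  "glob_basis p g V l x =
     (if \<exists>(r, i)\<in>index_pairs p g V l. x \<in> closure (patch g r)
      then SOME y. \<exists>(r, i)\<in>index_pairs p g V l. x \<in> closure (patch g r) \<and> y = loc_basis p g V r i x
      else 0)"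

text \<open>Elements of \<open>V\<^sub>h\<close> are functions on the domain; their values elsewhere are irrelevant.\<close>

definition global_space ::
    "nat \<Rightarrow> ('d::finite) geometry \<Rightarrow> 'd discretization \<Rightarrow> (real ^ 'd \<Rightarrow> real) set" where
  "global_space p g V =
     {v. continuous_on (domain g) v \<and>
         (\<forall>r<npatch g. \<exists>c. \<forall>x\<in>patch g r. v x = (\<Sum>i<ndof p V r. c i * loc_basis p g V r i x))}"

definition is_basis_on ::
    "'a set \<Rightarrow> ('a \<Rightarrow> real) set \<Rightarrow> nat \<Rightarrow> (nat \<Rightarrow> 'a \<Rightarrow> real) \<Rightarrow> bool" where
  "is_basis_on D W n b \<longleftrightarrow>
     (\<forall>l<n. b l \<in> W) \<and>
     (\<forall>c. (\<forall>x\<in>D. (\<Sum>l<n. c l * b l x) = 0) \<longrightarrow> (\<forall>l<n. c l = 0)) \<and>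
     (\<forall>v\<in>W. \<exists>c. \<forall>x\<in>D. v x = (\<Sum>l<n. c l * b l x))"

definition conforming_discretization ::
    "nat \<Rightarrow> ('d::finite) geometry \<Rightarrow> 'd discretization \<Rightarrow> bool" where
  "conforming_discretization p g V \<longleftrightarrow>
     (\<forall>r<npatch g. (\<forall>k. open_knot_vector p (knots V r k)) \<and>
        bij_betw (numbering V r) {..<ndof p V r} (multi_indices p (knots V r))) \<and>
     (\<forall>r<npatch g. \<forall>s<npatch g. \<forall>i<ndof p V r.
        r \<noteq> s \<and>
        closure {x \<in> closure (patch g r). loc_basis p g V r i x \<noteq> 0} \<inter> interface g r s \<noteq> {} \<longrightarrow>
        (\<exists>j<ndof p V s. eq_trace p g V r i s j)) \<and>
     (\<forall>r<npatch g. inj_on (loc_glob V r) {..<ndof p V r}) \<and>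
     (\<Union>r<npatch g. loc_glob V r ` {..<ndof p V r}) = {..<ndim V} \<and>
     (\<forall>r<npatch g. \<forall>s<npatch g. \<forall>i<ndof p V r. \<forall>j<ndof p V s. r \<noteq> s \<longrightarrow>
        (loc_glob V r i = loc_glob V s j \<longleftrightarrow>
           interface g r s \<noteq> {} \<and> eq_trace p g V r i s j \<and>
           (\<exists>x\<in>interface g r s. loc_basis p g V r i x \<noteq> 0))) \<and>
     is_basis_on (domain g) (global_space p g V) (ndim V) (glob_basis p g V)"

section \<open>Matrices\<close>

definition mass_matrix :: "nat \<Rightarrow> ('d::finite) geometry \<Rightarrow> 'd discretization \<Rightarrow> real mat" where
  "mass_matrix p g V =
     Matrix.mat (ndim V) (ndim V) (\<lambda>(i, j).
       LINT x:domain g|lborel. glob_basis p g V i x * glob_basis p g V j x)"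

definition ref_mass :: "nat \<Rightarrow> ('d::finite) discretization \<Rightarrow> nat \<Rightarrow> real mat" where
  "ref_mass p V r =
     Matrix.mat (ndof p V r) (ndof p V r) (\<lambda>(i, j).
       LINT x:box 0 1|lborel. ref_basis p V r i x * ref_basis p V r j x)"

definition loc_mass :: "nat \<Rightarrow> ('d::finite) geometry \<Rightarrow> 'd discretization \<Rightarrow> nat \<Rightarrow> real mat" where
  "loc_mass p g V r =
     Matrix.mat (ndof p V r) (ndof p V r) (\<lambda>(i, j).
       LINT x:patch g r|lborel. loc_basis p g V r i x * loc_basis p g V r j x)"

definition restriction :: "nat \<Rightarrow> ('d::finite) discretization \<Rightarrow> nat \<Rightarrow> real mat" where
  "restriction p V r =
     Matrix.mat (ndof p V r) (ndim V) (\<lambda>(i, l). if loc_glob V r i = l then 1 else 0)"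

text \<open>\<open>diag(A)\<^bsup>1/2\<^esup>\<close> and \<open>diag(A)\<^bsup>-1/2\<^esup>\<close>, where \<open>diag(A)\<close> is the diagonal part of \<open>A\<close>.\<close>

definition sqrt_diag :: "real mat \<Rightarrow> real mat" where
  "sqrt_diag A = Matrix.mat (dim_row A) (dim_row A) (\<lambda>(i, j). if i = j then sqrt (A $$ (i, i)) else 0)"

definition inv_sqrt_diag :: "real mat \<Rightarrow> real mat" where
  "inv_sqrt_diag A = Matrix.mat (dim_row A) (dim_row A) (\<lambda>(i, j). if i = j then 1 / sqrt (A $$ (i, i)) else 0)"

definition loc_precond :: "nat \<Rightarrow> ('d::finite) geometry \<Rightarrow> 'd discretization \<Rightarrow> nat \<Rightarrow> real mat" where
  "loc_precond p g V r =
     sqrt_diag (loc_mass p g V r) * inv_sqrt_diag (ref_mass p V r) * ref_mass p V r *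
     inv_sqrt_diag (ref_mass p V r) * sqrt_diag (loc_mass p g V r)"

definition schwarz_inv :: "nat \<Rightarrow> ('d::finite) geometry \<Rightarrow> 'd discretization \<Rightarrow> real mat" where
  "schwarz_inv p g V =
     Matrix.mat (ndim V) (ndim V) (\<lambda>ij. \<Sum>r<npatch g.
       (transpose_mat (restriction p V r) * the (mat_inverse (loc_precond p g V r)) *
        restriction p V r) $$ ij)"

definition spd_mat :: "real mat \<Rightarrow> bool" where
  "spd_mat A \<longleftrightarrow>
     square_mat A \<and> transpose_mat A = A \<and>
     (\<forall>v\<in>carrier_vec (dim_row A). v \<noteq> 0\<^sub>v (dim_row A) \<longrightarrow> 0 < scalar_prod v (A *\<^sub>v v))"

definition spd_sqrt :: "real mat \<Rightarrow> real mat" where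
  "spd_sqrt A = (THE S. spd_mat S \<and> S * S = A)"

text \<open>Used for symmetric matrices only, all of whose eigenvalues are real.\<close>

definition cond_number :: "real mat \<Rightarrow> real" where
  "cond_number A = Max (spectrum A) / Min (spectrum A)"

end

theory Submission
  imports Defs
begin

text \<open>
On a quasi-uniform mesh every matrix in the theorem is comparable to a multiple of the identity, up
to the patch multiplicities, and the condition number is a quotient of the comparison constants.

Univariate B-splines are stable in \<open>L\<^sup>2\<close>:
\<open>\<gamma> h \<Sum>\<^sub>i c\<^sub>i\<^sup>2 \<le> \<integral> (\<Sum>\<^sub>i c\<^sub>i B\<^sub>i)\<^sup>2 \<le> (p + 1)\<^sup>2 h \<Sum>\<^sub>i c\<^sub>i\<^sup>2\<close>, with \<open>\<gamma>\<close> depending on \<open>p\<close> and \<open>\<alpha>\<close>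
only (\<open>spline_L2_stability\<close>, \<open>spline_L2_upper\<close>).  The lower bound is local: on one
knot span a spline controls the \<open>p + 1\<close> coefficients that are active there
(\<open>span_spline_coeff_bound\<close>).  This goes by induction on the degree.  The coefficients of the
derivative are difference quotients of the coefficients, and an inverse inequality bounds the
derivative by the spline itself; so all differences of neighbouring coefficients are controlled, and
then so are the coefficients, since the spline is a convex combination of them.

Reference mass matrices are Kronecker products of univariate Gram matrices, and such bounds are
multiplicative under Kronecker products (\<open>tensor_form_bounds\<close>).  Hence the reference mass matrix
of each patch lies between \<open>r\<^sub>1 = (\<gamma> h)\<^sup>d\<close> and \<open>r\<^sub>2 = ((p + 1)\<^sup>2 h)\<^sup>d\<close> times the identity.  Let
\<open>j\<close> and \<open>J\<close> be the infimum and the supremum of all Jacobian determinants.  Changing variables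
costs a factor in \<open>[j, J]\<close>, for the whole mass matrix of the patch as well as for its diagonal; so
the mass matrix of the patch and its scaled preconditioner both lie between
\<open>j r\<^sub>1\<close> and \<open>J r\<^sub>2\<close> (\<open>loc_mass_form_bounds\<close>).

Both the global mass matrix and the inverse of the Schwarz preconditioner have the form
\<open>\<Sum>\<^sub>r R\<^sub>r\<^sup>T X\<^sub>r R\<^sub>r\<close>, while \<open>\<Sum>\<^sub>r R\<^sub>r\<^sup>T R\<^sub>r\<close> is the diagonal matrix of the multiplicities
\<open>n\<^sub>l\<close>, which lie between \<open>1\<close> and \<open>N\<close>, the maximum \<open>N_adj\<close>.  So the mass matrix lies
between \<open>j r\<^sub>1\<close> and \<open>J r\<^sub>2 N\<close>, and the inverse of the preconditioner between \<open>1 / (J r\<^sub>2)\<close>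
and \<open>N / (j r\<^sub>1)\<close> (\<open>assemble_form_bounds\<close>).  Multiplying the bounds (\<open>cond_number_bound\<close>)
bounds the condition number by \<open>(J r\<^sub>2 / (j r\<^sub>1))\<^sup>2 N\<^sup>2\<close>; the powers of \<open>h\<close> in \<open>r\<^sub>1\<close> and
\<open>r\<^sub>2\<close> cancel.
\<close>

section \<open>Spectral theory of real symmetric matrices\<close>

text \<open>The symbols \<open>$\<close> and \<open>\<bullet>\<close> are kept for vectors of variable length, and
\<open>smult\<close> for polynomials.\<close>

hide_const (open) module.smult
no_notation vec_nth (infixl \<open>$\<close> 90)
unbundle no inner_syntax

text \<open>A complex eigenvalue exists; the Hermitian form of an eigenvector shows that it is real, and then
it is a root of the real characteristic polynomial.\<close>

lemma symmetric_real_eigenvalue: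
  fixes A :: "real mat"
  assumes A: "A \<in> carrier_mat n n" and sym: "transpose_mat A = A" and n: "n \<noteq> 0"
  shows "\<exists>k. eigenvalue A k"
proof -
  let ?A = "map_mat complex_of_real A"
  have Ac: "?A \<in> carrier_mat n n" using A by auto
  from spectrum_non_empty[OF Ac] n obtain k where k: "eigenvalue ?A k"
    unfolding spectrum_def by auto
  then obtain v where v: "v \<in> carrier_vec n" "v \<noteq> 0\<^sub>v n" "?A *\<^sub>v v = k \<cdot>\<^sub>v v"
    unfolding eigenvalue_def eigenvector_def using A by auto
  have aij: "A $$ (i,j) = A $$ (j,i)" if "i < n" "j < n" for i j
    using sym A that by (metis carrier_matD index_transpose_mat(1))
  have row: "(\<Sum>j<n. complex_of_real (A $$ (i,j)) * v $ j) = k * v $ i" if "i < n" for i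
  proof -
    have "(?A *\<^sub>v v) $ i = (\<Sum>j<n. complex_of_real (A $$ (i,j)) * v $ j)"
      using that A v(1) by (simp add: scalar_prod_def atLeast0LessThan)
    then show ?thesis using v(1,3) that by simp
  qed
  define s where "s = (\<Sum>i<n. \<Sum>j<n. cnj (v $ i) * complex_of_real (A $$ (i,j)) * v $ j)"
  define q where "q = (\<Sum>i<n. (cmod (v $ i))\<^sup>2)"
  have "s = (\<Sum>i<n. cnj (v $ i) * (k * v $ i))"
    unfolding s_def by (intro sum.cong refl) (simp add: row[symmetric] sum_distrib_left mult.assoc)
  also have "\<dots> = k * complex_of_real q"
    unfolding q_def by (simp add: sum_distrib_left complex_norm_square mult_ac del: of_real_power)
  finally have s: "s = k * complex_of_real q" .
  \<comment> \<open>Conjugation transposes the double sum, and the matrix is symmetric.\<close>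
  have "cnj s = (\<Sum>i<n. \<Sum>j<n. cnj (v $ j) * complex_of_real (A $$ (j,i)) * v $ i)"
    unfolding s_def by (simp, intro sum.cong refl) (simp add: aij mult_ac)
  also have "\<dots> = s" unfolding s_def by (rule sum.swap)
  finally have "cnj k * complex_of_real q = k * complex_of_real q" using s by simp
  moreover have "q \<noteq> 0"
  proof
    assume "q = 0"
    then have "\<forall>i\<in>{..<n}. (cmod (v $ i))\<^sup>2 = 0" unfolding q_def
      by (subst (asm) sum_nonneg_eq_0_iff) auto
    then have "v = 0\<^sub>v n" using v(1) by (intro eq_vecI) auto
    with v(2) show False by simp
  qed
  ultimately have "cnj k = k" by simp
  then have kr: "k = complex_of_real (Re k)" by (simp add: complex_eq_iff)
  have "poly (char_poly ?A) k = 0" using k eigenvalue_root_char_poly[OF Ac] by simp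
  then have "poly (map_poly complex_of_real (char_poly A)) (complex_of_real (Re k)) = 0"
    using of_real_hom.char_poly_hom[OF A] kr by metis
  then have "poly (char_poly A) (Re k) = 0" by (simp add: of_real_hom.poly_map_poly)
  then show ?thesis using eigenvalue_root_char_poly[OF A] by blast
qed

text \<open>Complete the vector to a basis, orthogonalize, and normalize the columns.\<close>

lemma orthogonal_mat_with_first_column:
  fixes v :: "real vec"
  assumes v: "v \<in> carrier_vec n" "v \<noteq> 0\<^sub>v n"
  obtains W c where "W \<in> carrier_mat n n" "transpose_mat W * W = 1\<^sub>m n"
    "Matrix.col W 0 = c \<cdot>\<^sub>v v"
proof -
  interpret cof_vec_space n "TYPE(real)" .
  have n: "n \<noteq> 0" using v by (metis carrier_vecD vec_of_dim_0)
  define b where "b = basis_completion v"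
  note bc = basis_completion[OF v, folded b_def]
  have b: "set b \<subseteq> carrier_vec n" "distinct b" "\<not> lin_dep (set b)" "length b = n" "hd b = v"
    using bc by auto
  define ws where "ws = gram_schmidt n b"
  note gs = gram_schmidt_result[OF b(1-3) ws_def]
  obtain vs where "b = v # vs" using b(4,5) n by (cases b) auto
  then have hd: "hd ws = v" unfolding ws_def using gram_schmidt_hd[OF v(1)] by simp
  have len: "length ws = n" using gs b by simp
  have wsc: "ws ! i \<in> carrier_vec n" if "i < n" for i using gs(3) len that by auto
  have orth: "(ws ! i) \<bullet> (ws ! j) = 0 \<longleftrightarrow> i \<noteq> j" if "i < n" "j < n" for i j
  proof -
    have "conjugate (ws ! j) = ws ! j" by (intro eq_vecI) auto
    then show ?thesis using gs(2) that len unfolding corthogonal_def by metis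
  qed
  define l where "l i = sqrt ((ws ! i) \<bullet> (ws ! i))" for i
  have pos: "0 \<le> (ws ! i) \<bullet> (ws ! i)" for i
    unfolding scalar_prod_def by (intro sum_nonneg) auto
  define W where "W = Matrix.mat n n (\<lambda>(i,j). ws ! j $ i / l j)"
  have W: "W \<in> carrier_mat n n" unfolding W_def by simp
  have "transpose_mat W * W = 1\<^sub>m n"
  proof (rule eq_matI)
    fix i j assume ij: "i < dim_row (1\<^sub>m n)" "j < dim_col (1\<^sub>m n)"
    have "(transpose_mat W * W) $$ (i,j) = ((ws ! i) \<bullet> (ws ! j)) / (l i * l j)"
      using ij wsc[of j] unfolding W_def
      by (simp add: scalar_prod_def sum_divide_distrib)
    also have "\<dots> = 1\<^sub>m n $$ (i,j)"
      using ij orth[of i j] orth[of i i] pos[of i] by (auto simp: l_def)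
    finally show "(transpose_mat W * W) $$ (i,j) = 1\<^sub>m n $$ (i,j)" .
  qed (use W in auto)
  moreover have "Matrix.col W 0 = (1 / l 0) \<cdot>\<^sub>v v"
    proof -
    have "ws ! 0 = v" using hd len n by (metis hd_conv_nth length_0_conv)
    then show ?thesis using n v(1) by (intro eq_vecI) (auto simp: W_def)
  qed
  ultimately show ?thesis using that W by blast
qed

text \<open>Induction on the size.  In an orthonormal basis that starts with an eigenvector, the first column
of the matrix is a multiple of the first unit vector.  By symmetry the same holds for the first row,
so the matrix splits off a block of size one.\<close>

theorem real_symmetric_diagonalization:
  fixes A :: "real mat"
  assumes "A \<in> carrier_mat n n" and "transpose_mat A = A"
  shows "\<exists>U e. U \<in> carrier_mat n n \<and> transpose_mat U * U = 1\<^sub>m n \<and> A * U = U * mat_diag n e"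
  using assms
proof (induction n arbitrary: A)
  case 0
  then show ?case by (intro exI[of _ "1\<^sub>m 0"] exI[of _ "\<lambda>_. 0"]) (auto intro!: eq_matI simp: mat_diag_def)
next
  case (Suc n)
  note A = Suc.prems(1) and sym = Suc.prems(2)
  obtain k where "eigenvalue A k" using symmetric_real_eigenvalue[OF A sym] by auto
  then obtain v where v: "v \<in> carrier_vec (Suc n)" "v \<noteq> 0\<^sub>v (Suc n)" "A *\<^sub>v v = k \<cdot>\<^sub>v v"
    unfolding eigenvalue_def eigenvector_def using A by auto
  obtain W c where W: "W \<in> carrier_mat (Suc n) (Suc n)" "transpose_mat W * W = 1\<^sub>m (Suc n)"
    "Matrix.col W 0 = c \<cdot>\<^sub>v v"
    using orthogonal_mat_with_first_column[OF v(1,2)] by blast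
  define V where "V = transpose_mat W"
  have V: "V \<in> carrier_mat (Suc n) (Suc n)" "V * W = 1\<^sub>m (Suc n)" "transpose_mat V = W"
    using W unfolding V_def by auto
  have WV: "W * V = 1\<^sub>m (Suc n)" using mat_mult_left_right_inverse V W by blast
  define B where "B = V * A * W"
  have B: "B \<in> carrier_mat (Suc n) (Suc n)" using V A W unfolding B_def by auto
  have symB: "transpose_mat B = B"
    unfolding B_def using V W A sym
    by (simp add: transpose_mult[of _ "Suc n" "Suc n" _ "Suc n"] assoc_mult_mat[of _ "Suc n" "Suc n" _ "Suc n" _ "Suc n"] mult_carrier_mat[of _ "Suc n" "Suc n" _ "Suc n"] V_def)
  have col0: "Matrix.col B 0 = k \<cdot>\<^sub>v unit_vec (Suc n) 0"
  proof -
    have Wv: "A *\<^sub>v Matrix.col W 0 = k \<cdot>\<^sub>v Matrix.col W 0"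
      using v W(3) A by (simp add: smult_smult_assoc mult.commute mult_mat_vec[of _ "Suc n" "Suc n"])
    have "Matrix.col B 0 = V *\<^sub>v (A *\<^sub>v Matrix.col W 0)"
      unfolding B_def using W(1) assoc_mult_mat_vec[OF V(1) A, of "Matrix.col W 0"]
        col_mult2[OF mult_carrier_mat[OF V(1) A] W(1), of 0] by (simp add: carrier_vecI)
    also have "\<dots> = k \<cdot>\<^sub>v (V *\<^sub>v Matrix.col W 0)" unfolding Wv
      using W(1) by (intro mult_mat_vec[OF V(1)]) (auto simp: carrier_vecI)
    also have "V *\<^sub>v Matrix.col W 0 = Matrix.col (V * W) 0"
      by (rule col_mult2[symmetric, OF V(1) W(1)]) simp
    finally show ?thesis using V by simp
  qed
  have Bi0: "B $$ (i,0) = (if i = 0 then k else 0)" if "i < Suc n" for i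
  proof -
    have "B $$ (i,0) = Matrix.col B 0 $ i" using B that by simp
    then show ?thesis unfolding col0 using that by simp
  qed
  have B0i: "B $$ (0,i) = (if i = 0 then k else 0)" if "i < Suc n" for i
    using Bi0[OF that] symB B that
    by (metis carrier_matD index_transpose_mat(1) zero_less_Suc)
  define B3 where "B3 = Matrix.mat n n (\<lambda>(i,j). B $$ (Suc i, Suc j))"
  have B3: "B3 \<in> carrier_mat n n" unfolding B3_def by simp
  have symB3: "transpose_mat B3 = B3"
    using symB B unfolding B3_def by (intro eq_matI) (auto, metis Suc_less_eq carrier_matD index_transpose_mat(1))
  have Bblock: "B = four_block_mat (mat_diag 1 (\<lambda>_. k)) (0\<^sub>m 1 n) (0\<^sub>m n 1) B3"
    using B Bi0 B0i unfolding B3_def by (intro eq_matI) (auto simp: mat_diag_def)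
  obtain U e where U: "U \<in> carrier_mat n n" "transpose_mat U * U = 1\<^sub>m n" "B3 * U = U * mat_diag n e"
    using Suc.IH[OF B3 symB3] by blast
  define U1 where "U1 = four_block_mat (1\<^sub>m 1) (0\<^sub>m 1 n) (0\<^sub>m n 1) U"
  have U1: "U1 \<in> carrier_mat (Suc n) (Suc n)" unfolding U1_def using U by auto
  have U1orth: "transpose_mat U1 * U1 = 1\<^sub>m (Suc n)"
    unfolding U1_def using U
    by (subst transpose_four_block_mat[of _ 1 1 _ n _ n], auto)
       (subst mult_four_block_mat[of _ 1 1 _ n _ n _ _ 1 _ n], auto)
  define f where "f i = (case i of 0 \<Rightarrow> k | Suc j \<Rightarrow> e j)" for i
  have D: "mat_diag (Suc n) f = four_block_mat (mat_diag 1 (\<lambda>_. k)) (0\<^sub>m 1 n) (0\<^sub>m n 1) (mat_diag n e)"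
    by (intro eq_matI) (auto simp: mat_diag_def f_def split: nat.splits)
  have BU: "B * U1 = U1 * mat_diag (Suc n) f"
    unfolding U1_def D Bblock using U B3
    by (subst (1 2) mult_four_block_mat[of _ 1 1 _ n _ n _ _ 1 _ n]) (auto simp: mat_diag_def)
  have "transpose_mat (W * U1) * (W * U1) = transpose_mat U1 * (V * W) * U1"
    using W(1) U1 V(1) unfolding V_def
    by (simp add: transpose_mult[of _ "Suc n" "Suc n" _ "Suc n"] assoc_mult_mat[of _ "Suc n" "Suc n" _ "Suc n" _ "Suc n"])
  then have "transpose_mat (W * U1) * (W * U1) = 1\<^sub>m (Suc n)" using V(2) U1 U1orth by simp
  moreover have "A * (W * U1) = W * U1 * mat_diag (Suc n) f"
  proof -
    have "A * (W * U1) = (W * V) * A * (W * U1)" using WV A by simp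
    also have "\<dots> = W * (B * U1)"
      unfolding B_def using W(1) V(1) A U1
      by (simp add: assoc_mult_mat[of _ "Suc n" "Suc n" _ "Suc n" _ "Suc n"] mult_carrier_mat[of _ "Suc n" "Suc n" _ "Suc n"])
    also have "\<dots> = W * U1 * mat_diag (Suc n) f" unfolding BU
      using W(1) U1 by (subst assoc_mult_mat[of _ "Suc n" "Suc n" _ "Suc n" _ "Suc n"]) auto
    finally show ?thesis .
  qed
  ultimately show ?case using W(1) U1 by (intro exI[of _ "W * U1"] exI[of _ f]) auto
qed


definition orthogonal_frame :: "real mat \<Rightarrow> nat \<Rightarrow> bool" where
  "orthogonal_frame U n \<longleftrightarrow>
     U \<in> carrier_mat n n \<and> transpose_mat U * U = 1\<^sub>m n \<and> U * transpose_mat U = 1\<^sub>m n"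

lemma spectral_decomposition:
  fixes A :: "real mat"
  assumes A: "A \<in> carrier_mat n n" "transpose_mat A = A"
  obtains U e where "orthogonal_frame U n"
    "A = U * mat_diag n e * transpose_mat U"
proof -
  from real_symmetric_diagonalization[OF A] obtain U e where
    U: "U \<in> carrier_mat n n" "transpose_mat U * U = 1\<^sub>m n" "A * U = U * mat_diag n e" by blast
  have UU: "U * transpose_mat U = 1\<^sub>m n" using mat_mult_left_right_inverse[of "transpose_mat U" n U] U by simp
  have "A = A * (U * transpose_mat U)" using UU A by simp
  also have "\<dots> = A * U * transpose_mat U" using A U(1) by (simp add: assoc_mult_mat[of _ n n _ n _ n] mult_carrier_mat[of _ n n _ n])
  finally have "A = U * mat_diag n e * transpose_mat U" using U(3) by simp
  then show ?thesis using that U UU unfolding orthogonal_frame_def by blast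
qed

text \<open>The matrix with eigenvalues \<open>f i\<close> and with the columns of the orthogonal matrix \<open>U\<close> as
eigenvectors.  For fixed \<open>U\<close> this turns products of functions into products of matrices, which is
how square roots are formed.\<close>

definition frame_diag :: "real mat \<Rightarrow> nat \<Rightarrow> (nat \<Rightarrow> real) \<Rightarrow> real mat" where
  "frame_diag U n f = U * mat_diag n f * transpose_mat U"

context
  fixes U :: "real mat" and n :: nat
  assumes frame: "orthogonal_frame U n"
begin

lemma U: "U \<in> carrier_mat n n" "transpose_mat U * U = 1\<^sub>m n" "U * transpose_mat U = 1\<^sub>m n"
  using frame unfolding orthogonal_frame_def by auto

lemma frame_diag_carrier: "frame_diag U n f \<in> carrier_mat n n"
  unfolding frame_diag_def using U by (meson mat_diag_dim mult_carrier_mat transpose_carrier_mat)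

lemma frame_diag_transpose: "transpose_mat (frame_diag U n f) = frame_diag U n f"
proof -
  have d: "transpose_mat (mat_diag n f) = mat_diag n f" by (rule eq_matI) (auto simp: mat_diag_def)
  show ?thesis unfolding frame_diag_def using U d mat_diag_dim[of n f]
    by (simp add: transpose_mult[of _ n n _ n] assoc_mult_mat[of _ n n _ n _ n] mult_carrier_mat[of _ n n _ n])
qed

lemma frame_diag_mult: "frame_diag U n f * frame_diag U n g = frame_diag U n (\<lambda>i. f i * g i)"
proof -
  have c: "transpose_mat U \<in> carrier_mat n n" "mat_diag n f \<in> carrier_mat n n" "mat_diag n g \<in> carrier_mat n n"
    using U by auto
  have "frame_diag U n f * frame_diag U n g
      = U * mat_diag n f * (transpose_mat U * U) * (mat_diag n g * transpose_mat U)"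
    unfolding frame_diag_def using U(1) c by (simp add: assoc_mult_mat[of _ n n _ n _ n] mult_carrier_mat[of _ n n _ n] del: mat_diag_diag)
  also have "\<dots> = U * (mat_diag n f * mat_diag n g) * transpose_mat U"
    using U c by (simp add: left_mult_one_mat[of _ n n] assoc_mult_mat[of _ n n _ n _ n] mult_carrier_mat[of _ n n _ n] del: mat_diag_diag)
  finally show ?thesis unfolding frame_diag_def by simp
qed

lemma frame_diag_form:
  assumes v: "v \<in> carrier_vec n"
  shows "v \<bullet> (frame_diag U n f *\<^sub>v v) = (\<Sum>i<n. f i * ((transpose_mat U *\<^sub>v v) $ i)\<^sup>2)"
proof -
  define w where "w = transpose_mat U *\<^sub>v v"
  have w: "w \<in> carrier_vec n" unfolding w_def using U v by simp
  have D: "mat_diag n f *\<^sub>v w = Matrix.vec n (\<lambda>i. f i * w $ i)"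
  proof (rule eq_vecI)
    fix i assume "i < dim_vec (Matrix.vec n (\<lambda>i. f i * w $ i))"
    then have i: "i < n" by simp
    have "(mat_diag n f *\<^sub>v w) $ i = (\<Sum>j\<in>{0..<n}. (if i = j then f j else 0) * w $ j)"
      using i w unfolding mat_diag_def by (simp add: scalar_prod_def)
    also have "\<dots> = (\<Sum>j\<in>{0..<n}. if j = i then f j * w $ j else 0)"
      by (rule sum.cong) auto
    finally show "(mat_diag n f *\<^sub>v w) $ i = Matrix.vec n (\<lambda>i. f i * w $ i) $ i"
      using i by simp
  qed (simp add: mat_diag_def)
  have "frame_diag U n f *\<^sub>v v = U *\<^sub>v (mat_diag n f *\<^sub>v w)"
    unfolding frame_diag_def w_def using U(1) v mat_diag_dim[of n f]
    by (simp add: assoc_mult_mat_vec[of _ n n _ n] del: assoc_mult_mat)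
  then have "v \<bullet> (frame_diag U n f *\<^sub>v v) = w \<bullet> (mat_diag n f *\<^sub>v w)"
    using transpose_vec_mult_scalar[OF U(1) _ v, of "mat_diag n f *\<^sub>v w"] w
    unfolding w_def[symmetric] by (simp add: D)
  then show ?thesis unfolding w_def[symmetric] D using w
    by (simp add: scalar_prod_def power2_eq_square atLeast0LessThan mult_ac)
qed

lemma frame_norm:
  assumes v: "v \<in> carrier_vec n"
  shows "v \<bullet> v = (\<Sum>i<n. ((transpose_mat U *\<^sub>v v) $ i)\<^sup>2)"
proof -
  have "frame_diag U n (\<lambda>_. 1) = 1\<^sub>m n" unfolding frame_diag_def using U by simp
  then show ?thesis using frame_diag_form[OF v, of "\<lambda>_. 1"] v by simp
qed

lemma frame_col:
  assumes i: "i < n"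
  shows "Matrix.col U i \<in> carrier_vec n" "transpose_mat U *\<^sub>v Matrix.col U i = unit_vec n i"
    "Matrix.col U i \<noteq> 0\<^sub>v n" "frame_diag U n f *\<^sub>v Matrix.col U i = f i \<cdot>\<^sub>v Matrix.col U i"
proof -
  show c: "Matrix.col U i \<in> carrier_vec n" using U by (simp add: carrier_vecI)
  have "transpose_mat U *\<^sub>v Matrix.col U i = Matrix.col (transpose_mat U * U) i"
    by (rule col_mult2[symmetric, OF _ U(1) i]) (use U in simp)
  then show u: "transpose_mat U *\<^sub>v Matrix.col U i = unit_vec n i" using U i by simp
  show "Matrix.col U i \<noteq> 0\<^sub>v n"
  proof
    assume "Matrix.col U i = 0\<^sub>v n"
    then have "unit_vec n i = (0\<^sub>v n :: real vec)" using u U(1) by (auto simp: scalar_prod_def mult_mat_vec_def zero_vec_def)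
    then show False using i by (metis index_unit_vec(1) index_zero_vec(1) zero_neq_one)
  qed
  have "mat_diag n f *\<^sub>v unit_vec n i = f i \<cdot>\<^sub>v unit_vec n i"
    using i by (intro eq_vecI) (auto simp: mat_diag_def scalar_prod_right_unit)
  moreover have "frame_diag U n f *\<^sub>v Matrix.col U i = U *\<^sub>v (mat_diag n f *\<^sub>v unit_vec n i)"
    unfolding frame_diag_def u[symmetric] using U(1) c mat_diag_dim[of n f]
    by (simp add: assoc_mult_mat_vec[of _ n n _ n] del: assoc_mult_mat)
  moreover have "U *\<^sub>v unit_vec n i = Matrix.col U i" using U(1) i by auto
  ultimately show "frame_diag U n f *\<^sub>v Matrix.col U i = f i \<cdot>\<^sub>v Matrix.col U i"
    using U(1) by (metis mult_mat_vec unit_vec_carrier)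
qed

end

lemma scalar_prod_self: "(v :: real vec) \<bullet> v = (\<Sum>i<dim_vec v. (v $ i)\<^sup>2)"
  by (simp add: scalar_prod_def power2_eq_square atLeast0LessThan)

lemma scalar_prod_self_pos:
  assumes "(v :: real vec) \<in> carrier_vec n" "v \<noteq> 0\<^sub>v n"
  shows "0 < v \<bullet> v"
proof -
  have "v \<bullet> v \<noteq> 0"
  proof
    assume "v \<bullet> v = 0"
    then have "\<forall>i\<in>{..<dim_vec v}. (v $ i)\<^sup>2 = 0" unfolding scalar_prod_self
      by (subst (asm) sum_nonneg_eq_0_iff) auto
    then have "v = 0\<^sub>v n" using assms(1) by (intro eq_vecI) auto
    with assms show False by simp
  qed
  moreover have "0 \<le> v \<bullet> v" unfolding scalar_prod_self by (rule sum_nonneg) auto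
  ultimately show ?thesis by simp
qed

lemma positive_definite_coercive:
  fixes A :: "real mat"
  assumes A: "A \<in> carrier_mat n n" "transpose_mat A = A"
    and pos: "\<And>v. v \<in> carrier_vec n \<Longrightarrow> v \<noteq> 0\<^sub>v n \<Longrightarrow> 0 < v \<bullet> (A *\<^sub>v v)"
  shows "\<exists>c>0. \<forall>v\<in>carrier_vec n. c * (v \<bullet> v) \<le> v \<bullet> (A *\<^sub>v v)"
proof -
  obtain U e where U: "orthogonal_frame U n"
    and Ae: "A = frame_diag U n e"
    using spectral_decomposition[OF A] unfolding frame_diag_def by metis
  have e: "0 < e i" if i: "i < n" for i
  proof -
    have "0 < Matrix.col U i \<bullet> (e i \<cdot>\<^sub>v Matrix.col U i)"
      using pos[OF frame_col(1,3)[OF U i]] frame_col(4)[OF U i] Ae by metis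
    then have "0 < e i * (Matrix.col U i \<bullet> Matrix.col U i)" using frame_col(1)[OF U i] by simp
    then show ?thesis using scalar_prod_self_pos[OF frame_col(1,3)[OF U i]]
      by (metis zero_less_mult_pos2)
  qed
  define c where "c = Min (insert 1 (e ` {..<n}))"
  have "0 < c" unfolding c_def using e by (subst Min_gr_iff) auto
  moreover have "c * (v \<bullet> v) \<le> v \<bullet> (A *\<^sub>v v)" if v: "v \<in> carrier_vec n" for v
    unfolding Ae frame_diag_form[OF U v] frame_norm[OF U v] sum_distrib_left
    by (intro sum_mono mult_right_mono) (auto simp: c_def intro!: Min_le)
  ultimately show ?thesis by blast
qed

lemma spd_frame_diag:
  assumes U: "orthogonal_frame U n"
    and f: "\<And>i. i < n \<Longrightarrow> 0 < f i"
  shows "spd_mat (frame_diag U n f)"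
proof -
  have c: "frame_diag U n f \<in> carrier_mat n n" using frame_diag_carrier U by blast
  have "0 < v \<bullet> (frame_diag U n f *\<^sub>v v)" if v: "v \<in> carrier_vec n" "v \<noteq> 0\<^sub>v n" for v
  proof -
    have "0 < (\<Sum>i<n. ((transpose_mat U *\<^sub>v v) $ i)\<^sup>2)"
      using scalar_prod_self_pos[OF v] frame_norm[OF U v(1)] by simp
    then obtain i where i: "i < n" "0 < ((transpose_mat U *\<^sub>v v) $ i)\<^sup>2"
      by (metis (no_types, lifting) lessThan_iff not_less sum_nonpos)
    have "0 < f i * ((transpose_mat U *\<^sub>v v) $ i)\<^sup>2" using i f by simp
    moreover have "0 \<le> f i * ((transpose_mat U *\<^sub>v v) $ i)\<^sup>2" if "i < n" for i
      using f[OF that] by simp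
    ultimately show ?thesis unfolding frame_diag_form[OF U v(1)]
      using i by (intro sum_pos2[of _ i]) auto
  qed
  then show ?thesis using c frame_diag_transpose[OF U] unfolding spd_mat_def by auto
qed

text \<open>The difference \<open>D = S - T\<close> satisfies \<open>S D + D T = 0\<close>.  Testing this with an eigenvector of
\<open>D\<close> for the eigenvalue \<open>e\<close> gives \<open>e (u \<bullet> S u + u \<bullet> T u) = 0\<close>, so all eigenvalues of \<open>D\<close>
vanish.\<close>

lemma spd_mat_sqrt_unique:
  assumes S: "spd_mat S" and T: "spd_mat T" and eq: "S * S = T * T"
  shows "S = T"
proof -
  define n where "n = dim_row S"
  have Sc: "S \<in> carrier_mat n n" using S unfolding spd_mat_def n_def by auto
  have "dim_row T = n" using arg_cong[OF eq, of dim_row] unfolding n_def by simp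
  then have Tc: "T \<in> carrier_mat n n" using T unfolding spd_mat_def by auto
  define D where "D = S - T"
  have Dc: "D \<in> carrier_mat n n" unfolding D_def using Sc Tc by (simp add: minus_carrier_mat)
  have "transpose_mat D = transpose_mat S - transpose_mat T"
    unfolding D_def using Sc Tc by (intro eq_matI) auto
  then have sym: "transpose_mat D = D" using S T unfolding spd_mat_def D_def by simp
  obtain U e where U: "orthogonal_frame U n"
    and De: "D = frame_diag U n e"
    using spectral_decomposition[OF Dc sym] unfolding frame_diag_def by metis
  have "e i = 0" if i: "i < n" for i
  proof -
    define u where "u = Matrix.col U i"
    note fc = frame_col[OF U i, folded u_def]
    have u: "u \<in> carrier_vec n" "u \<noteq> 0\<^sub>v n" "D *\<^sub>v u = e i \<cdot>\<^sub>v u" using fc De by auto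
    have "S * D + D * T = S * S - S * T + (S * T - T * T)"
      unfolding D_def using Sc Tc by (simp add: mult_minus_distrib_mat[of _ n n _ n] minus_mult_distrib_mat[of _ n n _ _ n])
    also have "\<dots> = 0\<^sub>m n n" using Sc Tc eq by (intro eq_matI) auto
    finally have z: "S * D + D * T = 0\<^sub>m n n" .
    have "0 = u \<bullet> ((S * D + D * T) *\<^sub>v u)" using u unfolding z
      by (auto simp: scalar_prod_def mult_mat_vec_def)
    also have "\<dots> = u \<bullet> (S *\<^sub>v (D *\<^sub>v u)) + u \<bullet> (D *\<^sub>v (T *\<^sub>v u))"
      using Sc Tc Dc u(1) by (simp add: add_mult_distrib_mat_vec[of _ n n] scalar_prod_add_distrib[of _ n] assoc_mult_mat_vec[of _ n n _ n])
    also have "u \<bullet> (D *\<^sub>v (T *\<^sub>v u)) = (D *\<^sub>v u) \<bullet> (T *\<^sub>v u)"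
      using transpose_vec_mult_scalar[OF Dc _ u(1), of "T *\<^sub>v u"] sym Tc u(1) by simp
    finally have "0 = e i * (u \<bullet> (S *\<^sub>v u) + u \<bullet> (T *\<^sub>v u))"
      unfolding u(3) using Sc Tc u(1) by (simp add: mult_mat_vec[of _ n n] distrib_left)
    moreover have "0 < u \<bullet> (S *\<^sub>v u)" "0 < u \<bullet> (T *\<^sub>v u)"
      using S T Sc Tc u unfolding spd_mat_def by auto
    ultimately show ?thesis by simp
  qed
  then have "mat_diag n e = 0\<^sub>m n n" by (intro eq_matI) (auto simp: mat_diag_def)
  then have "D = 0\<^sub>m n n" unfolding De frame_diag_def using U unfolding orthogonal_frame_def by auto
  then show ?thesis unfolding D_def using Sc Tc
    by (intro eq_matI) (auto, metis carrier_matD index_minus_mat(1) index_zero_mat(1) right_minus_eq)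
qed

text \<open>The description that defines \<^const>\<open>spd_sqrt\<close> is proper: existence comes from the spectral
decomposition.\<close>

lemma spd_sqrt_props:
  assumes A: "spd_mat A"
  shows "spd_mat (spd_sqrt A)" "spd_sqrt A * spd_sqrt A = A"
proof -
  define n where "n = dim_row A"
  have Ac: "A \<in> carrier_mat n n" "transpose_mat A = A" using A unfolding spd_mat_def n_def by auto
  obtain U e where U: "orthogonal_frame U n"
    and Ae: "A = frame_diag U n e"
    using spectral_decomposition[OF Ac] unfolding frame_diag_def by metis
  have e: "0 < e i" if i: "i < n" for i
  proof -
    have "0 < Matrix.col U i \<bullet> (e i \<cdot>\<^sub>v Matrix.col U i)"
      using A frame_col(1-3)[OF U i] frame_col(4)[OF U i, of e] Ac Ae unfolding spd_mat_def by auto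
    then have "0 < e i * (Matrix.col U i \<bullet> Matrix.col U i)" using frame_col(1)[OF U i] by simp
    then show ?thesis using scalar_prod_self_pos[OF frame_col(1,3)[OF U i]]
      by (metis zero_less_mult_pos2)
  qed
  define S where "S = frame_diag U n (\<lambda>i. sqrt (e i))"
  have "spd_mat S" unfolding S_def using e by (intro spd_frame_diag[OF U]) auto
  moreover have "S * S = A"
  proof -
    have "mat_diag n (\<lambda>i. sqrt (e i) * sqrt (e i)) = mat_diag n e"
      using e by (intro eq_matI) (auto simp: mat_diag_def less_imp_le)
    then show ?thesis unfolding S_def frame_diag_mult[OF U] Ae by (simp add: frame_diag_def)
  qed
  ultimately have ex: "\<exists>!S. spd_mat S \<and> S * S = A" using spd_mat_sqrt_unique by metis
  then show "spd_mat (spd_sqrt A)" "spd_sqrt A * spd_sqrt A = A"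
    unfolding spd_sqrt_def using theI'[OF ex] by auto
qed

section \<open>Two-sided bounds on quadratic forms\<close>

definition form_bounds :: "nat \<Rightarrow> real mat \<Rightarrow> real \<Rightarrow> real \<Rightarrow> bool" where
  "form_bounds n A a b \<longleftrightarrow> A \<in> carrier_mat n n \<and> transpose_mat A = A \<and>
     (\<forall>v\<in>carrier_vec n. a * (v \<bullet> v) \<le> v \<bullet> (A *\<^sub>v v) \<and> v \<bullet> (A *\<^sub>v v) \<le> b * (v \<bullet> v))"

lemma form_bounds_spd:
  assumes "form_bounds n A a b" "0 < a"
  shows "spd_mat A"
  using assms scalar_prod_self_pos unfolding form_bounds_def spd_mat_def
  by (auto, metis less_le_trans mult_pos_pos)

lemma scalar_prod_mult_mat_vec:
  fixes A :: "real mat"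
  assumes "A \<in> carrier_mat n n" "v \<in> carrier_vec n"
  shows "v \<bullet> (A *\<^sub>v v) = (\<Sum>i<n. \<Sum>j<n. v $ i * v $ j * A $$ (i, j))"
proof -
  have "v \<bullet> (A *\<^sub>v v) = (\<Sum>i<n. v $ i * (\<Sum>j<n. A $$ (i, j) * v $ j))"
    using assms by (simp add: scalar_prod_def atLeast0LessThan)
  then show ?thesis by (simp add: sum_distrib_left mult_ac)
qed

lemma form_boundsI:
  assumes "A \<in> carrier_mat n n" "\<And>i j. i < n \<Longrightarrow> j < n \<Longrightarrow> A $$ (i, j) = A $$ (j, i)"
    and "\<And>c :: nat \<Rightarrow> real. a * (\<Sum>i<n. (c i)\<^sup>2) \<le> (\<Sum>i<n. \<Sum>j<n. c i * c j * A $$ (i, j)) \<and>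
       (\<Sum>i<n. \<Sum>j<n. c i * c j * A $$ (i, j)) \<le> b * (\<Sum>i<n. (c i)\<^sup>2)"
  shows "form_bounds n A a b"
  unfolding form_bounds_def
proof (intro conjI ballI)
  show "transpose_mat A = A" using assms(1,2) by (intro eq_matI) auto
  fix v :: "real vec" assume v: "v \<in> carrier_vec n"
  show "a * (v \<bullet> v) \<le> v \<bullet> (A *\<^sub>v v)" "v \<bullet> (A *\<^sub>v v) \<le> b * (v \<bullet> v)"
    using assms(3)[of "\<lambda>i. v $ i"] v
    unfolding scalar_prod_mult_mat_vec[OF assms(1) v] scalar_prod_self by auto
qed (rule assms(1))

lemma form_boundsD:
  assumes "form_bounds n A a b"
  shows "A \<in> carrier_mat n n" "\<And>i j. i < n \<Longrightarrow> j < n \<Longrightarrow> A $$ (i, j) = A $$ (j, i)"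
    "a * (\<Sum>i<n. (c i)\<^sup>2) \<le> (\<Sum>i<n. \<Sum>j<n. c i * c j * A $$ (i, j))"
    "(\<Sum>i<n. \<Sum>j<n. c i * c j * A $$ (i, j)) \<le> b * (\<Sum>i<n. (c i)\<^sup>2)"
proof -
  show A: "A \<in> carrier_mat n n" using assms unfolding form_bounds_def by simp
  have "transpose_mat A = A" using assms unfolding form_bounds_def by simp
  then show "A $$ (i, j) = A $$ (j, i)" if "i < n" "j < n" for i j
    using that A by (metis carrier_matD index_transpose_mat(1))
  define v where "v = Matrix.vec n c"
  have v: "v \<in> carrier_vec n" unfolding v_def by simp
  have "a * (v \<bullet> v) \<le> v \<bullet> (A *\<^sub>v v)" "v \<bullet> (A *\<^sub>v v) \<le> b * (v \<bullet> v)"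
    using assms v unfolding form_bounds_def by auto
  then show "a * (\<Sum>i<n. (c i)\<^sup>2) \<le> (\<Sum>i<n. \<Sum>j<n. c i * c j * A $$ (i, j))"
    "(\<Sum>i<n. \<Sum>j<n. c i * c j * A $$ (i, j)) \<le> b * (\<Sum>i<n. (c i)\<^sup>2)"
    unfolding scalar_prod_mult_mat_vec[OF A v] scalar_prod_self by (simp_all add: v_def)
qed

lemma quadratic_form_unit:
  fixes A :: "real mat"
  assumes "i < n"
  shows "(\<Sum>k<n. \<Sum>l<n. (if k = i then 1 else 0) * (if l = i then 1 else 0) * A $$ (k, l)) = A $$ (i, i)"
    "(\<Sum>k<n. ((if k = i then 1 else 0 :: real))\<^sup>2) = 1"
proof -
  have "(\<Sum>l<n. (if k = i then 1 else 0) * (if l = i then 1 else 0) * A $$ (k, l)) = (if k = i then A $$ (i, i) else 0)" for k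
  proof -
    have "(\<Sum>l<n. (if k = i then 1 else 0) * (if l = i then 1 else 0) * A $$ (k, l))
        = (\<Sum>l<n. if l = i then (if k = i then A $$ (i, i) else 0) else 0)"
      by (intro sum.cong) auto
    then show ?thesis using assms by simp
  qed
  then show "(\<Sum>k<n. \<Sum>l<n. (if k = i then 1 else 0) * (if l = i then 1 else 0) * A $$ (k, l)) = A $$ (i, i)"
    using assms by simp
  have "(\<Sum>k<n. ((if k = i then 1 else 0 :: real))\<^sup>2) = (\<Sum>k<n. if k = i then 1 else 0)"
    by (intro sum.cong refl) auto
  then show "(\<Sum>k<n. ((if k = i then 1 else 0 :: real))\<^sup>2) = 1" using assms by simp
qed

text \<open>The scaling vector has the entries \<open>s i = sqrt (M\<^sub>i\<^sub>i / R\<^sub>i\<^sub>i)\<close>.  Comparing the forms of \<open>M\<close>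
and \<open>R\<close> on unit vectors gives \<open>d1 \<le> (s i)\<^sup>2 \<le> d2\<close>, so rescaling the variables of \<open>R\<close> costs
at most these factors.\<close>

lemma diag_scaled_form_bounds:
  assumes R: "form_bounds n R r1 r2" "0 < r1" and M: "M \<in> carrier_mat n n" and d1: "0 < d1" and r2: "0 \<le> r2"
    and MR: "\<And>c. d1 * (\<Sum>i<n. \<Sum>j<n. c i * c j * R $$ (i, j)) \<le> (\<Sum>i<n. \<Sum>j<n. c i * c j * M $$ (i, j)) \<and>
       (\<Sum>i<n. \<Sum>j<n. c i * c j * M $$ (i, j)) \<le> d2 * (\<Sum>i<n. \<Sum>j<n. c i * c j * R $$ (i, j))"
  shows "form_bounds n (sqrt_diag M * inv_sqrt_diag R * R * inv_sqrt_diag R * sqrt_diag M) (d1 * r1) (d2 * r2)"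
proof -
  note RD = form_boundsD[OF R(1)]
  define s where "s i = sqrt (M $$ (i, i)) / sqrt (R $$ (i, i))" for i
  have diag: "0 < R $$ (i, i)" "d1 * R $$ (i, i) \<le> M $$ (i, i)" "M $$ (i, i) \<le> d2 * R $$ (i, i)" if "i < n" for i
    using RD(3)[of "\<lambda>k. if k = i then 1 else 0"] MR[of "\<lambda>k. if k = i then 1 else 0"] R(2)
    unfolding quadratic_form_unit[OF that] by auto
  have s2: "d1 \<le> (s i)\<^sup>2 \<and> (s i)\<^sup>2 \<le> d2" if i: "i < n" for i
  proof -
    have "0 \<le> M $$ (i, i)" using diag[OF i] d1 by (meson less_imp_le mult_nonneg_nonneg order_trans)
    then have s: "(s i)\<^sup>2 = M $$ (i, i) / R $$ (i, i)"
      unfolding s_def power_divide using diag(1)[OF i] by simp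
    show ?thesis unfolding s using diag[OF i] by (simp add: pos_le_divide_eq pos_divide_le_eq)
  qed
  have c: "R \<in> carrier_mat n n" by (rule RD(1))
  have sq: "sqrt_diag M = mat_diag n (\<lambda>i. sqrt (M $$ (i, i)))"
    unfolding sqrt_diag_def mat_diag_def using M by (intro eq_matI) auto
  have isq: "inv_sqrt_diag R = mat_diag n (\<lambda>i. 1 / sqrt (R $$ (i, i)))"
    unfolding inv_sqrt_diag_def mat_diag_def using c by (intro eq_matI) auto
  let ?P = "sqrt_diag M * inv_sqrt_diag R * R * inv_sqrt_diag R * sqrt_diag M"
  have P: "?P = Matrix.mat n n (\<lambda>(i, j). s i * R $$ (i, j) * s j)"
    unfolding sq isq mat_diag_diag using c
    by (subst mat_diag_mult_left[of _ n n], simp)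
       (subst mat_diag_mult_right[of _ n n], simp,
        subst mat_diag_mult_right[of _ n n], simp,
        intro eq_matI, auto simp: s_def)
  show ?thesis
  proof (rule form_boundsI)
    show "?P \<in> carrier_mat n n" unfolding P by simp
    show "?P $$ (i, j) = ?P $$ (j, i)" if "i < n" "j < n" for i j
      unfolding P using that RD(2)[of i j] by simp
    fix c :: "nat \<Rightarrow> real"
    let ?Q = "(\<Sum>i<n. \<Sum>j<n. c i * c j * ?P $$ (i, j))"
    have e: "?Q = (\<Sum>i<n. \<Sum>j<n. (s i * c i) * (s j * c j) * R $$ (i, j))"
      unfolding P by (intro sum.cong refl) simp
    have s: "d1 * (\<Sum>i<n. (c i)\<^sup>2) \<le> (\<Sum>i<n. (s i * c i)\<^sup>2)" "(\<Sum>i<n. (s i * c i)\<^sup>2) \<le> d2 * (\<Sum>i<n. (c i)\<^sup>2)"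
      unfolding sum_distrib_left power_mult_distrib using s2 by (auto intro!: sum_mono mult_right_mono)
    have "d1 * r1 * (\<Sum>i<n. (c i)\<^sup>2) = r1 * (d1 * (\<Sum>i<n. (c i)\<^sup>2))" by simp
    also have "\<dots> \<le> r1 * (\<Sum>i<n. (s i * c i)\<^sup>2)" using s(1) R(2) by (intro mult_left_mono) auto
    also have "\<dots> \<le> ?Q" unfolding e by (rule RD(3))
    finally have lo: "d1 * r1 * (\<Sum>i<n. (c i)\<^sup>2) \<le> ?Q" .
    have "?Q \<le> r2 * (\<Sum>i<n. (s i * c i)\<^sup>2)" unfolding e by (rule RD(4))
    also have "\<dots> \<le> r2 * (d2 * (\<Sum>i<n. (c i)\<^sup>2))" using s(2) r2 by (intro mult_left_mono) auto
    also have "\<dots> = d2 * r2 * (\<Sum>i<n. (c i)\<^sup>2)" by simp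
    finally show "d1 * r1 * (\<Sum>i<n. (c i)\<^sup>2) \<le> ?Q \<and>
       ?Q \<le> d2 * r2 * (\<Sum>i<n. (c i)\<^sup>2)"
      using lo by blast
  qed
qed


text \<open>For an eigenvector \<open>v\<close> of \<open>S M S\<close>, where \<open>S\<^sup>2 = A\<close>, put \<open>w = S v\<close>.  The eigenvalue times
\<open>v \<bullet> v\<close> is \<open>w \<bullet> M w\<close>, and \<open>w \<bullet> w = v \<bullet> A v\<close>.  Thus every eigenvalue lies between the products
of the lower and of the upper bounds.\<close>

lemma cond_number_bound:
  assumes A: "form_bounds n A a1 a2" "0 < a1" and M: "form_bounds n M b1 b2" "0 < b1" and n: "0 < n"
  shows "cond_number (spd_sqrt A * M * spd_sqrt A) \<le> (a2 * b2) / (a1 * b1)"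
proof -
  define S where "S = spd_sqrt A"
  note sq = spd_sqrt_props[OF form_bounds_spd[OF A], folded S_def]
  have Ac: "A \<in> carrier_mat n n" and Mc: "M \<in> carrier_mat n n" and symM: "transpose_mat M = M"
    using A M unfolding form_bounds_def by auto
  have "dim_row S = n" using arg_cong[OF sq(2), of dim_row] Ac by simp
  then have Sc: "S \<in> carrier_mat n n" and symS: "transpose_mat S = S"
    using sq(1) unfolding spd_mat_def by auto
  define B where "B = S * M * S"
  have Bc: "B \<in> carrier_mat n n" unfolding B_def using Sc Mc by simp
  have symB: "transpose_mat B = B"
    unfolding B_def using Sc Mc symS symM
    by (simp add: transpose_mult[of _ n n _ n] assoc_mult_mat[of _ n n _ n _ n] mult_carrier_mat[of _ n n _ n])
  have ev: "a1 * b1 \<le> l \<and> l \<le> a2 * b2" if "l \<in> spectrum B" for l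
  proof -
    from that obtain v where v: "v \<in> carrier_vec n" "v \<noteq> 0\<^sub>v n" "B *\<^sub>v v = l \<cdot>\<^sub>v v"
      unfolding spectrum_def eigenvalue_def eigenvector_def using Bc by auto
    define w where "w = S *\<^sub>v v"
    have w: "w \<in> carrier_vec n" unfolding w_def using Sc v by simp
    have vv: "0 < v \<bullet> v" using scalar_prod_self_pos[OF v(1,2)] .
    have "B *\<^sub>v v = S *\<^sub>v (M *\<^sub>v w)"
      unfolding B_def w_def using Sc Mc v(1) by (simp add: assoc_mult_mat_vec[of _ n n _ n])
    then have "S *\<^sub>v (M *\<^sub>v w) = l \<cdot>\<^sub>v v" using v by simp
    then have "v \<bullet> (S *\<^sub>v (M *\<^sub>v w)) = l * (v \<bullet> v)" using v(1) by simp
    then have wM: "w \<bullet> (M *\<^sub>v w) = l * (v \<bullet> v)"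
      using transpose_vec_mult_scalar[OF Sc _ v(1), of "M *\<^sub>v w"] symS Mc w Sc v(1)
      by (metis (no_types, lifting) mult_mat_vec_carrier transpose_vec_mult_scalar w_def)
    have "v \<bullet> (A *\<^sub>v v) = v \<bullet> (S *\<^sub>v w)"
      unfolding sq(2)[symmetric] w_def using Sc v(1) by (simp add: assoc_mult_mat_vec[of _ n n _ n])
    also have "\<dots> = w \<bullet> w"
      using transpose_vec_mult_scalar[OF Sc w v(1)] symS Sc v(1) w
      by (metis transpose_vec_mult_scalar w_def)
    finally have wA: "w \<bullet> w = v \<bullet> (A *\<^sub>v v)" by simp
    have aw: "a1 * (v \<bullet> v) \<le> w \<bullet> w" "w \<bullet> w \<le> a2 * (v \<bullet> v)"
      using A(1) v(1) wA unfolding form_bounds_def by auto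
    have bw: "b1 * (w \<bullet> w) \<le> l * (v \<bullet> v)" "l * (v \<bullet> v) \<le> b2 * (w \<bullet> w)"
      using M(1) w wM unfolding form_bounds_def by auto
    have ww: "0 < w \<bullet> w" using aw(1) A(2) vv by (meson less_le_trans mult_pos_pos)
    have "b1 * (w \<bullet> w) \<le> b2 * (w \<bullet> w)" using bw by simp
    then have b2: "0 < b2" using M(2) ww by auto
    have "a1 * b1 * (v \<bullet> v) \<le> b1 * (w \<bullet> w)" using mult_left_mono[OF aw(1), of b1] M(2) by (simp add: mult_ac)
    then have 1: "a1 * b1 * (v \<bullet> v) \<le> l * (v \<bullet> v)" using bw by simp
    have "b2 * (w \<bullet> w) \<le> a2 * b2 * (v \<bullet> v)" using mult_left_mono[OF aw(2), of b2] b2 by (simp add: mult_ac)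
    then have 2: "l * (v \<bullet> v) \<le> a2 * b2 * (v \<bullet> v)" using bw by simp
    show ?thesis using 1 2 vv by simp
  qed
  have fin: "finite (spectrum B)" using card_finite_spectrum[OF Bc] by simp
  \<comment> \<open>Without eigenvalues the maximum and the minimum would be unspecified.\<close>
  have ne: "spectrum B \<noteq> {}" using symmetric_real_eigenvalue[OF Bc symB] n unfolding spectrum_def by auto
  have mx: "Max (spectrum B) \<le> a2 * b2" and mn: "a1 * b1 \<le> Min (spectrum B)"
    using ev fin ne by auto
  have p: "0 < a1 * b1" using A M by simp
  have "0 \<le> Max (spectrum B)" using Max_in[OF fin ne] ev p by (meson less_le_trans less_imp_le)
  then show ?thesis unfolding cond_number_def S_def[symmetric] B_def[symmetric]
    using mx mn p by (intro frac_le) auto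
qed

text \<open>With \<open>u = A\<^bsup>-1\<^esup> w\<close>, evaluate the form of \<open>A\<close> at \<open>u - w / b\<close> for the lower bound, and the
square norm of \<open>u - w / a\<close> for the upper bound.\<close>

lemma form_bounds_inverse:
  assumes A: "form_bounds n A a b" and a: "0 < a" and b: "0 < b"
  shows "\<exists>B. mat_inverse A = Some B \<and> form_bounds n B (1 / b) (1 / a)"
proof -
  have Ac: "A \<in> carrier_mat n n" and sym: "transpose_mat A = A"
    using A unfolding form_bounds_def by auto
  have "Determinant.det A \<noteq> 0"
  proof
    assume "Determinant.det A = 0"
    then obtain v where v: "v \<in> carrier_vec n" "v \<noteq> 0\<^sub>v n" "A *\<^sub>v v = 0\<^sub>v n"
      using det_0_iff_vec_prod_zero_field[OF Ac] by auto
    have "a * (v \<bullet> v) \<le> v \<bullet> (A *\<^sub>v v)" using A v(1) unfolding form_bounds_def by auto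
    then show False using scalar_prod_self_pos[OF v(1,2)] a v(1,3)
      by (simp add: mult_le_0_iff)
  qed
  then have unit: "A \<in> Units (ring_mat TYPE(real) n ())" by (rule det_non_zero_imp_unit[OF Ac])
  have "mat_inverse A \<noteq> None"
  proof
    assume "mat_inverse A = None"
    then have "A \<notin> Units (ring_mat TYPE(real) n ())" by (rule mat_inverse(1)[OF Ac])
    with unit show False by contradiction
  qed
  then obtain B where B: "mat_inverse A = Some B" by blast
  note Bp = mat_inverse(2)[OF Ac B]
  have Bc: "B \<in> carrier_mat n n" using Bp by blast
  have "transpose_mat B * A = 1\<^sub>m n"
    using Bp Ac Bc sym transpose_mult[OF Ac Bc] by simp
  then have "transpose_mat B * (A * B) = B" using Bc Ac
    by (subst assoc_mult_mat[symmetric, of _ n n _ n _ n]) auto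
  then have symB: "transpose_mat B = B" using Bp Bc by simp
  have bnd: "1 / b * (w \<bullet> w) \<le> w \<bullet> (B *\<^sub>v w) \<and> w \<bullet> (B *\<^sub>v w) \<le> 1 / a * (w \<bullet> w)"
    if w: "w \<in> carrier_vec n" for w
  proof -
    define u where "u = B *\<^sub>v w"
    have u: "u \<in> carrier_vec n" unfolding u_def using Bc w by simp
    have Au: "A *\<^sub>v u = w" unfolding u_def using Bp Ac w assoc_mult_mat_vec[OF Ac Bc w] by simp
    have key: "(u - c \<cdot>\<^sub>v w) \<bullet> (A *\<^sub>v (u - c \<cdot>\<^sub>v w)) = w \<bullet> u - 2 * c * (w \<bullet> w) + c\<^sup>2 * (w \<bullet> (A *\<^sub>v w))" for c
    proof -
      have e: "A *\<^sub>v (u - c \<cdot>\<^sub>v w) = w - c \<cdot>\<^sub>v (A *\<^sub>v w)"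
        using Ac u w Au by (simp add: mult_minus_distrib_mat_vec[of _ n n] mult_mat_vec[of _ n n])
      have s: "u \<bullet> (A *\<^sub>v w) = w \<bullet> w"
        using transpose_vec_mult_scalar[OF Ac w u] sym Au by simp
      have Aw: "A *\<^sub>v w \<in> carrier_vec n" using Ac w by simp
      show ?thesis unfolding e using u w Aw s comm_scalar_prod[OF u w]
        by (simp add: minus_scalar_prod_distrib[of _ n] scalar_prod_minus_distrib[of _ n] power2_eq_square algebra_simps)
    qed
    have ub: "w \<bullet> (A *\<^sub>v w) \<le> b * (w \<bullet> w)" using A w unfolding form_bounds_def by auto
    have pos: "0 \<le> v \<bullet> (A *\<^sub>v v) - a * (v \<bullet> v)" if "v \<in> carrier_vec n" for v
      using A that unfolding form_bounds_def by auto
    have nn: "0 \<le> v \<bullet> v" for v :: "real vec" unfolding scalar_prod_self by (rule sum_nonneg) auto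
    have "0 \<le> (u - (1/b) \<cdot>\<^sub>v w) \<bullet> (A *\<^sub>v (u - (1/b) \<cdot>\<^sub>v w))"
    proof -
      have "u - (1/b) \<cdot>\<^sub>v w \<in> carrier_vec n" using u w by simp
      from pos[OF this] mult_nonneg_nonneg[OF less_imp_le[OF a] nn[of "u - (1/b) \<cdot>\<^sub>v w"]]
      show ?thesis by linarith
    qed
    also have "\<dots> \<le> w \<bullet> u - 2 * (1/b) * (w \<bullet> w) + (1/b)\<^sup>2 * (b * (w \<bullet> w))"
      unfolding key using ub by (intro add_left_mono mult_left_mono) auto
    also have "\<dots> = w \<bullet> u - 1 / b * (w \<bullet> w)" using b by (simp add: power2_eq_square field_simps)
    finally have 1: "1 / b * (w \<bullet> w) \<le> w \<bullet> u" by simp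
    have "a * (u \<bullet> u) \<le> u \<bullet> w" using pos[OF u] Au by simp
    moreover have "0 \<le> (u - (1/a) \<cdot>\<^sub>v w) \<bullet> (u - (1/a) \<cdot>\<^sub>v w)" by (rule nn)
    then have "0 \<le> u \<bullet> u - 2 / a * (w \<bullet> u) + (1/a)\<^sup>2 * (w \<bullet> w)"
      using u w comm_scalar_prod[OF u w]
      by (simp add: minus_scalar_prod_distrib[of _ n] scalar_prod_minus_distrib[of _ n] power2_eq_square algebra_simps)
    then have "0 \<le> a * (u \<bullet> u - 2 / a * (w \<bullet> u) + (1/a)\<^sup>2 * (w \<bullet> w))" using a by simp
    then have "2 * (w \<bullet> u) \<le> a * (u \<bullet> u) + 1 / a * (w \<bullet> w)" using a
      by (simp add: power2_eq_square algebra_simps)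
    ultimately have 2: "w \<bullet> u \<le> 1 / a * (w \<bullet> w)" using comm_scalar_prod[OF u w] by simp
    show ?thesis using 1 2 unfolding u_def by simp
  qed
  show ?thesis using B Bc symB bnd unfolding form_bounds_def by blast
qed

section \<open>An inverse inequality for polynomials\<close>

lemma integral_poly_sq_rescale:
  fixes q :: "real poly"
  assumes "a < b"
  shows "integral {a..b} (\<lambda>x. (poly q x)\<^sup>2) = (b - a) * integral {0..1} (\<lambda>x. (poly (pcompose q [:a, b - a:]) x)\<^sup>2)"
proof -
  have "((\<lambda>x. (poly q x)\<^sup>2) has_integral integral {a..b} (\<lambda>x. (poly q x)\<^sup>2)) (cbox a b)"
    unfolding interval_cbox[symmetric] cbox_interval
    by (intro integrable_integral integrable_continuous_interval continuous_intros)
  from has_integral_affinity'[OF this, of "b - a" a]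
  have "((\<lambda>x. (poly q ((b - a) * x + a))\<^sup>2) has_integral integral {a..b} (\<lambda>x. (poly q x)\<^sup>2) / (b - a)) {0..1}"
    using assms by (simp add: field_simps)
  from integral_unique[OF this] show ?thesis
    using assms by (simp add: poly_pcompose mult.commute add.commute)
qed

lemma poly_sq_integral_pos:
  fixes q :: "real poly"
  assumes "q \<noteq> 0"
  shows "0 < integral {0..1} (\<lambda>x. (poly q x)\<^sup>2)"
proof -
  have cont: "continuous_on {0..1} (\<lambda>x. (poly q x)\<^sup>2)" by (intro continuous_intros)
  have int: "(\<lambda>x. (poly q x)\<^sup>2) integrable_on {0..1::real}"
    using cont by (rule integrable_continuous_interval)
  have "integral {0..1} (\<lambda>x. (poly q x)\<^sup>2) \<noteq> 0"
  proof
    assume z: "integral {0..1} (\<lambda>x. (poly q x)\<^sup>2) = 0"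
    have "((\<lambda>x. (poly q x)\<^sup>2) has_integral 0) (cbox 0 1)"
      using integrable_integral[OF int] z by simp
    then have "(poly q x)\<^sup>2 = 0" if "x \<in> cbox 0 1" for x :: real
      by (rule has_integral_0_cbox_imp_0[rotated 2]) (use cont that in auto)
    then have "{0..1} \<subseteq> {x. poly q x = 0}" by auto
    then have "finite {0..1::real}" using poly_roots_finite[OF assms] finite_subset by blast
    then show False using infinite_Icc[of 0 "1::real"] by simp
  qed
  moreover have "0 \<le> integral {0..1} (\<lambda>x. (poly q x)\<^sup>2)"
    by (rule integral_nonneg[OF int]) auto
  ultimately show ?thesis by simp
qed

lemma positive_definite_form_coercive:
  fixes G :: "nat \<Rightarrow> nat \<Rightarrow> real"
  assumes "\<And>i j. G i j = G j i"
    and "\<And>v. (\<exists>i<n. v i \<noteq> 0) \<Longrightarrow> 0 < (\<Sum>i<n. \<Sum>j<n. v i * G i j * v j)"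
  shows "\<exists>c>0. \<forall>v. c * (\<Sum>i<n. (v i)\<^sup>2) \<le> (\<Sum>i<n. \<Sum>j<n. v i * G i j * v j)"
proof -
  define A where "A = Matrix.mat n n (\<lambda>(i, j). G i j)"
  have A: "A \<in> carrier_mat n n" "transpose_mat A = A"
    unfolding A_def using assms(1) by (auto intro!: eq_matI)
  have form: "scalar_prod v (A *\<^sub>v v) = (\<Sum>i<n. \<Sum>j<n. v $ i * G i j * v $ j)" if "v \<in> carrier_vec n" for v
    using that unfolding A_def
    by (simp add: scalar_prod_def atLeast0LessThan sum_distrib_left mult.assoc)
  have "0 < scalar_prod v (A *\<^sub>v v)" if v: "v \<in> carrier_vec n" "v \<noteq> 0\<^sub>v n" for v
  proof -
    have "\<exists>i<n. v $ i \<noteq> 0" using v by (metis carrier_vecD eq_vecI index_zero_vec)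
    then show ?thesis unfolding form[OF v(1)] by (rule assms(2))
  qed
  from positive_definite_coercive[OF A this] obtain c where
    c: "0 < c" "\<And>v. v \<in> carrier_vec n \<Longrightarrow> c * (scalar_prod v v) \<le> scalar_prod v (A *\<^sub>v v)" by blast
  have "c * (\<Sum>i<n. (v i)\<^sup>2) \<le> (\<Sum>i<n. \<Sum>j<n. v i * G i j * v j)" for v
  proof -
    define w where "w = Matrix.vec n v"
    have w: "w \<in> carrier_vec n" unfolding w_def by simp
    show ?thesis using c(2)[OF w] unfolding form[OF w] scalar_prod_self by (simp add: w_def)
  qed
  then show ?thesis using c(1) by blast
qed

text \<open>The Gram matrix of the monomials is positive definite, because a nonzero polynomial cannot vanish
on an interval.\<close>

lemma poly_coeffs_L2_bound:
  "\<exists>c>0. \<forall>q :: real poly. degree q \<le> n \<longrightarrow>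
     c * (\<Sum>i\<le>n. (coeff q i)\<^sup>2) \<le> integral {0..1} (\<lambda>x. (poly q x)\<^sup>2)"
proof -
  define G :: "nat \<Rightarrow> nat \<Rightarrow> real" where "G i j = integral {0..1} (\<lambda>x. x ^ i * x ^ j)" for i j
  define P where "P v = (\<Sum>i<Suc n. monom (v i) i)" for v :: "nat \<Rightarrow> real"
  have cP: "coeff (P v) k = (if k < Suc n then v k else 0)" for v k
    unfolding P_def by (simp add: coeff_sum)
  have form: "(\<Sum>i<Suc n. \<Sum>j<Suc n. v i * G i j * v j) = integral {0..1} (\<lambda>x. (poly (P v) x)\<^sup>2)" for v
  proof -
    have i: "(\<lambda>x. v i * (x ^ i * x ^ j) * v j) integrable_on {0..1}" for i j
      by (intro integrable_continuous_interval continuous_intros)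
    have "integral {0..1} (\<lambda>x. (poly (P v) x)\<^sup>2) =
        integral {0..1} (\<lambda>x. \<Sum>i<Suc n. \<Sum>j<Suc n. v i * (x ^ i * x ^ j) * v j)"
      unfolding P_def power2_eq_square poly_sum sum_product by (simp add: poly_monom mult_ac)
    also have "\<dots> = (\<Sum>i<Suc n. \<Sum>j<Suc n. v i * G i j * v j)"
      unfolding G_def
      by (subst integral_sum, auto intro!: integrable_sum i sum.cong simp del: sum.lessThan_Suc)
         (subst integral_sum, auto intro!: integrable_sum i sum.cong simp del: sum.lessThan_Suc)
    finally show ?thesis by simp
  qed
  have "\<exists>c>0. \<forall>v. c * (\<Sum>i<Suc n. (v i)\<^sup>2) \<le> (\<Sum>i<Suc n. \<Sum>j<Suc n. v i * G i j * v j)"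
  proof (rule positive_definite_form_coercive)
    show "G i j = G j i" for i j unfolding G_def by (simp add: mult.commute)
    fix v :: "nat \<Rightarrow> real"
    assume "\<exists>i<Suc n. v i \<noteq> 0"
    then obtain i where "i < Suc n" "v i \<noteq> 0" by auto
    then have "coeff (P v) i \<noteq> 0" unfolding cP by simp
    then have "P v \<noteq> 0" by auto
    then show "0 < (\<Sum>i<Suc n. \<Sum>j<Suc n. v i * G i j * v j)"
      unfolding form by (rule poly_sq_integral_pos)
  qed
  then obtain c where c: "0 < c" "\<And>v. c * (\<Sum>i<Suc n. (v i)\<^sup>2) \<le> integral {0..1} (\<lambda>x. (poly (P v) x)\<^sup>2)"
    unfolding form by auto
  have "c * (\<Sum>i\<le>n. (coeff q i)\<^sup>2) \<le> integral {0..1} (\<lambda>x. (poly q x)\<^sup>2)" if "degree q \<le> n" for q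
  proof -
    have "P (coeff q) = q" using that by (intro poly_eqI) (auto simp: cP coeff_eq_0)
    then show ?thesis using c(2)[of "coeff q"] by (simp add: lessThan_Suc_atMost)
  qed
  then show ?thesis using c(1) by blast
qed

text \<open>Both sides are compared with the sum of the squares of the coefficients.\<close>

lemma poly_inverse_inequality_unit:
  "\<exists>K>0. \<forall>q :: real poly. degree q \<le> n \<longrightarrow>
     integral {0..1} (\<lambda>x. (poly (pderiv q) x)\<^sup>2) \<le> K * integral {0..1} (\<lambda>x. (poly q x)\<^sup>2)"
proof -
  obtain c where c: "0 < c" "\<And>q :: real poly. degree q \<le> n \<Longrightarrow>
     c * (\<Sum>i\<le>n. (coeff q i)\<^sup>2) \<le> integral {0..1} (\<lambda>x. (poly q x)\<^sup>2)"
    using poly_coeffs_L2_bound[of n] by auto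
  define K where "K = (real n + 1) ^ 3 / c"
  have "integral {0..1} (\<lambda>x. (poly (pderiv q) x)\<^sup>2) \<le> K * integral {0..1} (\<lambda>x. (poly q x)\<^sup>2)"
    if q: "degree q \<le> n" for q :: "real poly"
  proof -
    define s where "s = (\<Sum>i\<le>n. (coeff q i)\<^sup>2)"
    have pt: "(poly (pderiv q) x)\<^sup>2 \<le> (real n + 1) ^ 3 * s" if x: "x \<in> {0..1}" for x
    proof -
      have deg: "degree (pderiv q) \<le> n" using q by (simp add: degree_pderiv)
      have "poly (pderiv q) x = (\<Sum>i\<le>n. coeff (pderiv q) i * x ^ i)"
        using deg unfolding poly_altdef by (intro sum.mono_neutral_left) (auto simp: coeff_eq_0)
      then have "(poly (pderiv q) x)\<^sup>2 \<le> (\<Sum>i\<le>n. (coeff (pderiv q) i * x ^ i)\<^sup>2) * (real n + 1)"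
        using sum_squared_le_sum_of_squares[of "\<lambda>i. coeff (pderiv q) i * x ^ i" "{..n}"] by (simp add: add.commute)
      also have "(\<Sum>i\<le>n. (coeff (pderiv q) i * x ^ i)\<^sup>2) \<le> (\<Sum>i\<le>n. (real n + 1)\<^sup>2 * (coeff q (Suc i))\<^sup>2)"
      proof (rule sum_mono)
        fix i assume i: "i \<in> {..n}"
        have "(x ^ i)\<^sup>2 \<le> 1" using x by (simp add: power_le_one)
        then have "(coeff (pderiv q) i * x ^ i)\<^sup>2 \<le> (coeff (pderiv q) i)\<^sup>2"
          unfolding power_mult_distrib by (simp add: mult_left_le)
        also have "\<dots> \<le> (real n + 1)\<^sup>2 * (coeff q (Suc i))\<^sup>2"
          using i unfolding coeff_pderiv power_mult_distrib by (intro mult_right_mono power_mono) auto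
        finally show "(coeff (pderiv q) i * x ^ i)\<^sup>2 \<le> (real n + 1)\<^sup>2 * (coeff q (Suc i))\<^sup>2" .
      qed
      also have "\<dots> = (real n + 1)\<^sup>2 * (\<Sum>i\<in>{1..Suc n}. (coeff q i)\<^sup>2)"
        unfolding sum_distrib_left[symmetric]
        using sum.atLeast_Suc_atMost_Suc_shift[of "\<lambda>i. (coeff q i)\<^sup>2" 0 n]
        by (simp only: atLeast0AtMost o_def One_nat_def)
      also have "(\<Sum>i\<in>{1..Suc n}. (coeff q i)\<^sup>2) \<le> s"
      proof -
        have "(\<Sum>i\<in>{1..Suc n}. (coeff q i)\<^sup>2) = (\<Sum>i\<in>{1..n}. (coeff q i)\<^sup>2)"
          using q by (simp add: coeff_eq_0)
        also have "\<dots> \<le> s" unfolding s_def by (rule sum_mono2) auto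
        finally show ?thesis .
      qed
      finally show ?thesis by (simp add: power3_eq_cube power2_eq_square mult_ac mult_left_mono mult_right_mono)
    qed
    have "integral {0..1} (\<lambda>x. (poly (pderiv q) x)\<^sup>2) \<le> integral {0..1::real} (\<lambda>x. (real n + 1) ^ 3 * s)"
      by (intro integral_le integrable_continuous_interval continuous_intros pt)
    also have "\<dots> = (real n + 1) ^ 3 * s" by simp
    also have "\<dots> \<le> (real n + 1) ^ 3 * (integral {0..1} (\<lambda>x. (poly q x)\<^sup>2) / c)"
      using c(2)[OF q] c(1) unfolding s_def by (intro mult_left_mono) (auto simp: field_simps)
    finally show ?thesis unfolding K_def by simp
  qed
  moreover have "0 < K" unfolding K_def using c(1) by simp
  ultimately show ?thesis by blast
qed

lemma poly_inverse_inequality: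
  "\<exists>K>0. \<forall>(q :: real poly) a b. degree q \<le> n \<longrightarrow> a < b \<longrightarrow>
     (b - a)\<^sup>2 * integral {a..b} (\<lambda>x. (poly (pderiv q) x)\<^sup>2) \<le> K * integral {a..b} (\<lambda>x. (poly q x)\<^sup>2)"
proof -
  obtain K where K: "0 < K" "\<And>q :: real poly. degree q \<le> n \<Longrightarrow>
     integral {0..1} (\<lambda>x. (poly (pderiv q) x)\<^sup>2) \<le> K * integral {0..1} (\<lambda>x. (poly q x)\<^sup>2)"
    using poly_inverse_inequality_unit[of n] by auto
  have "(b - a)\<^sup>2 * integral {a..b} (\<lambda>x. (poly (pderiv q) x)\<^sup>2) \<le> K * integral {a..b} (\<lambda>x. (poly q x)\<^sup>2)"
    if q: "degree q \<le> n" and ab: "a < b" for q :: "real poly" and a b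
  proof -
    define Q where "Q = pcompose q [:a, b - a:]"
    have "pderiv Q = smult (b - a) (pcompose (pderiv q) [:a, b - a:])"
      unfolding Q_def pderiv_pcompose by (simp add: pderiv_pCons)
    then have e: "(poly (pderiv Q) x)\<^sup>2 = (b - a)\<^sup>2 * (poly (pcompose (pderiv q) [:a, b - a:]) x)\<^sup>2" for x
      by (simp add: power_mult_distrib)
    have "degree Q \<le> n" unfolding Q_def using q ab by (simp add: degree_pcompose)
    from K(2)[OF this] have "(b - a)\<^sup>2 * integral {0..1} (\<lambda>x. (poly (pcompose (pderiv q) [:a, b - a:]) x)\<^sup>2)
        \<le> K * integral {0..1} (\<lambda>x. (poly Q x)\<^sup>2)"
      unfolding e by simp
    from mult_left_mono[OF this, of "b - a"] ab show ?thesis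
      unfolding integral_poly_sq_rescale[OF ab] Q_def[symmetric] by (simp add: mult_ac)
  qed
  then show ?thesis using K(1) by blast
qed

section \<open>B-splines on one knot span\<close>

text \<open>The polynomial to which the \<open>i\<close>-th B-spline of degree \<open>q\<close> restricts on the span between the
knots \<open>j\<close> and \<open>j + 1\<close>.  Working with polynomials makes derivatives algebraic and keeps the
values at the end points of the span out of the argument.\<close>

fun span_bspline :: "(nat \<Rightarrow> real) \<Rightarrow> nat \<Rightarrow> nat \<Rightarrow> nat \<Rightarrow> real poly" where
  "span_bspline t j 0 i = (if i = j then 1 else 0)"
| "span_bspline t j (Suc q) i =
     smult (1 / (t (i + q + 1) - t i)) ([:- t i, 1:] * span_bspline t j q i)
   + smult (1 / (t (i + q + 2) - t (i + 1))) ([:t (i + q + 2), -1:] * span_bspline t j q (i + 1))"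

definition span_spline :: "(nat \<Rightarrow> real) \<Rightarrow> nat \<Rightarrow> nat \<Rightarrow> (nat \<Rightarrow> real) \<Rightarrow> real poly" where
  "span_spline t j q c = (\<Sum>i\<le>j. smult (c i) (span_bspline t j q i))"

lemma poly_span_spline: "poly (span_spline t j q c) x = (\<Sum>i\<le>j. c i * poly (span_bspline t j q i) x)"
  unfolding span_spline_def by (simp add: poly_sum)

lemma span_spline_0: "span_spline t j 0 c = [:c j:]"
proof -
  have "span_spline t j 0 c = (\<Sum>i\<le>j. if i = j then [:c j:] else 0)"
    unfolding span_spline_def by (intro sum.cong) (auto simp: one_pCons)
  then show ?thesis by simp
qed

text \<open>Only the knots up to \<open>j + q\<close> influence degree \<open>q\<close> on span \<open>j\<close>.  Under this condition no
denominator of the recursion that matters there vanishes, although knots may be repeated.\<close>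

definition proper_span :: "(nat \<Rightarrow> real) \<Rightarrow> nat \<Rightarrow> nat \<Rightarrow> bool" where
  "proper_span t j q \<longleftrightarrow> q \<le> j \<and> t j < t (Suc j) \<and> (\<forall>a b. a \<le> b \<longrightarrow> b \<le> j + q \<longrightarrow> t a \<le> t b)"

lemma proper_span_Suc: "proper_span t j (Suc q) \<Longrightarrow> proper_span t j q"
  unfolding proper_span_def by auto

lemma proper_span_gap:
  assumes "proper_span t j (Suc q)" "i \<le> j" "j \<le> i + q"
  shows "t i < t (i + q + 1)"
proof -
  have "t i \<le> t j" "t (Suc j) \<le> t (i + q + 1)" "t j < t (Suc j)"
    using assms unfolding proper_span_def by auto
  then show ?thesis by linarith
qed

lemma span_bspline_eq_0: "j < i \<or> i + q < j \<Longrightarrow> span_bspline t j q i = 0"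
  by (induction q arbitrary: i) auto

lemma degree_span_bspline: "degree (span_bspline t j q i) \<le> q"
proof (induction q arbitrary: i)
  case (Suc q)
  have "degree ([:a, b:] * span_bspline t j q i) \<le> Suc q" for a b i
    using degree_mult_le[of "[:a, b:]" "span_bspline t j q i"] Suc[of i] degree_pCons_le[of a "[:b:]"]
    by simp
  then show ?case
    by (auto intro!: degree_add_le order.trans[OF degree_smult_le] simp del: mult_pCons_left)
qed auto

lemma degree_span_spline: "degree (span_spline t j q c) \<le> q"
  unfolding span_spline_def
  by (intro degree_sum_le order.trans[OF degree_smult_le] degree_span_bspline) auto

lemma bspline_eq_span_bspline:
  assumes "sorted \<xi>" "i + q + 1 < length \<xi>" "j + 1 < length \<xi>" "\<xi> ! j < x" "x < \<xi> ! (j + 1)"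
  shows "bspline \<xi> q i x = poly (span_bspline ((!) \<xi>) j q i) x"
  using assms(2)
proof (induction q arbitrary: i)
  case 0
  consider "i = j" | "i < j" | "j < i" by linarith
  then show ?case
  proof cases
    case 2
    then have "\<xi> ! (i + 1) \<le> \<xi> ! j" using assms by (intro sorted_nth_mono) auto
    then show ?thesis using 2 assms by auto
  next
    case 3
    then have "\<xi> ! (j + 1) \<le> \<xi> ! i" using assms 0 by (intro sorted_nth_mono) auto
    then show ?thesis using 3 assms by auto
  qed (use assms in auto)
next
  case (Suc q)
  have "bspline \<xi> q i x = poly (span_bspline ((!) \<xi>) j q i) x"
    "bspline \<xi> q (i + 1) x = poly (span_bspline ((!) \<xi>) j q (i + 1)) x"
    using Suc.prems by (intro Suc.IH; simp)+
  then show ?case by (simp add: algebra_simps add_divide_distrib diff_divide_distrib)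
qed

text \<open>The weight with which a B-spline of degree \<open>q\<close> enters the one of degree \<open>q + 1\<close> with the same
index; it is the affine function that is 0 and 1 at the ends of the support.\<close>

definition knot_weight :: "(nat \<Rightarrow> real) \<Rightarrow> nat \<Rightarrow> nat \<Rightarrow> real poly" where
  "knot_weight t q i = smult (1 / (t (i + q + 1) - t i)) [:- t i, 1:]"

lemma poly_knot_weight: "poly (knot_weight t q i) x = (x - t i) / (t (i + q + 1) - t i)"
  unfolding knot_weight_def by (simp add: diff_divide_distrib)

lemma span_bspline_Suc:
  assumes "proper_span t j (Suc q)"
  shows "span_bspline t j (Suc q) i =
    knot_weight t q i * span_bspline t j q i + (1 - knot_weight t q (i + 1)) * span_bspline t j q (i + 1)"
proof -
  have "smult (1 / (t (i + q + 2) - t (i + 1))) ([:t (i + q + 2), -1:] * span_bspline t j q (i + 1))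
      = (1 - knot_weight t q (i + 1)) * span_bspline t j q (i + 1)"
  proof (cases "span_bspline t j q (i + 1) = 0")
    case False
    then have "i + 1 \<le> j" "j \<le> i + 1 + q" using span_bspline_eq_0 by (metis not_le)+
    then have "t (i + 1) < t (i + 1 + q + 1)" using proper_span_gap[OF assms] by blast
    then have "1 - knot_weight t q (i + 1) = smult (1 / (t (i + q + 2) - t (i + 1))) [:t (i + q + 2), -1:]"
      unfolding knot_weight_def by (simp add: one_pCons field_simps)
    then show ?thesis by (simp only: mult_smult_left)
  qed simp
  then show ?thesis
    unfolding span_bspline.simps(2) knot_weight_def by (simp only: mult_smult_left)
qed

text \<open>One step of the de Boor algorithm: the coefficients with respect to degree \<open>q\<close> of the spline
of degree \<open>q + 1\<close> with coefficients \<open>c\<close>.  They are polynomials, affine in the variable.  The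
value \<open>c (0 - 1) = c 0\<close> is harmless, since it only ever meets a B-spline that vanishes on the
span.\<close>

definition blend :: "(nat \<Rightarrow> real) \<Rightarrow> nat \<Rightarrow> (nat \<Rightarrow> real) \<Rightarrow> nat \<Rightarrow> real poly" where
  "blend t q c i = smult (c i) (knot_weight t q i) + smult (c (i - 1)) (1 - knot_weight t q i)"

lemma poly_blend: "poly (blend t q c i) x =
   c i * ((x - t i) / (t (i + q + 1) - t i)) + c (i - 1) * (1 - (x - t i) / (t (i + q + 1) - t i))"
  unfolding blend_def by (simp add: poly_knot_weight)

lemma span_spline_Suc:
  assumes "proper_span t j (Suc q)"
  shows "span_spline t j (Suc q) c = (\<Sum>i\<le>j. blend t q c i * span_bspline t j q i)"
proof -
  let ?B = "span_bspline t j q" and ?W = "knot_weight t q"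
  have q: "q < j" using assms unfolding proper_span_def by simp
  have "span_spline t j (Suc q) c = (\<Sum>i\<le>j. smult (c i) (?W i * ?B i))
      + (\<Sum>i\<le>j. smult (c i) ((1 - ?W (Suc i)) * ?B (Suc i)))"
    unfolding span_spline_def span_bspline_Suc[OF assms] by (simp add: smult_add_right sum.distrib)
  also have "(\<Sum>i\<le>j. smult (c i) ((1 - ?W (Suc i)) * ?B (Suc i)))
      = (\<Sum>i\<in>{1..Suc j}. smult (c (i - 1)) ((1 - ?W i) * ?B i))"
    using sum.atLeast_Suc_atMost_Suc_shift[of "\<lambda>i. smult (c (i - 1)) ((1 - ?W i) * ?B i)" 0 j]
    by (simp add: atLeast0AtMost o_def)
  also have "\<dots> = (\<Sum>i\<le>j. smult (c (i - 1)) ((1 - ?W i) * ?B i))"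
  proof -
    have "?B 0 = 0" "?B (Suc j) = 0" using q by (simp_all add: span_bspline_eq_0)
    then have "(\<Sum>i\<in>{1..Suc j}. smult (c (i - 1)) ((1 - ?W i) * ?B i))
        = (\<Sum>i\<in>{0..Suc j}. smult (c (i - 1)) ((1 - ?W i) * ?B i))"
      by (intro sum.mono_neutral_left) (auto simp: not_less_eq_eq)
    then show ?thesis using \<open>?B (Suc j) = 0\<close> by (simp add: atLeast0AtMost)
  qed
  finally show ?thesis
    unfolding blend_def sum.distrib[symmetric] by (simp add: distrib_right)
qed

lemma span_bspline_partition:
  assumes "proper_span t j q"
  shows "span_spline t j q (\<lambda>_. 1) = 1"
  using assms
proof (induction q)
  case 0
  have "(\<Sum>i\<le>j. if i = j then 1 else 0 :: real poly) = 1" by simp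
  then show ?case unfolding span_spline_def by simp
next
  case (Suc q)
  have "blend t q (\<lambda>_. 1) i = 1" for i unfolding blend_def by simp
  then show ?case unfolding span_spline_Suc[OF Suc.prems]
    using Suc.IH[OF proper_span_Suc[OF Suc.prems]] unfolding span_spline_def by simp
qed

lemma span_bspline_nonneg:
  assumes "proper_span t j q" "t j \<le> x" "x \<le> t (Suc j)"
  shows "0 \<le> poly (span_bspline t j q i) x"
  using assms(1)
proof (induction q arbitrary: i)
  case (Suc q)
  note IH = Suc.IH[OF proper_span_Suc[OF Suc.prems]]
  have w: "0 \<le> poly (knot_weight t q i) x * poly (span_bspline t j q i) x"
     "0 \<le> (1 - poly (knot_weight t q i) x) * poly (span_bspline t j q i) x" for i
  proof (atomize (full), cases "i \<le> j \<and> j \<le> i + q")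
    case True
    have gap: "t i < t (i + q + 1)" using proper_span_gap[OF Suc.prems] True by blast
    have "t i \<le> t j" "t (Suc j) \<le> t (i + q + 1)"
      using Suc.prems True unfolding proper_span_def by auto
    then have "0 \<le> poly (knot_weight t q i) x" "poly (knot_weight t q i) x \<le> 1"
      unfolding poly_knot_weight using gap assms by (auto simp: field_simps)
    then show "0 \<le> poly (knot_weight t q i) x * poly (span_bspline t j q i) x \<and>
      0 \<le> (1 - poly (knot_weight t q i) x) * poly (span_bspline t j q i) x" using IH[of i] by simp
  next
    case False
    then have "span_bspline t j q i = 0" by (intro span_bspline_eq_0) auto
    then show "0 \<le> poly (knot_weight t q i) x * poly (span_bspline t j q i) x \<and>
      0 \<le> (1 - poly (knot_weight t q i) x) * poly (span_bspline t j q i) x" by simp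
  qed
  show ?case unfolding span_bspline_Suc[OF Suc.prems] using w(1)[of i] w(2)[of "i + 1"] by simp
qed simp

lemma span_bspline_sum_1:
  assumes "proper_span t j q"
  shows "(\<Sum>i\<le>j. poly (span_bspline t j q i) x) = 1"
  using arg_cong[OF span_bspline_partition[OF assms], of "\<lambda>p. poly p x"] by (simp add: poly_span_spline)

lemma span_bspline_le_1:
  assumes "proper_span t j q" "t j \<le> x" "x \<le> t (Suc j)"
  shows "poly (span_bspline t j q i) x \<le> 1"
proof (cases "i \<le> j")
  case True
  have "poly (span_bspline t j q i) x \<le> (\<Sum>i\<le>j. poly (span_bspline t j q i) x)"
    using True span_bspline_nonneg[OF assms] by (intro member_le_sum) auto
  then show ?thesis using span_bspline_sum_1[OF assms(1)] by simp
qed (simp add: span_bspline_eq_0)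

text \<open>The coefficients of the derivative are scaled divided differences.  In the induction step the
product rule, applied to the blended representation, gives one copy of the claim from the derivatives
of the blended coefficients.  The other \<open>q + 1\<close> copies come from the induction hypothesis for
coefficients frozen at \<open>x\<close>: there the divided differences of the blended coefficients are again
a blend of divided differences.\<close>

lemma pderiv_span_spline:
  assumes "proper_span t j (Suc q)"
  shows "pderiv (span_spline t j (Suc q) c)
    = smult (real q + 1) (span_spline t j q (\<lambda>i. (c i - c (i - 1)) / (t (i + q + 1) - t i)))"
  using assms
proof (induction q arbitrary: c)
  case 0
  have "span_spline t j (Suc 0) c = (\<Sum>i\<le>j. if i = j then blend t 0 c j else 0)"
    unfolding span_spline_Suc[OF 0] by (intro sum.cong) auto
  then have "span_spline t j (Suc 0) c = blend t 0 c j" by simp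
  then show ?case unfolding span_spline_0
    by (simp add: blend_def knot_weight_def pderiv_add pderiv_diff pderiv_smult pderiv_pCons diff_divide_distrib smult_diff_right smult_diff_left)
next
  case (Suc q)
  let ?B = "span_bspline t j (Suc q)"
  let ?E = "blend t (Suc q) c"
  define g where "g i = (c i - c (i - 1)) / (t (i + Suc q + 1) - t i)" for i
  note good1 = proper_span_Suc[OF Suc.prems]
  have dE: "pderiv (?E i) = [:g i:]" for i
    unfolding blend_def knot_weight_def g_def
    by (simp add: pderiv_add pderiv_diff pderiv_smult pderiv_pCons diff_divide_distrib)
  show ?case
  proof (rule poly_eq_poly_eq_iff[THEN iffD1], rule ext)
    fix x
    have "poly (pderiv (span_spline t j (Suc (Suc q)) c)) x =
       (\<Sum>i\<le>j. g i * poly (?B i) x) + (\<Sum>i\<le>j. poly (?E i) x * poly (pderiv (?B i)) x)"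
      unfolding span_spline_Suc[OF Suc.prems]
      by (simp add: pderiv_sum pderiv_mult poly_sum dE sum.distrib mult.commute add.commute del: span_bspline.simps)
    also have "(\<Sum>i\<le>j. poly (?E i) x * poly (pderiv (?B i)) x)
       = poly (pderiv (span_spline t j (Suc q) (\<lambda>i. poly (?E i) x))) x"
      unfolding span_spline_def by (simp add: pderiv_sum poly_sum pderiv_smult del: span_bspline.simps)
    also have "\<dots> = (real q + 1) * (\<Sum>i\<le>j. (poly (?E i) x - poly (?E (i - 1)) x) / (t (i + q + 1) - t i) * poly (span_bspline t j q i) x)"
      unfolding Suc.IH[OF good1] by (simp add: poly_span_spline)
    also have "(\<Sum>i\<le>j. (poly (?E i) x - poly (?E (i - 1)) x) / (t (i + q + 1) - t i) * poly (span_bspline t j q i) x)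
       = (\<Sum>i\<le>j. poly (blend t q g i) x * poly (span_bspline t j q i) x)"
    proof (intro sum.cong refl)
      fix i assume i: "i \<in> {..j}"
      show "(poly (?E i) x - poly (?E (i - 1)) x) / (t (i + q + 1) - t i) * poly (span_bspline t j q i) x
        = poly (blend t q g i) x * poly (span_bspline t j q i) x"
      proof (cases "j \<le> i + q")
        case True
        have i2: "2 \<le> i" using True Suc.prems unfolding proper_span_def by auto
        then obtain k where k: "i = Suc k" by (cases i) auto
        have d1: "t i < t (i + Suc q + 1)" using i True by (intro proper_span_gap[OF Suc.prems]) auto
        have d2: "t k < t (k + Suc q + 1)" using i True k by (intro proper_span_gap[OF Suc.prems]) auto
        have d3: "t i < t (i + q + 1)" using i True by (intro proper_span_gap[OF good1]) auto
        have a1: "a * (u / d) + b * (1 - u / d) = b + u * ((a - b) / d)" if "d \<noteq> 0" for a b u d :: real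
          using that by (simp add: field_simps)
        have a2: "a * (u / d) + b * (1 - u / d) = a - (d - u) * ((a - b) / d)" if "d \<noteq> 0" for a b u d :: real
          using that by (simp add: field_simps)
        have a3: "a * (u / d) + b * (1 - u / d) = (u * a + (d - u) * b) / d" if "d \<noteq> 0" for a b u d :: real
          using that by (simp add: field_simps)
        have "poly (?E i) x = c k + (x - t i) * g i"
          unfolding poly_blend g_def using a1[of "t (i + Suc q + 1) - t i" "c i" "x - t i" "c k"] d1 k by simp
        moreover have "poly (?E k) x = c k - (t (i + q + 1) - x) * g k"
          unfolding poly_blend g_def
          using a2[of "t (k + Suc q + 1) - t k" "c k" "x - t k" "c (k - 1)"] d2 k by simp
        ultimately have num: "poly (?E i) x - poly (?E k) x = (x - t i) * g i + (t (i + q + 1) - x) * g k"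
          by simp
        have "poly (blend t q g i) x = ((x - t i) * g i + (t (i + q + 1) - x) * g k) / (t (i + q + 1) - t i)"
          unfolding poly_blend using a3[of "t (i + q + 1) - t i" "g i" "x - t i" "g k"] d3 k by simp
        then show ?thesis using num k by simp
      qed (simp add: span_bspline_eq_0)
    qed
    also have "\<dots> = poly (span_spline t j (Suc q) g) x"
      unfolding span_spline_Suc[OF good1] by (simp add: poly_sum)
    also have "(\<Sum>i\<le>j. g i * poly (?B i) x) = poly (span_spline t j (Suc q) g) x"
      by (simp only: poly_span_spline)
    finally show "poly (pderiv (span_spline t j (Suc (Suc q)) c)) x =
       poly (smult (real (Suc q) + 1) (span_spline t j (Suc q) (\<lambda>i. (c i - c (i - 1)) / (t (i + Suc q + 1) - t i)))) x"
      unfolding g_def[symmetric] by (simp add: algebra_simps)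
  qed
qed

text \<open>Each active coefficient is bounded by the \<open>L\<^sup>2\<close> norm of the spline on the span alone.  The number
\<open>\<rho>\<close> limits how far the relevant knots spread, relative to the length of the span.\<close>

definition span_stable :: "nat \<Rightarrow> real \<Rightarrow> real \<Rightarrow> bool" where
  "span_stable q \<rho> K \<longleftrightarrow> (\<forall>t j c i. proper_span t j q \<longrightarrow>
     t (j + q) - t (j + 1 - q) \<le> \<rho> * (t (Suc j) - t j) \<longrightarrow> j - q \<le> i \<longrightarrow> i \<le> j \<longrightarrow>
     (t (Suc j) - t j) * (c i)\<^sup>2 \<le> K * integral {t j..t (Suc j)} (\<lambda>x. (poly (span_spline t j q c) x)\<^sup>2))"

text \<open>Induction on the degree.  The hypothesis for the derivative and the inverse inequality bound the
differences of neighbouring coefficients; the spline values are convex combinations of the active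
coefficients, so each coefficient differs from every value of the spline by at most the sum of the
differences.\<close>

theorem span_spline_coeff_bound:
  assumes \<rho>: "0 \<le> \<rho>"
  shows "\<exists>K>0. span_stable q \<rho> K"
proof (induction q)
  case 0
  have "(t (Suc j) - t j) * (c i)\<^sup>2 \<le> 1 * integral {t j..t (Suc j)} (\<lambda>x. (poly (span_spline t j 0 c) x)\<^sup>2)"
    if "proper_span t j 0" "i = j" for t j c i
  proof -
    have "poly (span_spline t j 0 c) x = c j" for x
      unfolding span_spline_0 by simp
    then show ?thesis using that unfolding proper_span_def by simp
  qed
  then show ?case unfolding span_stable_def by (intro exI[of _ 1]) auto
next
  case (Suc q)
  obtain K where K: "0 < K" "\<And>t j c i. proper_span t j q \<Longrightarrow> t (j + q) - t (j + 1 - q) \<le> \<rho> * (t (Suc j) - t j) \<Longrightarrow>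
     j - q \<le> i \<Longrightarrow> i \<le> j \<Longrightarrow>
     (t (Suc j) - t j) * (c i)\<^sup>2 \<le> K * integral {t j..t (Suc j)} (\<lambda>x. (poly (span_spline t j q c) x)\<^sup>2)"
    using Suc.IH unfolding span_stable_def by auto
  obtain M where M: "0 < M" "\<And>(f :: real poly) a b. degree f \<le> Suc q \<Longrightarrow> a < b \<Longrightarrow>
     (b - a)\<^sup>2 * integral {a..b} (\<lambda>x. (poly (pderiv f) x)\<^sup>2) \<le> M * integral {a..b} (\<lambda>x. (poly f x)\<^sup>2)"
    using poly_inverse_inequality[of "Suc q"] by auto
  define K' where "K' = 2 + 2 * (real q + 1)\<^sup>2 * (\<rho>\<^sup>2 * K * M)"
  have K'0: "0 < K'" unfolding K'_def using K M by (intro add_pos_nonneg) auto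
  have "(t (Suc j) - t j) * (c i)\<^sup>2 \<le> K' * integral {t j..t (Suc j)} (\<lambda>x. (poly (span_spline t j (Suc q) c) x)\<^sup>2)"
    if good: "proper_span t j (Suc q)" and r: "t (j + Suc q) - t (j + 1 - Suc q) \<le> \<rho> * (t (Suc j) - t j)"
      and i: "j - Suc q \<le> i" "i \<le> j" for t j c i
  proof -
    define s where "s = t (Suc j) - t j"
    have s: "0 < s" using good unfolding s_def proper_span_def by simp
    have mono: "t a \<le> t b" if "a \<le> b" "b \<le> j + Suc q" for a b
      using good that unfolding proper_span_def by blast
    have qj: "Suc q \<le> j" using good unfolding proper_span_def by blast
    define f where "f = span_spline t j (Suc q) c"
    define I where "I = integral {t j..t (Suc j)} (\<lambda>x. (poly f x)\<^sup>2)"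
    have int: "(\<lambda>x. (poly p x)\<^sup>2) integrable_on {a..b}" for p :: "real poly" and a b
      by (intro integrable_continuous_interval continuous_intros)
    have I0: "0 \<le> I" unfolding I_def by (rule integral_nonneg[OF int]) auto
    define g where "g i = (c i - c (i - 1)) / (t (i + q + 1) - t i)" for i
    have r': "t (j + q) - t (j + 1 - q) \<le> \<rho> * (t (Suc j) - t j)"
    proof -
      have "t (j + q) \<le> t (j + Suc q)" "t (j + 1 - Suc q) \<le> t (j + 1 - q)" by (intro mono; simp)+
      then show ?thesis using r by linarith
    qed
    have df: "pderiv f = smult (real q + 1) (span_spline t j q g)"
      unfolding f_def g_def by (rule pderiv_span_spline[OF good])
    have "integral {t j..t (Suc j)} (\<lambda>x. (poly (span_spline t j q g) x)\<^sup>2)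
        \<le> integral {t j..t (Suc j)} (\<lambda>x. (poly (pderiv f) x)\<^sup>2)"
      unfolding df by (intro integral_le int) (auto simp: power_mult_distrib mult_le_cancel_right1)
    also have "\<dots> \<le> M * I / s\<^sup>2"
      using M(2)[of f "t j" "t (Suc j)"] s degree_span_spline[of t j "Suc q" c]
      unfolding I_def s_def f_def by (simp add: field_simps)
    finally have gI: "integral {t j..t (Suc j)} (\<lambda>x. (poly (span_spline t j q g) x)\<^sup>2) \<le> M * I / s\<^sup>2" .
    define L where "L = \<rho>\<^sup>2 * K * M * I"
    have L0: "0 \<le> L" unfolding L_def using K M I0 by simp
    \<comment> \<open>The powers of the span length from the inverse inequality and from the divided differences cancel.\<close>
    have dc: "s * (c l - c (l - 1))\<^sup>2 \<le> L" if l: "j - q \<le> l" "l \<le> j" for l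
    proof -
      have "s * (g l)\<^sup>2 \<le> K * (M * I / s\<^sup>2)"
        using K(2)[OF proper_span_Suc[OF good] r' l, of g] mult_left_mono[OF gI, of K] K(1)
        unfolding s_def by simp
      have gap: "t l < t (l + q + 1)" using l by (intro proper_span_gap[OF good]) auto
      have "t (l + q + 1) \<le> t (j + Suc q)" "t (j + 1 - Suc q) \<le> t l" using l by (intro mono; simp)+
      then have D: "t (l + q + 1) - t l \<le> \<rho> * s" using r unfolding s_def by linarith
      have "(c l - c (l - 1))\<^sup>2 = (t (l + q + 1) - t l)\<^sup>2 * (g l)\<^sup>2"
        unfolding g_def using gap by (simp add: power_divide)
      also have "\<dots> \<le> (\<rho> * s)\<^sup>2 * (g l)\<^sup>2"
        using D gap by (intro mult_right_mono power_mono) auto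
      finally have "s * (c l - c (l - 1))\<^sup>2 \<le> (\<rho> * s)\<^sup>2 * (s * (g l)\<^sup>2)" using s by (simp add: mult_ac)
      also have "\<dots> \<le> (\<rho> * s)\<^sup>2 * (K * (M * I / s\<^sup>2))"
        using \<open>s * (g l)\<^sup>2 \<le> K * (M * I / s\<^sup>2)\<close> by (intro mult_left_mono) auto
      also have "\<dots> = L" unfolding L_def using s by (simp add: power_mult_distrib)
      finally show ?thesis .
    qed
    define \<delta> where "\<delta> = sqrt (L / s)"
    have \<delta>0: "0 \<le> \<delta>" unfolding \<delta>_def using L0 s by simp
    have step: "\<bar>c l - c (l - 1)\<bar> \<le> \<delta>" if l: "j - q \<le> l" "l \<le> j" for l
      unfolding \<delta>_def using dc[OF l] s by (intro real_le_rsqrt) (simp add: field_simps)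
    have chain: "\<bar>c (a + k) - c a\<bar> \<le> real k * \<delta>" if "j - Suc q \<le> a" "a + k \<le> j" for a k
      using that
    proof (induction k)
      case (Suc k)
      have "\<bar>c (a + Suc k) - c a\<bar> \<le> \<bar>c (a + k) - c a\<bar> + \<bar>c (a + Suc k) - c (a + Suc k - 1)\<bar>" by simp
      also have "\<dots> \<le> real k * \<delta> + \<delta>" using Suc by (intro add_mono Suc.IH step) auto
      finally show ?case by (simp add: algebra_simps)
    qed simp
    have diff: "\<bar>c a - c b\<bar> \<le> (real q + 1) * \<delta>" if "j - Suc q \<le> a" "a \<le> b" "b \<le> j" for a b
    proof -
      have "\<bar>c (a + (b - a)) - c a\<bar> \<le> real (b - a) * \<delta>" using that by (intro chain) auto
      also have "\<dots> \<le> (real q + 1) * \<delta>" using that \<delta>0 by (intro mult_right_mono) auto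
      finally show ?thesis using that by (simp add: abs_minus_commute)
    qed
    have diff': "\<bar>c a - c b\<bar> \<le> (real q + 1) * \<delta>"
      if "j - Suc q \<le> a" "a \<le> j" "j - Suc q \<le> b" "b \<le> j" for a b
      using diff[of a b] diff[of b a] that by (cases "a \<le> b") (auto simp: abs_minus_commute)
    \<comment> \<open>Partition of unity: \<open>f x\<close> is an average of the active coefficients.\<close>
    have pt: "(c i)\<^sup>2 \<le> 2 * (poly f x)\<^sup>2 + 2 * (real q + 1)\<^sup>2 * (L / s)"
      if x: "x \<in> {t j..t (Suc j)}" for x
    proof -
      let ?B = "\<lambda>k. poly (span_bspline t j (Suc q) k) x"
      have "c i - poly f x = (\<Sum>k\<le>j. (c i - c k) * ?B k)"
        unfolding f_def poly_span_spline left_diff_distrib sum_subtractf sum_distrib_left[symmetric]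
          span_bspline_sum_1[OF good] by simp
      also have "\<bar>\<dots>\<bar> \<le> (\<Sum>k\<le>j. (real q + 1) * \<delta> * ?B k)"
      proof (rule order.trans[OF sum_abs], rule sum_mono)
        fix k assume k: "k \<in> {..j}"
        show "\<bar>(c i - c k) * ?B k\<bar> \<le> (real q + 1) * \<delta> * ?B k"
        proof (cases "j - Suc q \<le> k")
          case True
          have "0 \<le> ?B k" using x by (intro span_bspline_nonneg[OF good]) auto
          then show ?thesis using diff'[OF i True] k by (simp add: abs_mult mult_right_mono)
        next
          case False
          then have "span_bspline t j (Suc q) k = 0" by (intro span_bspline_eq_0) auto
          then show ?thesis by (simp del: span_bspline.simps)
        qed
      qed
      also have "\<dots> = (real q + 1) * \<delta>"
        unfolding sum_distrib_left[symmetric] span_bspline_sum_1[OF good] by simp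
      finally have d: "\<bar>c i - poly f x\<bar> \<le> (real q + 1) * \<delta>" .
      have "(c i)\<^sup>2 \<le> 2 * (poly f x)\<^sup>2 + 2 * (c i - poly f x)\<^sup>2"
        using sum_squares_bound[of "c i - poly f x" "poly f x"] by (simp add: power2_eq_square algebra_simps)
      also have "(c i - poly f x)\<^sup>2 \<le> ((real q + 1) * \<delta>)\<^sup>2"
        using d \<delta>0 by (intro abs_le_square_iff[THEN iffD1]) auto
      also have "\<dots> = (real q + 1)\<^sup>2 * (L / s)"
        unfolding \<delta>_def power_mult_distrib using L0 s by simp
      finally show ?thesis by simp
    qed
    have "s * (c i)\<^sup>2 = integral {t j..t (Suc j)} (\<lambda>x. (c i)\<^sup>2)" using s unfolding s_def by simp
    also have "\<dots> \<le> integral {t j..t (Suc j)} (\<lambda>x. 2 * (poly f x)\<^sup>2 + 2 * (real q + 1)\<^sup>2 * (L / s))"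
      by (intro integral_le pt integrable_continuous_interval continuous_intros)
    also have "\<dots> = 2 * I + s * (2 * (real q + 1)\<^sup>2 * (L / s))"
      using s unfolding I_def s_def
      by (subst integral_add) (auto intro!: integrable_continuous_interval continuous_intros simp: field_simps)
    also have "\<dots> = K' * I" unfolding K'_def L_def using s by (simp add: algebra_simps)
    finally show ?thesis unfolding s_def I_def f_def .
  qed
  then show ?case unfolding span_stable_def using K'0 by blast
qed


section \<open>Stability of the univariate B-spline basis\<close>

lemma integral_sum_spans:
  fixes f :: "real \<Rightarrow> real" and t :: "nat \<Rightarrow> real"
  assumes "a \<le> b"
    and mono: "\<And>j. a \<le> j \<Longrightarrow> j < b \<Longrightarrow> t j \<le> t (Suc j)"
    and int: "\<And>j. a \<le> j \<Longrightarrow> j < b \<Longrightarrow> f integrable_on {t j..t (Suc j)}"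
  shows "f integrable_on {t a..t b} \<and> integral {t a..t b} f = (\<Sum>j\<in>{a..<b}. integral {t j..t (Suc j)} f) \<and> t a \<le> t b"
  using assms
proof (induction b rule: dec_induct)
  case (step n)
  have IH: "f integrable_on {t a..t n}" "integral {t a..t n} f = (\<Sum>j\<in>{a..<n}. integral {t j..t (Suc j)} f)" "t a \<le> t n"
    using step.IH step.prems by auto
  have n: "t n \<le> t (Suc n)" "f integrable_on {t n..t (Suc n)}" using step by auto
  have i: "f integrable_on {t a..t (Suc n)}" using Henstock_Kurzweil_Integration.integrable_combine[OF IH(3) n(1) IH(1) n(2)] .
  show ?case using i Henstock_Kurzweil_Integration.integral_combine[OF IH(3) n(1) i] IH n step(1) by simp
qed (use integrable_on_refl[of f "t a"] in simp)

locale quasi_uniform_knots =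
  fixes p :: nat and \<xi> :: "real list" and h \<alpha> :: real
  assumes p: "1 \<le> p" and open_knots: "open_knot_vector p \<xi>" and \<alpha>: "0 < \<alpha>"
    and span_le: "\<And>i. i + 1 < length \<xi> \<Longrightarrow> \<xi> ! (i + 1) - \<xi> ! i \<le> h"
    and span_ge: "\<And>i. i + 1 < length \<xi> \<Longrightarrow> \<xi> ! (i + 1) \<noteq> \<xi> ! i \<Longrightarrow> \<alpha> * h \<le> \<xi> ! (i + 1) - \<xi> ! i"
begin

abbreviation "m \<equiv> num_bsplines p \<xi>"

abbreviation spline :: "(nat \<Rightarrow> real) \<Rightarrow> real \<Rightarrow> real" where
  "spline c x \<equiv> \<Sum>i<m. c i * bspline \<xi> p i x"

abbreviation piece :: "(nat \<Rightarrow> real) \<Rightarrow> nat \<Rightarrow> real poly" where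
  "piece c j \<equiv> span_spline ((!) \<xi>) j p c"

abbreviation piece_energy :: "(nat \<Rightarrow> real) \<Rightarrow> nat \<Rightarrow> real" where
  "piece_energy c j \<equiv> integral {\<xi> ! j..\<xi> ! Suc j} (\<lambda>x. (poly (piece c j) x)\<^sup>2)"

abbreviation spans :: "nat \<Rightarrow> nat set" where
  "spans i \<equiv> {j\<in>{p..<m}. i \<le> j \<and> j \<le> i + p}"

lemma knot_props: "length \<xi> = m + p + 1" "p < m" "sorted \<xi>"
  "\<And>i. i \<le> p \<Longrightarrow> \<xi> ! i = 0" "\<And>i. i \<le> p \<Longrightarrow> \<xi> ! (m + i) = 1"
  "0 < \<xi> ! (p + 1)" "\<xi> ! (m - 1) < 1"
  "\<And>t. 0 < t \<Longrightarrow> t < 1 \<Longrightarrow> count_list \<xi> t \<le> p"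
proof -
  note o = open_knots[unfolded open_knot_vector_def Let_def]
  show "length \<xi> = m + p + 1" "p < m" using o unfolding num_bsplines_def by auto
  show "sorted \<xi>" using o by auto
  show i: "\<And>i. i \<le> p \<Longrightarrow> \<xi> ! i = 0" "\<And>i. i \<le> p \<Longrightarrow> \<xi> ! (m + i) = 1" using o by auto
  show "0 < \<xi> ! (p + 1)" "\<xi> ! (m - 1) < 1" using o i(1)[of p] i(2)[of 0] by auto
  show "\<And>t. 0 < t \<Longrightarrow> t < 1 \<Longrightarrow> count_list \<xi> t \<le> p" using o by auto
qed

lemma knot_mono: "a \<le> b \<Longrightarrow> b \<le> m + p \<Longrightarrow> \<xi> ! a \<le> \<xi> ! b"
  using knot_props(1,3) by (intro sorted_nth_mono) auto

lemma knot_diff_le: "a \<le> b \<Longrightarrow> b \<le> m + p \<Longrightarrow> \<xi> ! b - \<xi> ! a \<le> real (b - a) * h"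
proof (induction b rule: dec_induct)
  case (step n)
  have "\<xi> ! (n + 1) - \<xi> ! n \<le> h" using step knot_props(1) by (intro span_le) auto
  then show ?case using step by (simp add: Suc_diff_le algebra_simps)
qed simp

lemma h_pos: "0 < h"
proof -
  have "\<xi> ! (p + 1) - \<xi> ! p \<le> h" using knot_props(1,2) by (intro span_le) auto
  then show ?thesis using knot_props(4)[of p] knot_props(6) by simp
qed

text \<open>An empty support would be a knot of multiplicity \<open>p + 2\<close>, which is excluded inside the interval
by the multiplicity bound and at the ends by the two nonempty extreme spans.\<close>

lemma knot_gap:
  assumes i: "i < m"
  shows "\<xi> ! i < \<xi> ! (i + p + 1)"
proof (rule ccontr)
  assume "\<not> ?thesis"
  then have eq: "\<xi> ! (i + p + 1) = \<xi> ! i" using knot_mono[of i "i + p + 1"] i by simp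
  define \<tau> where "\<tau> = \<xi> ! i"
  have all: "\<xi> ! k = \<tau>" if "i \<le> k" "k \<le> i + p + 1" for k
    using knot_mono[of i k] knot_mono[of k "i + p + 1"] that i eq unfolding \<tau>_def by auto
  have "\<tau> \<le> \<xi> ! (m - 1)" unfolding \<tau>_def using i by (intro knot_mono) auto
  then have t1: "\<tau> < 1" using knot_props(7) by simp
  have "\<xi> ! (p + 1) \<le> \<xi> ! (i + p + 1)" using i by (intro knot_mono) auto
  then have t0: "0 < \<tau>" using knot_props(6) eq unfolding \<tau>_def by simp
  have "{i..i + p + 1} \<subseteq> {k. k < length \<xi> \<and> \<xi> ! k = \<tau>}" using all i knot_props(1) by auto
  then have "card {i..i + p + 1} \<le> card {k. k < length \<xi> \<and> \<xi> ! k = \<tau>}" by (intro card_mono) auto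
  also have "\<dots> = count_list \<xi> \<tau>"
    by (simp add: count_list_eq_length_filter length_filter_conv_card eq_commute)
  finally show False using knot_props(8)[OF t0 t1] by simp
qed

text \<open>Only the spans from \<open>p\<close> to \<open>m - 1\<close> count; the ones outside are empty because the knot vector is
open.  Clipping the support to this range does not change its end points.\<close>

lemma exists_span:
  assumes i: "i < m"
  shows "\<exists>j. p \<le> j \<and> j < m \<and> i \<le> j \<and> j \<le> i + p \<and> \<xi> ! j < \<xi> ! Suc j"
proof (rule ccontr)
  assume none: "\<not> ?thesis"
  define a b where "a = max i p" and "b = min (i + p + 1) m"
  have ab: "a \<le> b" "b \<le> m" unfolding a_def b_def using i knot_props(2) by auto
  have "\<xi> ! n = \<xi> ! a" if "a \<le> n" "n \<le> b" for n
    using that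
  proof (induction n rule: dec_induct)
    case (step n)
    have "\<not> \<xi> ! n < \<xi> ! Suc n" using none step unfolding a_def b_def by auto
    moreover have "\<xi> ! n \<le> \<xi> ! Suc n" using step ab by (intro knot_mono) auto
    ultimately show ?case using step by simp
  qed simp
  then have "\<xi> ! b = \<xi> ! a" using ab by blast
  moreover have "\<xi> ! a = \<xi> ! i" unfolding a_def using knot_props(4)[of i] knot_props(4)[of p] by (cases "i \<le> p") (auto simp: max_def)
  moreover have "\<xi> ! b = \<xi> ! (i + p + 1)"
  proof (cases "i + p + 1 \<le> m")
    case False
    then have "\<xi> ! (m + (i + p + 1 - m)) = 1" using i by (intro knot_props(5)) auto
    then show ?thesis unfolding b_def using False knot_props(5)[of 0] by (simp add: min_def)
  qed (simp add: b_def min_def)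
  ultimately show False using knot_gap[OF i] by simp
qed

lemma proper_span_knots:
  assumes "p \<le> j" "j < m" "\<xi> ! j < \<xi> ! Suc j"
  shows "proper_span ((!) \<xi>) j p"
  unfolding proper_span_def using assms knot_mono by auto

lemma spline_eq_span_spline:
  assumes "p \<le> j" "j < m" "\<xi> ! j < x" "x < \<xi> ! Suc j"
  shows "spline c x = poly (piece c j) x"
proof -
  have "spline c x = (\<Sum>i<m. c i * poly (span_bspline ((!) \<xi>) j p i) x)"
    using assms knot_props(1,3) by (intro sum.cong refl) (simp add: bspline_eq_span_bspline)
  also have "\<dots> = (\<Sum>i\<le>j. c i * poly (span_bspline ((!) \<xi>) j p i) x)"
    using assms by (intro sum.mono_neutral_right) (auto simp: span_bspline_eq_0)
  finally show ?thesis unfolding poly_span_spline .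
qed

lemma spline_sq_integrals:
  fixes c :: "nat \<Rightarrow> real"
  defines "f \<equiv> \<lambda>x. (spline c x)\<^sup>2"
  defines "F \<equiv> \<lambda>j. piece_energy c j"
  shows "f integrable_on {0..1}" "integral {0..1} f = (\<Sum>j\<in>{p..<m}. F j)" "\<And>j. 0 \<le> F j"
proof -
  have int: "(\<lambda>x. (poly q x)\<^sup>2) integrable_on {a..b}" for q :: "real poly" and a b
    by (intro integrable_continuous_interval continuous_intros)
  show "0 \<le> F j" for j unfolding F_def by (rule integral_nonneg[OF int]) auto
  have F: "(f has_integral F j) {\<xi> ! j..\<xi> ! Suc j}" if j: "p \<le> j" "j < m" for j
  proof (rule has_integral_spike_finite[of "{\<xi> ! j, \<xi> ! Suc j}"])
    show "((\<lambda>x. (poly (piece c j) x)\<^sup>2) has_integral F j) {\<xi> ! j..\<xi> ! Suc j}"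
      unfolding F_def by (rule integrable_integral[OF int])
    fix x assume "x \<in> {\<xi> ! j..\<xi> ! Suc j} - {\<xi> ! j, \<xi> ! Suc j}"
    then show "f x = (poly (piece c j) x)\<^sup>2"
      unfolding f_def using spline_eq_span_spline[OF j, of x c] by auto
  qed simp
  have "f integrable_on {\<xi> ! p..\<xi> ! m} \<and> integral {\<xi> ! p..\<xi> ! m} f = (\<Sum>j\<in>{p..<m}. integral {\<xi> ! j..\<xi> ! Suc j} f) \<and> \<xi> ! p \<le> \<xi> ! m"
    using knot_props(2) by (intro integral_sum_spans) (auto intro!: knot_mono has_integral_integrable[OF F])
  moreover have "\<xi> ! p = 0" "\<xi> ! m = 1" using knot_props(4)[of p] knot_props(5)[of 0] by auto
  moreover have "(\<Sum>j\<in>{p..<m}. integral {\<xi> ! j..\<xi> ! Suc j} f) = (\<Sum>j\<in>{p..<m}. F j)"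
    using integral_unique[OF F] by (intro sum.cong) auto
  ultimately show "f integrable_on {0..1}" "integral {0..1} f = (\<Sum>j\<in>{p..<m}. F j)" by auto
qed

text \<open>Each span lies in the supports of at most \<open>p + 1\<close> B-splines.\<close>

lemma overlap_sum:
  fixes F :: "nat \<Rightarrow> real"
  assumes "\<And>j. 0 \<le> F j"
  shows "(\<Sum>i<m. \<Sum>j\<in>spans i. F j) \<le> (real p + 1) * (\<Sum>j\<in>{p..<m}. F j)"
proof -
  have "(\<Sum>i<m. \<Sum>j\<in>spans i. F j)
      = (\<Sum>j\<in>{p..<m}. \<Sum>i\<in>{i\<in>{..<m}. i \<le> j \<and> j \<le> i + p}. F j)"
    by (rule sum.swap_restrict) auto
  also have "\<dots> \<le> (\<Sum>j\<in>{p..<m}. (real p + 1) * F j)"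
  proof (rule sum_mono)
    fix j assume j: "j \<in> {p..<m}"
    have "{i\<in>{..<m}. i \<le> j \<and> j \<le> i + p} \<subseteq> {j - p..j}" by auto
    then have "card {i\<in>{..<m}. i \<le> j \<and> j \<le> i + p} \<le> card {j - p..j}" by (intro card_mono) auto
    also have "\<dots> = p + 1" using j by simp
    finally have "real (card {i\<in>{..<m}. i \<le> j \<and> j \<le> i + p}) \<le> real p + 1" by simp
    then show "(\<Sum>i\<in>{i\<in>{..<m}. i \<le> j \<and> j \<le> i + p}. F j) \<le> (real p + 1) * F j"
      using assms[of j] by (simp add: mult_right_mono)
  qed
  finally show ?thesis by (simp add: sum_distrib_left)
qed

text \<open>On each span at most \<open>p + 1\<close> B-splines are active, and they take values between 0 and 1.\<close>

lemma spline_L2_upper: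
  "integral {0..1} (\<lambda>x. (spline c x)\<^sup>2) \<le> (real p + 1)\<^sup>2 * h * (\<Sum>i<m. (c i)\<^sup>2)"
proof -
  define F where "F j = piece_energy c j" for j
  have Fj: "F j \<le> (real p + 1) * h * (\<Sum>i\<in>{j - p..j}. (c i)\<^sup>2)" if j: "p \<le> j" "j < m" for j
  proof (cases "\<xi> ! j < \<xi> ! Suc j")
    case True
    note good = proper_span_knots[OF j True]
    have pt: "(poly (piece c j) x)\<^sup>2 \<le> (real p + 1) * (\<Sum>i\<in>{j - p..j}. (c i)\<^sup>2)"
      if x: "x \<in> {\<xi> ! j..\<xi> ! Suc j}" for x
    proof -
      let ?B = "\<lambda>i. poly (span_bspline ((!) \<xi>) j p i) x"
      have B: "0 \<le> ?B i" "?B i \<le> 1" for i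
        using x by (auto intro!: span_bspline_nonneg[OF good] span_bspline_le_1[OF good])
      have "poly (piece c j) x = (\<Sum>i\<in>{j - p..j}. c i * ?B i)"
        unfolding poly_span_spline by (intro sum.mono_neutral_right) (auto simp: span_bspline_eq_0)
      then have "(poly (piece c j) x)\<^sup>2 \<le> (\<Sum>i\<in>{j - p..j}. (c i * ?B i)\<^sup>2) * (real p + 1)"
        using sum_squared_le_sum_of_squares[of "\<lambda>i. c i * ?B i" "{j - p..j}"] j by (simp add: add.commute)
      also have "\<dots> \<le> (\<Sum>i\<in>{j - p..j}. (c i)\<^sup>2) * (real p + 1)"
      proof (intro mult_right_mono sum_mono)
        fix i
        have "(?B i)\<^sup>2 \<le> 1" using B by (simp add: power_le_one)
        then show "(c i * ?B i)\<^sup>2 \<le> (c i)\<^sup>2" unfolding power_mult_distrib by (simp add: mult_left_le)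
      qed simp
      finally show ?thesis by (simp add: mult.commute)
    qed
    have "F j \<le> integral {\<xi> ! j..\<xi> ! Suc j} (\<lambda>x. (real p + 1) * (\<Sum>i\<in>{j - p..j}. (c i)\<^sup>2))"
      unfolding F_def by (intro integral_le pt integrable_continuous_interval continuous_intros)
    also have "\<dots> = (\<xi> ! Suc j - \<xi> ! j) * ((real p + 1) * (\<Sum>i\<in>{j - p..j}. (c i)\<^sup>2))" using True by simp
    also have "\<dots> \<le> h * ((real p + 1) * (\<Sum>i\<in>{j - p..j}. (c i)\<^sup>2))"
      using span_le[of j] j knot_props(1) by (intro mult_right_mono) (auto intro!: sum_nonneg mult_nonneg_nonneg)
    finally show ?thesis by (simp add: mult_ac)
  next
    case False
    then have "\<xi> ! j = \<xi> ! Suc j" using knot_mono[of j "Suc j"] j by auto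
    then have "F j = 0" unfolding F_def by simp
    then show ?thesis using h_pos by (simp add: sum_nonneg)
  qed
  have "integral {0..1} (\<lambda>x. (spline c x)\<^sup>2) = (\<Sum>j\<in>{p..<m}. F j)"
    unfolding F_def by (rule spline_sq_integrals)
  also have "\<dots> \<le> (\<Sum>j\<in>{p..<m}. (real p + 1) * h * (\<Sum>i\<in>{j - p..j}. (c i)\<^sup>2))"
    using Fj by (intro sum_mono) auto
  also have "\<dots> = (real p + 1) * h * (\<Sum>j\<in>{p..<m}. \<Sum>i\<in>{i\<in>{..<m}. i \<le> j \<and> j \<le> i + p}. (c i)\<^sup>2)"
    unfolding sum_distrib_left[symmetric]
    by (intro arg_cong2[where f = "(*)"] refl sum.cong) auto
  also have "(\<Sum>j\<in>{p..<m}. \<Sum>i\<in>{i\<in>{..<m}. i \<le> j \<and> j \<le> i + p}. (c i)\<^sup>2)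
      = (\<Sum>i<m. \<Sum>j\<in>spans i. (c i)\<^sup>2)"
    by (rule sum.swap_restrict) auto
  also have "\<dots> \<le> (\<Sum>i<m. (real p + 1) * (c i)\<^sup>2)"
  proof (rule sum_mono)
    fix i
    have "card (spans i) \<le> card {i..i + p}" by (intro card_mono) auto
    then have "real (card (spans i)) \<le> real p + 1" by simp
    then show "(\<Sum>j\<in>spans i. (c i)\<^sup>2) \<le> (real p + 1) * (c i)\<^sup>2"
      by (simp add: mult_right_mono)
  qed
  finally have "integral {0..1} (\<lambda>x. (spline c x)\<^sup>2) \<le> (real p + 1) * h * (\<Sum>i<m. (real p + 1) * (c i)\<^sup>2)"
    using h_pos by (simp add: mult_left_mono)
  moreover have "(\<Sum>i<m. (real p + 1) * (c i)\<^sup>2) = (real p + 1) * (\<Sum>i<m. (c i)\<^sup>2)"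
    by (simp add: sum_distrib_left)
  ultimately show ?thesis by (simp add: power2_eq_square[of "real p + 1"] mult_ac)
qed

text \<open>Every coefficient is charged to one nonempty span in the support of its B-spline, of length at least
\<open>\<alpha> h\<close>, and each span is charged at most \<open>p + 1\<close> times.  The knots around a span of length
\<open>s\<close> spread over at most \<open>2 p h \<le> (2 p / \<alpha>) s\<close>.\<close>

lemma spline_L2_lower:
  assumes K: "0 < K" "span_stable p (2 * real p / \<alpha>) K"
  shows "\<alpha> / (K * (real p + 1)) * h * (\<Sum>i<m. (c i)\<^sup>2) \<le> integral {0..1} (\<lambda>x. (spline c x)\<^sup>2)"
proof -
  define F where "F j = piece_energy c j" for j
  have F0: "0 \<le> F j" for j unfolding F_def by (rule spline_sq_integrals)
  have ci: "\<alpha> * h * (c i)\<^sup>2 \<le> K * (\<Sum>j\<in>spans i. F j)" if i: "i < m" for i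
  proof -
    obtain j where j: "p \<le> j" "j < m" "i \<le> j" "j \<le> i + p" "\<xi> ! j < \<xi> ! Suc j" using exists_span[OF i] by blast
    have s: "\<alpha> * h \<le> \<xi> ! Suc j - \<xi> ! j" using span_ge[of j] j knot_props(1) by simp
    have "\<xi> ! (j + p) - \<xi> ! (j + 1 - p) \<le> real (j + p - (j + 1 - p)) * h"
      using j p by (intro knot_diff_le) auto
    also have "\<dots> \<le> (2 * real p) * h" using h_pos p j by (intro mult_right_mono) auto
    also have "\<dots> = (2 * real p / \<alpha>) * (\<alpha> * h)" using \<alpha> by simp
    also have "\<dots> \<le> (2 * real p / \<alpha>) * (\<xi> ! Suc j - \<xi> ! j)" using s \<alpha> by (intro mult_left_mono) auto
    finally have "(\<xi> ! Suc j - \<xi> ! j) * (c i)\<^sup>2 \<le> K * F j"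
      unfolding F_def using j proper_span_knots by (intro K(2)[unfolded span_stable_def, rule_format]) auto
    moreover have "\<alpha> * h * (c i)\<^sup>2 \<le> (\<xi> ! Suc j - \<xi> ! j) * (c i)\<^sup>2" using s by (intro mult_right_mono) auto
    moreover have "F j \<le> (\<Sum>j\<in>spans i. F j)"
      using j F0 by (intro member_le_sum) auto
    then have "K * F j \<le> K * (\<Sum>j\<in>spans i. F j)" using K(1) by simp
    ultimately show ?thesis by linarith
  qed
  have "\<alpha> * h * (\<Sum>i<m. (c i)\<^sup>2) \<le> K * (\<Sum>i<m. \<Sum>j\<in>spans i. F j)"
    unfolding sum_distrib_left[of _ _ "{..<m}"] using ci by (intro sum_mono) auto
  also have "\<dots> \<le> K * ((real p + 1) * (\<Sum>j\<in>{p..<m}. F j))"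
    using overlap_sum[OF F0] K(1) by (intro mult_left_mono) auto
  also have "(\<Sum>j\<in>{p..<m}. F j) = integral {0..1} (\<lambda>x. (spline c x)\<^sup>2)"
    unfolding F_def by (rule spline_sq_integrals(2)[symmetric])
  finally have "\<alpha> * h * (\<Sum>i<m. (c i)\<^sup>2) \<le> integral {0..1} (\<lambda>x. (spline c x)\<^sup>2) * (K * (real p + 1))"
    by (simp add: mult_ac)
  then have "\<alpha> * h * (\<Sum>i<m. (c i)\<^sup>2) / (K * (real p + 1)) \<le> integral {0..1} (\<lambda>x. (spline c x)\<^sup>2)"
    using K(1) by (subst pos_divide_le_eq) auto
  then show ?thesis by simp
qed

end

theorem spline_L2_stability:
  assumes "1 \<le> p" "0 < \<alpha>"
  shows "\<exists>\<gamma>>0. \<forall>\<xi> h c. quasi_uniform_knots p \<xi> h \<alpha> \<longrightarrow>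
    \<gamma> * h * (\<Sum>i<num_bsplines p \<xi>. (c i)\<^sup>2)
      \<le> integral {0..1} (\<lambda>x. (\<Sum>i<num_bsplines p \<xi>. c i * bspline \<xi> p i x)\<^sup>2)"
proof -
  obtain K where K: "0 < K" "span_stable p (2 * real p / \<alpha>) K"
    using span_spline_coeff_bound[of "2 * real p / \<alpha>" p] assms by auto
  show ?thesis
    using quasi_uniform_knots.spline_L2_lower[OF _ K] K(1) assms
    by (intro exI[of _ "\<alpha> / (K * (real p + 1))"]) auto
qed

section \<open>Tensor products\<close>

hide_fact (open) Henstock_Kurzweil_Integration.integrable_sum Henstock_Kurzweil_Integration.integral_sum

text \<open>The quadratic form of the Kronecker product of the matrices \<open>A k\<close>.\<close>

definition tensor_form :: "'k set \<Rightarrow> ('k \<Rightarrow> nat) \<Rightarrow> ('k \<Rightarrow> nat \<Rightarrow> nat \<Rightarrow> real) \<Rightarrow> (('k \<Rightarrow> nat) \<Rightarrow> real) \<Rightarrow> real" where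
  "tensor_form D N A c = (\<Sum>I\<in>PiE D (\<lambda>k. {..<N k}). \<Sum>J\<in>PiE D (\<lambda>k. {..<N k}). c I * c J * (\<Prod>k\<in>D. A k (I k) (J k)))"

lemma sum_PiE_insert:
  assumes "finite D" "k \<notin> D"
  shows "(\<Sum>I\<in>PiE (insert k D) S. f I) = (\<Sum>I\<in>PiE D S. \<Sum>i\<in>S k. f (I(k := i)))"
proof -
  have inj: "inj_on (\<lambda>(i, I). I(k := i)) (S k \<times> PiE D S)" by (rule inj_combinator[OF assms(2)])
  have "(\<Sum>I\<in>PiE (insert k D) S. f I) = (\<Sum>(i, I)\<in>S k \<times> PiE D S. f (I(k := i)))"
    unfolding PiE_insert_eq by (subst sum.reindex[OF inj]) (simp add: case_prod_unfold o_def)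
  also have "\<dots> = (\<Sum>i\<in>S k. \<Sum>I\<in>PiE D S. f (I(k := i)))" by (simp add: sum.cartesian_product)
  finally show ?thesis by (simp add: sum.swap[of _ "S k"])
qed

text \<open>Induction on the set of directions.  As \<open>A k\<close> is a Gram matrix, the form of the product is the
integral of the form of the remaining directions at the coefficients contracted with \<open>b k\<close>.  The
induction hypothesis applies under the integral sign, and afterwards the bound for the direction
\<open>k\<close> applies to each of the remaining indices.\<close>

lemma tensor_form_bounds:
  fixes b :: "'k \<Rightarrow> nat \<Rightarrow> 'x \<Rightarrow> real" and \<mu> :: "'x measure"
  assumes fin: "finite D"
    and int: "\<And>k i j. k \<in> D \<Longrightarrow> integrable \<mu> (\<lambda>x. b k i x * b k j x)"
    and A: "\<And>k i j. A k i j = (\<integral>x. b k i x * b k j x \<partial>\<mu>)"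
    and lo: "\<And>k c. k \<in> D \<Longrightarrow> l * (\<Sum>i<N k. (c i)\<^sup>2) \<le> (\<integral>x. (\<Sum>i<N k. c i * b k i x)\<^sup>2 \<partial>\<mu>)"
    and up: "\<And>k c. k \<in> D \<Longrightarrow> (\<integral>x. (\<Sum>i<N k. c i * b k i x)\<^sup>2 \<partial>\<mu>) \<le> u * (\<Sum>i<N k. (c i)\<^sup>2)"
    and l: "0 \<le> l" and u: "0 \<le> u"
  shows "l ^ card D * (\<Sum>I\<in>PiE D (\<lambda>k. {..<N k}). (c I)\<^sup>2) \<le> tensor_form D N A c \<and>
         tensor_form D N A c \<le> u ^ card D * (\<Sum>I\<in>PiE D (\<lambda>k. {..<N k}). (c I)\<^sup>2)"
  using fin int lo up
proof (induction D arbitrary: c rule: finite_induct)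
  case empty
  then show ?case by (simp add: tensor_form_def power2_eq_square)
next
  case (insert k D)
  let ?P = "PiE D (\<lambda>k. {..<N k})"
  define w where "w x I = (\<Sum>i<N k. c (I(k := i)) * b k i x)" for x I
  have intk: "integrable \<mu> (\<lambda>x. b k i x * b k j x)" for i j using insert.prems(1) by simp
  have IH: "l ^ card D * (\<Sum>I\<in>?P. (c I)\<^sup>2) \<le> tensor_form D N A c \<and>
         tensor_form D N A c \<le> u ^ card D * (\<Sum>I\<in>?P. (c I)\<^sup>2)" for c
    using insert.prems by (intro insert.IH) auto
  have expand: "w x I * w x J = (\<Sum>i<N k. \<Sum>j<N k. c (I(k := i)) * c (J(k := j)) * (b k i x * b k j x))" for x I J
    unfolding w_def sum_product by (intro sum.cong refl) simp
  have intw: "integrable \<mu> (\<lambda>x. w x I * w x J)" for I J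
    unfolding expand by (intro integrable_sum integrable_mult_right intk)
  have Iw: "(\<integral>x. w x I * w x J \<partial>\<mu>) = (\<Sum>i<N k. \<Sum>j<N k. c (I(k := i)) * c (J(k := j)) * A k i j)" for I J
  proof -
    have "(\<integral>x. w x I * w x J \<partial>\<mu>) = (\<Sum>i<N k. (\<integral>x. (\<Sum>j<N k. c (I(k := i)) * c (J(k := j)) * (b k i x * b k j x)) \<partial>\<mu>))"
      unfolding expand
      by (rule integral_sum) (intro integrable_sum integrable_mult_right intk)
    also have "\<dots> = (\<Sum>i<N k. \<Sum>j<N k. c (I(k := i)) * c (J(k := j)) * A k i j)"
      unfolding A
      by (intro sum.cong refl, subst integral_sum) (auto intro: integrable_mult_right intk)
    finally show ?thesis .
  qed
  have prodk: "(\<Prod>k'\<in>D. A k' ((I(k := i)) k') ((J(k := j)) k')) = (\<Prod>k'\<in>D. A k' (I k') (J k'))" for I J i j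
    using insert(2) by (intro prod.cong) auto
  have "tensor_form (insert k D) N A c =
     (\<Sum>I\<in>?P. \<Sum>i<N k. \<Sum>J\<in>?P. \<Sum>j<N k. c (I(k := i)) * c (J(k := j)) * (A k i j * (\<Prod>k'\<in>D. A k' (I k') (J k'))))"
    unfolding tensor_form_def sum_PiE_insert[OF insert(1,2)] using insert(1,2) prodk by simp
  also have "\<dots> = (\<Sum>I\<in>?P. \<Sum>J\<in>?P. (\<integral>x. w x I * w x J \<partial>\<mu>) * (\<Prod>k'\<in>D. A k' (I k') (J k')))"
    unfolding Iw sum_distrib_right
    by (intro sum.cong refl, subst sum.swap) (simp add: mult_ac)
  also have "\<dots> = (\<integral>x. tensor_form D N A (w x) \<partial>\<mu>)"
    unfolding tensor_form_def
    by (subst integral_sum, auto intro!: integrable_sum intw sum.cong)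
       (subst integral_sum, auto intro!: intw)
  finally have T: "tensor_form (insert k D) N A c = (\<integral>x. tensor_form D N A (w x) \<partial>\<mu>)" .
  have intT: "integrable \<mu> (\<lambda>x. tensor_form D N A (w x))"
    unfolding tensor_form_def by (intro integrable_sum integrable_mult_left intw)
  have intS: "integrable \<mu> (\<lambda>x. a * (\<Sum>I\<in>?P. (w x I)\<^sup>2))" for a
    unfolding power2_eq_square by (intro integrable_mult_right integrable_sum intw)
  have IS: "(\<integral>x. a * (\<Sum>I\<in>?P. (w x I)\<^sup>2) \<partial>\<mu>) = a * (\<Sum>I\<in>?P. \<integral>x. (w x I)\<^sup>2 \<partial>\<mu>)" for a
    using intw unfolding power2_eq_square by (subst integral_mult_right_zero, subst integral_sum) auto
  have sq: "(\<Sum>I\<in>PiE (insert k D) (\<lambda>k. {..<N k}). (c I)\<^sup>2) = (\<Sum>I\<in>?P. \<Sum>i<N k. (c (I(k := i)))\<^sup>2)"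
    by (rule sum_PiE_insert[OF insert(1,2)])
  have card: "card (insert k D) = Suc (card D)" using insert(1,2) by simp
  show ?case
  proof
    have "l ^ card D * (\<Sum>I\<in>?P. l * (\<Sum>i<N k. (c (I(k := i)))\<^sup>2)) \<le> l ^ card D * (\<Sum>I\<in>?P. \<integral>x. (w x I)\<^sup>2 \<partial>\<mu>)"
      unfolding w_def using l by (intro mult_left_mono sum_mono insert.prems(2)) auto
    also have "\<dots> \<le> (\<integral>x. tensor_form D N A (w x) \<partial>\<mu>)"
      unfolding IS[symmetric] using IH by (intro integral_mono intS intT) auto
    finally show "l ^ card (insert k D) * (\<Sum>I\<in>PiE (insert k D) (\<lambda>k. {..<N k}). (c I)\<^sup>2) \<le> tensor_form (insert k D) N A c"
      unfolding T sq card by (simp add: sum_distrib_left[symmetric] mult_ac)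
  next
    have "(\<integral>x. tensor_form D N A (w x) \<partial>\<mu>) \<le> u ^ card D * (\<Sum>I\<in>?P. \<integral>x. (w x I)\<^sup>2 \<partial>\<mu>)"
      unfolding IS[symmetric] using IH by (intro integral_mono intS intT) auto
    also have "\<dots> \<le> u ^ card D * (\<Sum>I\<in>?P. u * (\<Sum>i<N k. (c (I(k := i)))\<^sup>2))"
      unfolding w_def using u by (intro mult_left_mono sum_mono insert.prems(3)) auto
    finally show "tensor_form (insert k D) N A c \<le> u ^ card (insert k D) * (\<Sum>I\<in>PiE (insert k D) (\<lambda>k. {..<N k}). (c I)\<^sup>2)"
      unfolding T sq card by (simp add: sum_distrib_left[symmetric] mult_ac)
  qed
qed

lemma integral_prod_components:
  fixes f :: "'d::finite \<Rightarrow> real \<Rightarrow> real"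
  assumes int: "\<And>k. integrable lborel (f k)"
  shows "(\<integral>x. (\<Prod>k\<in>UNIV. f k (vec_nth x k)) \<partial>(lborel :: (real ^ 'd) measure)) = (\<Prod>k\<in>UNIV. \<integral>y. f k y \<partial>lborel)"
proof -
  interpret product_sigma_finite "\<lambda>_::real ^ 'd. lborel :: real measure" by standard
  define ax :: "'d \<Rightarrow> real ^ 'd" where "ax k = axis k 1" for k
  have inj: "inj ax" unfolding ax_def by (auto simp: inj_on_def axis_eq_axis)
  have Basis: "(Basis :: (real ^ 'd) set) = range ax" unfolding Basis_vec_def ax_def by auto
  define F where "F b = f (inv_into UNIV ax b)" for b
  have F: "F (ax k) = f k" for k unfolding F_def using inj by simp
  have [measurable]: "f k \<in> borel_measurable borel" for k using borel_measurable_integrable[OF int] by simp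
  have comp: "vec_nth (\<Sum>b\<in>Basis. g b *\<^sub>R b) k = g (ax k)" for g :: "real ^ 'd \<Rightarrow> real" and k
  proof -
    have "vec_nth (\<Sum>b\<in>Basis. g b *\<^sub>R b) k = (\<Sum>i\<in>UNIV. g (ax i) * vec_nth (ax i) k)"
      unfolding Basis by (subst sum.reindex[OF inj]) simp
    also have "\<dots> = (\<Sum>i\<in>UNIV. if i = k then g (ax i) else 0)"
      by (intro sum.cong) (auto simp: ax_def axis_def)
    finally show ?thesis by simp
  qed
  have m: "(\<lambda>x. (\<Prod>k\<in>UNIV. f k (vec_nth x k))) \<in> borel_measurable (borel :: (real ^ 'd) measure)"
    by measurable
  have "(\<integral>x. (\<Prod>k\<in>UNIV. f k (vec_nth x k)) \<partial>(lborel :: (real ^ 'd) measure))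
     = (\<integral>g. (\<Prod>k\<in>UNIV. f k (vec_nth (\<Sum>b\<in>Basis. g b *\<^sub>R b) k)) \<partial>PiM (Basis :: (real ^ 'd) set) (\<lambda>_. lborel))"
    unfolding lborel_eq[where 'a = "real ^ 'd"] by (rule integral_distr[OF _ m]) measurable
  also have "\<dots> = (\<integral>g. (\<Prod>b\<in>Basis. F b (g b)) \<partial>PiM (Basis :: (real ^ 'd) set) (\<lambda>_. lborel))"
    unfolding comp unfolding Basis by (subst prod.reindex[OF inj]) (simp add: F)
  also have "\<dots> = (\<Prod>b\<in>Basis. \<integral>y. F b y \<partial>lborel)"
    by (rule product_integral_prod) (auto simp: F_def int)
  also have "\<dots> = (\<Prod>k\<in>UNIV. \<integral>y. f k y \<partial>lborel)"
    unfolding Basis by (subst prod.reindex[OF inj]) (simp add: F)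
  finally show ?thesis .
qed

section \<open>Change of variables\<close>

lemma det_reindex:
  fixes A :: "'a::comm_ring_1 ^ 'm ^ 'm" and f :: "'n::finite \<Rightarrow> 'm::finite"
  assumes f: "bij f"
  shows "Determinants.det (\<chi> i j. vec_nth (vec_nth A (f i)) (f j)) = Determinants.det A"
proof -
  define f' where "f' = inv_into UNIV f"
  have f': "bij f'" "\<And>x. f' (f x) = x" "\<And>y. f (f' y) = y"
    unfolding f'_def using f by (auto simp: bij_imp_bij_inv bij_is_inj bij_is_surj surj_f_inv_f inv_f_f)
  have m: "map_permutation UNIV f p = f \<circ> p \<circ> f'" for p
    unfolding map_permutation_def restrict_id_def f'_def using f by (auto simp: bij_is_surj fun_eq_iff)
  have m': "map_permutation UNIV f' p = f' \<circ> p \<circ> f" for p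
  proof -
    have "inv_into UNIV f' = f" using f' by (metis (no_types) ext inv_f_eq bij_is_inj)
    then show ?thesis
      unfolding map_permutation_def restrict_id_def using f'(1) by (auto simp: bij_is_surj fun_eq_iff)
  qed
  show ?thesis unfolding Determinants.det_def
  proof (rule sum.reindex_bij_witness[where i = "map_permutation UNIV f'" and j = "map_permutation UNIV f"])
    fix p assume p: "p \<in> {p. p permutes (UNIV :: 'n set)}"
    show "map_permutation UNIV f' (map_permutation UNIV f p) = p"
      unfolding m m' by (simp add: fun_eq_iff f')
    show "map_permutation UNIV f p \<in> {p. p permutes UNIV}"
      using map_permutation_permutes[of f UNIV UNIV p] f p by simp
    have "sign (map_permutation UNIV f p) = sign p"
      by (rule sign_map_permutation) (use p f in \<open>auto simp: bij_is_inj\<close>)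
    moreover have "(\<Prod>i\<in>UNIV. vec_nth (vec_nth A i) (map_permutation UNIV f p i)) = (\<Prod>i\<in>UNIV. vec_nth (vec_nth A (f i)) (f (p i)))"
      unfolding m using f by (intro prod.reindex_bij_witness[where i = f and j = f']) (auto simp: f')
    ultimately show "of_int (sign (map_permutation UNIV f p)) * (\<Prod>i\<in>UNIV. vec_nth (vec_nth A i) (map_permutation UNIV f p i))
      = of_int (sign p) * (\<Prod>i\<in>UNIV. vec_nth (vec_nth (\<chi> i j. vec_nth (vec_nth A (f i)) (f j)) i) (p i))" by simp
  next
    fix q assume q: "q \<in> {p. p permutes (UNIV :: 'm set)}"
    show "map_permutation UNIV f (map_permutation UNIV f' q) = q"
      unfolding m m' by (simp add: fun_eq_iff f')
    show "map_permutation UNIV f' q \<in> {p. p permutes UNIV}"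
      using map_permutation_permutes[of f' UNIV UNIV q] f' q by simp
  qed
qed

text \<open>The change of variables formula for functions with values in some \<open>\<real>\<^sup>n\<close>, specialized to real
functions and Lebesgue--Borel integrals.  It needs a well-order on the type of coordinates.\<close>

lemma change_of_variables_wellorder:
  fixes f :: "real ^ 'n::{finite,wellorder} \<Rightarrow> real" and g :: "real ^ 'n::_ \<Rightarrow> real ^ 'n::_"
  assumes S: "compact S" and der: "\<And>x. x \<in> S \<Longrightarrow> (g has_derivative g' x) (at x within S)" and inj: "inj_on g S"
    and int: "set_integrable lborel S (\<lambda>x. \<bar>Determinants.det (matrix (g' x))\<bar> * f (g x))"
    and meas: "(\<lambda>x. indicator (g ` S) x * f x) \<in> borel_measurable borel"
  shows "set_integrable lborel (g ` S) f \<and>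
    (LINT x:g ` S|lborel. f x) = (LINT x:S|lborel. \<bar>Determinants.det (matrix (g' x))\<bar> * f (g x))"
proof -
  define e :: "real ^ 1" where "e = axis 1 1"
  have ee: "inner e e = 1" unfolding e_def by (simp add: inner_axis_axis)
  let ?d = "\<lambda>x. \<bar>Determinants.det (matrix (g' x))\<bar>"
  have d1: "set_integrable lebesgue S (\<lambda>x. ?d x * f (g x))"
    using int borel_measurable_integrable[OF int[unfolded set_integrable_def]]
    unfolding set_integrable_def by (simp add: integrable_completion)
  then have d2: "set_integrable lebesgue S (\<lambda>x. ?d x *\<^sub>R (f (g x) *\<^sub>R e))"
    using absolutely_integrable_linear[OF d1 bounded_linear_scaleR_left[of e]] by (simp add: o_def)
  have iff: "(\<lambda>x. ?d x *\<^sub>R (f (g x) *\<^sub>R e)) absolutely_integrable_on S \<and>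
             integral S (\<lambda>x. ?d x *\<^sub>R (f (g x) *\<^sub>R e)) = b
      \<longleftrightarrow> (\<lambda>y. f y *\<^sub>R e) absolutely_integrable_on (g ` S) \<and> integral (g ` S) (\<lambda>y. f y *\<^sub>R e) = b" for b
    using has_absolute_integral_change_of_variables_compact[OF S der inj, of "\<lambda>y. f y *\<^sub>R e" b] by simp
  have a1: "(\<lambda>y. f y *\<^sub>R e) absolutely_integrable_on (g ` S)"
    and i1: "integral (g ` S) (\<lambda>y. f y *\<^sub>R e) = integral S (\<lambda>x. ?d x *\<^sub>R (f (g x) *\<^sub>R e))"
    using iff[of "integral S (\<lambda>x. ?d x *\<^sub>R (f (g x) *\<^sub>R e))"] d2 by auto
  have a2: "f absolutely_integrable_on (g ` S)"
    using absolutely_integrable_component[OF a1, of e] by (simp add: ee)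
  have a3: "set_integrable lborel (g ` S) f"
    using a2 meas unfolding set_integrable_def by (simp add: integrable_completion)
  have "integral (g ` S) f = inner (integral (g ` S) (\<lambda>y. f y *\<^sub>R e)) e"
    using integral_linear[OF set_lebesgue_integral_eq_integral(1)[OF a1] bounded_linear_inner_left[of e]]
    by (simp add: o_def ee)
  also have "\<dots> = integral S (\<lambda>x. ?d x * f (g x))"
    unfolding i1 using integral_linear[OF set_lebesgue_integral_eq_integral(1)[OF d2] bounded_linear_inner_left[of e]]
    by (simp add: o_def ee)
  finally show ?thesis using a3 set_borel_integral_eq_integral(2)[OF a3] set_borel_integral_eq_integral(2)[OF int] by simp
qed

text \<open>Every finite type of coordinates can be well-ordered, but it need not come with an order.  A copy of
the type carries one, and integrals, derivatives and determinants are transported along the bijection.\<close>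

typedef 'a ordered_copy = "UNIV :: 'a set" by auto

definition copy_rank :: "'a::finite ordered_copy \<Rightarrow> nat" where
  "copy_rank = (SOME r. inj r)"

instance ordered_copy :: (finite) finite
proof
  have "UNIV = range (Abs_ordered_copy :: 'a \<Rightarrow> 'a ordered_copy)"
    by (metis Rep_ordered_copy_inverse rangeI UNIV_eq_I)
  then show "finite (UNIV :: 'a ordered_copy set)" by (metis finite_imageI finite_class.finite_UNIV)
qed

lemma inj_copy_rank: "inj (copy_rank :: 'a::finite ordered_copy \<Rightarrow> nat)"
proof -
  have "\<exists>r :: 'a ordered_copy \<Rightarrow> nat. inj r"
    using finite_imp_inj_to_nat_seg[of "UNIV :: 'a ordered_copy set"] by auto
  then show ?thesis unfolding copy_rank_def by (rule someI_ex)
qed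

instantiation ordered_copy :: (finite) wellorder
begin

definition less_eq_ordered_copy :: "'a ordered_copy \<Rightarrow> 'a ordered_copy \<Rightarrow> bool" where
  "less_eq_ordered_copy x y \<longleftrightarrow> copy_rank x \<le> copy_rank y"

definition less_ordered_copy :: "'a ordered_copy \<Rightarrow> 'a ordered_copy \<Rightarrow> bool" where
  "less_ordered_copy x y \<longleftrightarrow> copy_rank x < copy_rank y"

instance
proof
  fix P :: "'a ordered_copy \<Rightarrow> bool" and a
  assume step: "\<And>x. (\<And>y. y < x \<Longrightarrow> P y) \<Longrightarrow> P x"
  show "P a"
    by (induction "copy_rank a" arbitrary: a rule: less_induct) (auto intro: step simp: less_ordered_copy_def)
qed (use inj_copy_rank in \<open>auto simp: less_eq_ordered_copy_def less_ordered_copy_def inj_def\<close>)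

end

definition to_copy :: "real ^ 'd::finite \<Rightarrow> real ^ 'd ordered_copy" where
  "to_copy x = (\<chi> i. vec_nth x (Rep_ordered_copy i))"

definition of_copy :: "real ^ 'd::finite ordered_copy \<Rightarrow> real ^ 'd" where
  "of_copy y = (\<chi> i. vec_nth y (Abs_ordered_copy i))"

lemma copy_inverse [simp]: "of_copy (to_copy x) = x" "to_copy (of_copy y) = y"
  unfolding to_copy_def of_copy_def by (simp_all add: Finite_Cartesian_Product.vec_eq_iff Rep_ordered_copy_inverse Abs_ordered_copy_inverse)

lemma bij_Rep_ordered_copy: "bij Rep_ordered_copy"
  by (metis Abs_ordered_copy_inverse Rep_ordered_copy_inverse UNIV_I bijI')

lemma all_copy_iff: "(\<forall>i. P i (Rep_ordered_copy i)) \<longleftrightarrow> (\<forall>k. P (Abs_ordered_copy k) k)"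
  by (metis Abs_ordered_copy_inverse Rep_ordered_copy_inverse UNIV_I)

lemma linear_to_copy: "linear to_copy"
  unfolding to_copy_def by (rule linearI) (simp_all add: Finite_Cartesian_Product.vec_eq_iff)

lemma linear_of_copy: "linear of_copy"
  unfolding of_copy_def by (rule linearI) (simp_all add: Finite_Cartesian_Product.vec_eq_iff)

lemma measurable_to_copy [measurable]: "to_copy \<in> borel_measurable borel"
  by (intro borel_measurable_continuous_onI linear_continuous_on linear_conv_bounded_linear[THEN iffD1] linear_to_copy)

lemma measurable_of_copy [measurable]: "of_copy \<in> borel_measurable borel"
  by (intro borel_measurable_continuous_onI linear_continuous_on linear_conv_bounded_linear[THEN iffD1] linear_of_copy)

lemma prod_Basis_cart:
  fixes w :: "real ^ 'd::finite"
  shows "(\<Prod>b\<in>Basis. inner w b) = (\<Prod>i\<in>UNIV. vec_nth w i)"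
proof -
  have inj: "inj (\<lambda>i::'d. axis i (1::real))" by (auto simp: inj_def axis_eq_axis)
  have B: "(Basis :: (real ^ 'd) set) = range (\<lambda>i::'d. axis i (1::real))" by (auto simp: Basis_vec_def)
  show ?thesis unfolding B by (subst prod.reindex[OF inj]) (simp add: inner_axis)
qed

lemma lborel_to_copy: "lborel = distr lborel borel (to_copy :: real ^ 'd::finite \<Rightarrow> _)"
proof (rule lborel_eqI)
  fix l u :: "real ^ 'd ordered_copy"
  assume le: "\<And>b. b \<in> Basis \<Longrightarrow> inner l b \<le> inner u b"
  have vim: "to_copy -` box l u = box (of_copy l) (of_copy u)"
  proof (rule Set.set_eqI)
    fix x
    show "x \<in> to_copy -` box l u \<longleftrightarrow> x \<in> box (of_copy l) (of_copy u)"
      using all_copy_iff[of "\<lambda>i k. vec_nth l i < vec_nth x k \<and> vec_nth x k < vec_nth u i"]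
      by (simp add: mem_box_cart to_copy_def of_copy_def)
  qed
  have c: "vec_nth l i \<le> vec_nth u i" for i
    using le[of "axis i 1"] by (simp add: inner_axis axis_in_Basis_iff)
  have "emeasure (distr lborel borel to_copy) (box l u) = emeasure lborel (box (of_copy l) (of_copy u))"
    by (subst emeasure_distr) (auto simp: vim)
  also have "\<dots> = (\<Prod>b\<in>Basis. inner (of_copy u - of_copy l) b)"
    using c by (subst emeasure_lborel_box) (auto simp: Basis_vec_def inner_axis of_copy_def)
  also have "(\<Prod>b\<in>Basis. inner (of_copy u - of_copy l) b) = (\<Prod>i\<in>UNIV. vec_nth (of_copy u - of_copy l) i)"
    by (rule prod_Basis_cart)
  also have "\<dots> = (\<Prod>i\<in>UNIV. vec_nth (u - l) i)"
    by (rule prod.reindex_bij_witness[where i = Rep_ordered_copy and j = Abs_ordered_copy])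
       (auto simp: of_copy_def Abs_ordered_copy_inverse Rep_ordered_copy_inverse)
  also have "\<dots> = (\<Prod>b\<in>Basis. inner (u - l) b)"
    by (rule prod_Basis_cart[symmetric])
  finally show "emeasure (distr lborel borel to_copy) (box l u) = (\<Prod>b\<in>Basis. inner (u - l) b)" .
qed simp

lemma set_integral_to_copy:
  fixes h :: "real ^ 'd::finite \<Rightarrow> real"
  assumes m: "(\<lambda>x. indicator S x * h x) \<in> borel_measurable borel"
  shows "set_integrable lborel (to_copy ` S) (\<lambda>y. h (of_copy y)) \<longleftrightarrow> set_integrable lborel S h"
    and "(LINT y:to_copy ` S|lborel. h (of_copy y)) = (LINT x:S|lborel. h x)"
proof -
  have ind: "indicator (to_copy ` S) y = (indicator S (of_copy y) :: real)" for y
    by (auto simp: indicator_def image_iff) (metis copy_inverse)+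
  have m': "(\<lambda>y. indicator S (of_copy y) * h (of_copy y)) \<in> borel_measurable borel"
    using measurable_compose[OF measurable_of_copy m] .
  show "set_integrable lborel (to_copy ` S) (\<lambda>y. h (of_copy y)) \<longleftrightarrow> set_integrable lborel S h"
    unfolding set_integrable_def ind lborel_to_copy
    by (subst integrable_distr_eq) (use m' in auto)
  show "(LINT y:to_copy ` S|lborel. h (of_copy y)) = (LINT x:S|lborel. h x)"
    unfolding set_lebesgue_integral_def ind lborel_to_copy
    by (subst integral_distr) (use m' in auto)
qed

lemma matrix_copy:
  fixes L :: "real ^ 'd::finite \<Rightarrow> real ^ 'd"
  shows "matrix (\<lambda>y. to_copy (L (of_copy y))) = (\<chi> i j. vec_nth (vec_nth (matrix L) (Rep_ordered_copy i)) (Rep_ordered_copy j))"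
proof -
  have ax: "of_copy (axis j 1) = axis (Rep_ordered_copy j) 1" for j :: "'d ordered_copy"
    unfolding of_copy_def axis_def Finite_Cartesian_Product.vec_eq_iff
    by (simp, metis Abs_ordered_copy_inverse Rep_ordered_copy_inverse UNIV_I)
  show ?thesis unfolding matrix_def ax by (simp add: Finite_Cartesian_Product.vec_eq_iff to_copy_def)
qed

text \<open>The map is conjugated with the passage to the ordered copy, which preserves the Lebesgue measure and
the determinant of the derivative.\<close>

theorem change_of_variables_compact:
  fixes f :: "real ^ 'd::finite \<Rightarrow> real" and g :: "real ^ 'd \<Rightarrow> real ^ 'd"
  assumes S: "compact S" and der: "\<And>x. x \<in> S \<Longrightarrow> (g has_derivative g' x) (at x within S)" and inj: "inj_on g S"
    and int: "set_integrable lborel S (\<lambda>x. \<bar>Determinants.det (matrix (g' x))\<bar> * f (g x))"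
    and meas: "(\<lambda>x. indicator (g ` S) x * f x) \<in> borel_measurable borel"
  shows "set_integrable lborel (g ` S) f"
    and "(LINT x:g ` S|lborel. f x) = (LINT x:S|lborel. \<bar>Determinants.det (matrix (g' x))\<bar> * f (g x))"
proof -
  define G where "G y = to_copy (g (of_copy y))" for y
  define G' where "G' y = (\<lambda>v. to_copy (g' (of_copy y) (of_copy v)))" for y
  define T where "T = to_copy ` S"
  have GT: "G ` T = to_copy ` g ` S" unfolding T_def G_def by (simp add: image_image)
  have det: "Determinants.det (matrix (G' y)) = Determinants.det (matrix (g' (of_copy y)))" for y
    unfolding G'_def matrix_copy by (rule det_reindex[OF bij_Rep_ordered_copy])
  let ?D = "\<lambda>x. \<bar>Determinants.det (matrix (g' x))\<bar> * f (g x)"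
  have mD: "(\<lambda>x. indicator S x * ?D x) \<in> borel_measurable borel"
    using borel_measurable_integrable[OF int[unfolded set_integrable_def]] by simp
  have "compact T" unfolding T_def
    by (intro compact_continuous_image S linear_continuous_on linear_conv_bounded_linear[THEN iffD1] linear_to_copy)
  moreover have "(G has_derivative G' y) (at y within T)" if y: "y \<in> T" for y
  proof -
    have bl: "bounded_linear (to_copy :: real ^ 'd \<Rightarrow> _)" "bounded_linear (of_copy :: _ \<Rightarrow> real ^ 'd)"
      using linear_to_copy linear_of_copy by (simp_all add: linear_conv_bounded_linear)
    have oy: "of_copy y \<in> S" using y unfolding T_def by auto
    have oT: "of_copy ` T = S" unfolding T_def by (simp add: image_image)
    have "((g \<circ> of_copy) has_derivative (g' (of_copy y) \<circ> of_copy)) (at y within T)"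
      by (rule diff_chain_within) (use bounded_linear_imp_has_derivative[OF bl(2)] der[OF oy] oT in auto)
    from bounded_linear.has_derivative[OF bl(1) this] show ?thesis unfolding G_def[abs_def] G'_def by (simp add: o_def)
  qed
  moreover have "inj_on G T"
    unfolding G_def T_def inj_on_def using inj by (auto simp: inj_on_def) (metis copy_inverse(1))
  moreover have "set_integrable lborel T (\<lambda>y. \<bar>Determinants.det (matrix (G' y))\<bar> * f (of_copy (G y)))"
    using set_integral_to_copy(1)[OF mD] int unfolding T_def det G_def by simp
  moreover have "(\<lambda>y. indicator (G ` T) y * f (of_copy y)) \<in> borel_measurable borel"
  proof -
    have "indicator (G ` T) y = (indicator (g ` S) (of_copy y) :: real)" for y
      unfolding GT by (auto simp: indicator_def image_iff) (metis copy_inverse)+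
    then show ?thesis using measurable_compose[OF measurable_of_copy meas] by simp
  qed
  ultimately have cov: "set_integrable lborel (G ` T) (\<lambda>y. f (of_copy y)) \<and>
    (LINT y:G ` T|lborel. f (of_copy y)) = (LINT y:T|lborel. \<bar>Determinants.det (matrix (G' y))\<bar> * f (of_copy (G y)))"
    by (rule change_of_variables_wellorder)
  show "set_integrable lborel (g ` S) f"
    using cov set_integral_to_copy(1)[OF meas] unfolding GT by simp
  have "(LINT y:T|lborel. \<bar>Determinants.det (matrix (G' y))\<bar> * f (of_copy (G y))) = (LINT x:S|lborel. ?D x)"
    using set_integral_to_copy(2)[OF mD] unfolding T_def det G_def by simp
  then show "(LINT x:g ` S|lborel. f x) = (LINT x:S|lborel. ?D x)"
    using cov set_integral_to_copy(2)[OF meas] unfolding GT by simp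
qed

lemma null_image_cube_boundary:
  fixes g :: "real ^ 'd::finite \<Rightarrow> real ^ 'd"
  assumes "g differentiable_on cbox 0 1"
  shows "g ` (cbox 0 1 - box 0 1) \<in> null_sets lborel"
proof -
  let ?B = "cbox 0 1 - box 0 (1 :: real ^ 'd)"
  have d: "g differentiable_on ?B" using assms by (rule differentiable_on_subset) auto
  have "negligible (g ` ?B)"
    by (rule negligible_differentiable_image_negligible[OF order_refl negligible_frontier_interval d])
  moreover have "compact ?B" by (intro compact_diff) auto
  then have "compact (g ` ?B)" using d compact_continuous_image differentiable_imp_continuous_on by blast
  then have "g ` ?B \<in> sets lborel" by (simp add: borel_compact)
  ultimately show ?thesis using null_sets_completion_iff negligible_iff_null_sets by blast
qed

section \<open>Mass matrix on the reference cube\<close>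

lemma borel_measurable_bspline [measurable]: "bspline \<xi> q i \<in> borel_measurable borel"
proof (induction q arbitrary: i)
  case 0
  show ?case unfolding bspline.simps by measurable
next
  case (Suc q)
  note [measurable] = Suc.IH
  show ?case unfolding bspline.simps by measurable
qed

lemma bspline_bounded: "\<exists>B. \<forall>x\<in>{0..1}. \<bar>bspline \<xi> q i x\<bar> \<le> B"
proof (induction q arbitrary: i)
  case 0
  show ?case by (intro exI[of _ 1]) simp
next
  case (Suc q)
  obtain B1 where B1: "\<And>x. x \<in> {0..1} \<Longrightarrow> \<bar>bspline \<xi> q i x\<bar> \<le> B1" using Suc.IH[of i] by blast
  obtain B2 where B2: "\<And>x. x \<in> {0..1} \<Longrightarrow> \<bar>bspline \<xi> q (i + 1) x\<bar> \<le> B2" using Suc.IH[of "i + 1"] by blast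
  define a where "a = \<xi> ! (i + q + 1) - \<xi> ! i"
  define b where "b = \<xi> ! (i + q + 2) - \<xi> ! (i + 1)"
  have "\<bar>bspline \<xi> (Suc q) i x\<bar> \<le> (1 + \<bar>\<xi> ! i\<bar>) / \<bar>a\<bar> * B1 + (\<bar>\<xi> ! (i + q + 2)\<bar> + 1) / \<bar>b\<bar> * B2"
    if x: "x \<in> {0..1}" for x
  proof -
    have "\<bar>bspline \<xi> (Suc q) i x\<bar> \<le> \<bar>x - \<xi> ! i\<bar> / \<bar>a\<bar> * \<bar>bspline \<xi> q i x\<bar>
        + \<bar>\<xi> ! (i + q + 2) - x\<bar> / \<bar>b\<bar> * \<bar>bspline \<xi> q (i + 1) x\<bar>"
      unfolding bspline.simps a_def[symmetric] b_def[symmetric]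
      by (rule order.trans[OF abs_triangle_ineq]) (simp add: abs_mult)
    also have "\<dots> \<le> (1 + \<bar>\<xi> ! i\<bar>) / \<bar>a\<bar> * B1 + (\<bar>\<xi> ! (i + q + 2)\<bar> + 1) / \<bar>b\<bar> * B2"
      using x B1[OF x] B2[OF x] by (intro add_mono mult_mono divide_right_mono) auto
    finally show ?thesis .
  qed
  then show ?case by blast
qed

lemma integrable_lborel_bounded_on:
  fixes f :: "'a::euclidean_space \<Rightarrow> real"
  assumes "f \<in> borel_measurable borel" "S \<in> sets borel" "bounded S"
    and "\<And>x. x \<in> S \<Longrightarrow> \<bar>f x\<bar> \<le> B" "\<And>x. x \<notin> S \<Longrightarrow> f x = 0"
  shows "integrable lborel f"
proof (rule Bochner_Integration.integrable_bound[where f = "\<lambda>x. B * indicator S x"])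
  show "integrable lborel (\<lambda>x. B * indicator S x)"
    using assms(2,3) emeasure_bounded_finite[OF assms(3)] by (intro integrable_mult_right integrable_real_indicator) auto
  show "AE x in lborel. norm (f x) \<le> norm (B * indicator S x)"
  proof (rule AE_I2)
    fix x
    show "norm (f x) \<le> norm (B * indicator S x)"
      using assms(4)[of x] assms(5)[of x] by (cases "x \<in> S") (auto simp: indicator_def)
  qed
qed (use assms(1) in simp)

lemma set_integral_null_diff:
  fixes f :: "'a \<Rightarrow> real"
  assumes "(\<lambda>x. indicator T x * f x) \<in> borel_measurable M" "S \<in> sets M" "S \<subseteq> T" "T - S \<in> null_sets M"
  shows "(LINT x:S|M. f x) = (LINT x:T|M. f x)"
  unfolding set_lebesgue_integral_def
proof (rule integral_cong_AE)
  have "(\<lambda>x. indicator S x *\<^sub>R f x) = (\<lambda>x. indicator S x * (indicator T x * f x))"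
    using assms(3) by (auto simp: indicator_def fun_eq_iff)
  then show "(\<lambda>x. indicator S x *\<^sub>R f x) \<in> borel_measurable M" using assms(1,2) by simp
  show "AE x in M. indicator S x *\<^sub>R f x = indicator T x *\<^sub>R f x"
    by (rule AE_I'[OF assms(4)]) (use assms(3) in \<open>auto simp: indicator_def\<close>)
qed (use assms(1) in simp)

text \<open>With the B-splines cut off outside the open unit interval, integrals over the open cube become
integrals over the whole space, where Fubini applies to products.\<close>

definition cut_bspline :: "nat \<Rightarrow> real list \<Rightarrow> nat \<Rightarrow> real \<Rightarrow> real" where
  "cut_bspline p \<xi> i x = indicator {0<..<1} x * bspline \<xi> p i x"

lemma borel_measurable_cut_bspline [measurable]: "cut_bspline p \<xi> i \<in> borel_measurable borel"
  unfolding cut_bspline_def by measurable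

lemma integrable_cut_bspline_mult: "integrable lborel (\<lambda>x. cut_bspline p \<xi> i x * cut_bspline p \<xi> j x)"
proof -
  obtain B where B: "\<And>x. x \<in> {0..1} \<Longrightarrow> \<bar>bspline \<xi> p i x\<bar> \<le> B" using bspline_bounded by blast
  obtain C where C: "\<And>x. x \<in> {0..1} \<Longrightarrow> \<bar>bspline \<xi> p j x\<bar> \<le> C" using bspline_bounded by blast
  show ?thesis
  proof (rule integrable_lborel_bounded_on[where S = "{0<..<1}" and B = "B * C"])
    fix x :: real assume x: "x \<in> {0<..<1}"
    show "\<bar>cut_bspline p \<xi> i x * cut_bspline p \<xi> j x\<bar> \<le> B * C"
      using x B[of x] C[of x] unfolding cut_bspline_def by (auto simp: abs_mult intro!: mult_mono)
  qed (auto simp: cut_bspline_def)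
qed

lemma cut_bspline_sq_integral:
  assumes "(\<lambda>x. (\<Sum>i<m. c i * bspline \<xi> p i x)\<^sup>2) integrable_on {0..1}"
  shows "(\<integral>x. (\<Sum>i<m. c i * cut_bspline p \<xi> i x)\<^sup>2 \<partial>lborel) = integral {0..1} (\<lambda>x. (\<Sum>i<m. c i * bspline \<xi> p i x)\<^sup>2)"
proof -
  have e: "(\<Sum>i<m. c i * cut_bspline p \<xi> i x)\<^sup>2 = indicator {0<..<1} x *\<^sub>R (\<Sum>i<m. c i * bspline \<xi> p i x)\<^sup>2" for x
    unfolding cut_bspline_def by (auto simp: indicator_def)
  have "integrable lborel (\<lambda>x. (\<Sum>i<m. c i * cut_bspline p \<xi> i x)\<^sup>2)"
  proof -
    have "(\<Sum>i<m. c i * cut_bspline p \<xi> i x)\<^sup>2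
       = (\<Sum>i<m. \<Sum>j<m. (c i * c j) * (cut_bspline p \<xi> i x * cut_bspline p \<xi> j x))" for x
      unfolding power2_eq_square sum_product by (intro sum.cong refl) simp
    then show ?thesis
      by (simp add: integrable_cut_bspline_mult)
  qed
  then have "set_integrable lborel {0<..<1} (\<lambda>x. (\<Sum>i<m. c i * bspline \<xi> p i x)\<^sup>2)"
    unfolding e set_integrable_def .
  from set_borel_integral_eq_integral(2)[OF this]
  have "(\<integral>x. (\<Sum>i<m. c i * cut_bspline p \<xi> i x)\<^sup>2 \<partial>lborel) = integral {0<..<1} (\<lambda>x. (\<Sum>i<m. c i * bspline \<xi> p i x)\<^sup>2)"
    unfolding e set_lebesgue_integral_def .
  also have "\<dots> = integral {0..1} (\<lambda>x. (\<Sum>i<m. c i * bspline \<xi> p i x)\<^sup>2)"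
    by (rule integral_open_interval_real[symmetric])
  finally show ?thesis .
qed

lemma indicator_unit_box: "indicator (box 0 1) x = (\<Prod>k\<in>UNIV. indicator {0<..<1} (vec_nth x k) :: real)"
  for x :: "real ^ 'd::finite"
proof (cases "x \<in> box 0 1")
  case True
  then have "\<And>k. vec_nth x k \<in> {0<..<1}" by (auto simp: mem_box_cart)
  then show ?thesis using True by simp
next
  case False
  then obtain k where "vec_nth x k \<notin> {0<..<1}" by (auto simp: mem_box_cart)
  then have "(\<Prod>k\<in>UNIV. indicator {0<..<1} (vec_nth x k) :: real) = 0"
    by (intro prod_zero) (auto simp: indicator_def)
  then show ?thesis using False by simp
qed

text \<open>The indicator of the cube is idempotent and a product over the directions.\<close>

lemma tensor_mass_entry:
  fixes \<Xi> :: "'d::finite \<Rightarrow> real list"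
  shows "(LINT x:box 0 1|lborel. tensor_bspline p \<Xi> I x * tensor_bspline p \<Xi> J x)
   = (\<Prod>k\<in>UNIV. \<integral>y. cut_bspline p (\<Xi> k) (I k) y * cut_bspline p (\<Xi> k) (J k) y \<partial>lborel)"
proof -
  have "indicator (box 0 1) x *\<^sub>R (tensor_bspline p \<Xi> I x * tensor_bspline p \<Xi> J x)
    = (\<Prod>k\<in>UNIV. cut_bspline p (\<Xi> k) (I k) (vec_nth x k) * cut_bspline p (\<Xi> k) (J k) (vec_nth x k))"
    for x :: "real ^ 'd"
  proof -
    have "(\<Prod>k\<in>UNIV. cut_bspline p (\<Xi> k) (I k) (vec_nth x k) * cut_bspline p (\<Xi> k) (J k) (vec_nth x k))
       = (indicator (box 0 1) x * indicator (box 0 1) x) * (tensor_bspline p \<Xi> I x * tensor_bspline p \<Xi> J x)"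
      unfolding indicator_unit_box tensor_bspline_def cut_bspline_def prod.distrib[symmetric]
      by (simp add: mult_ac)
    then show ?thesis by (simp add: indicator_def)
  qed
  then show ?thesis unfolding set_lebesgue_integral_def
    using integral_prod_components[where f = "\<lambda>k y. cut_bspline p (\<Xi> k) (I k) y * cut_bspline p (\<Xi> k) (J k) y",
      OF integrable_cut_bspline_mult] by simp
qed

lemma ref_mass_tensor_form_bounds:
  fixes V :: "'d::finite discretization"
  assumes bij: "bij_betw (numbering V r) {..<ndof p V r} (multi_indices p (knots V r))"
    and lo: "\<And>k c. l * (\<Sum>i<num_bsplines p (knots V r k). (c i)\<^sup>2)
      \<le> (\<integral>x. (\<Sum>i<num_bsplines p (knots V r k). c i * cut_bspline p (knots V r k) i x)\<^sup>2 \<partial>lborel)"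
    and up: "\<And>k c. (\<integral>x. (\<Sum>i<num_bsplines p (knots V r k). c i * cut_bspline p (knots V r k) i x)\<^sup>2 \<partial>lborel)
      \<le> u * (\<Sum>i<num_bsplines p (knots V r k). (c i)\<^sup>2)"
    and l: "0 \<le> l" "0 \<le> u"
  shows "form_bounds (ndof p V r) (ref_mass p V r) (l ^ CARD('d)) (u ^ CARD('d))"
proof (rule form_boundsI)
  show "ref_mass p V r \<in> carrier_mat (ndof p V r) (ndof p V r)" unfolding ref_mass_def by simp
  show "ref_mass p V r $$ (i, j) = ref_mass p V r $$ (j, i)" if "i < ndof p V r" "j < ndof p V r" for i j
    using that unfolding ref_mass_def by (simp add: mult.commute)
  fix c :: "nat \<Rightarrow> real"
  let ?n = "ndof p V r" and ?P = "PiE UNIV (\<lambda>k. {..<num_bsplines p (knots V r k)})"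
  define b where "b k = cut_bspline p (knots V r k)" for k
  define A where "A k i j = (\<integral>x. b k i x * b k j x \<partial>lborel)" for k i j
  define C where "C I = c (inv_into {..<?n} (numbering V r) I)" for I
  have P: "multi_indices p (knots V r) = ?P" unfolding multi_indices_def by (auto simp: PiE_UNIV_domain)
  note bij' = bij[unfolded P]
  have R: "(\<Sum>I\<in>?P. F I) = (\<Sum>i<?n. F (numbering V r i))" for F :: "('d \<Rightarrow> nat) \<Rightarrow> real"
    by (rule sum.reindex_bij_betw[OF bij', symmetric])
  have C: "C (numbering V r i) = c i" if "i < ?n" for i
    unfolding C_def using bij that by (simp add: bij_betw_def)
  have "tensor_form UNIV (\<lambda>k. num_bsplines p (knots V r k)) A C
     = (\<Sum>i<?n. \<Sum>j<?n. C (numbering V r i) * C (numbering V r j) * (\<Prod>k\<in>UNIV. A k (numbering V r i k) (numbering V r j k)))"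
    unfolding tensor_form_def R ..
  also have "\<dots> = (\<Sum>i<?n. \<Sum>j<?n. c i * c j * ref_mass p V r $$ (i, j))"
    unfolding A_def b_def by (intro sum.cong refl) (simp add: C ref_mass_def ref_basis_def tensor_mass_entry)
  finally have T: "tensor_form UNIV (\<lambda>k. num_bsplines p (knots V r k)) A C
     = (\<Sum>i<?n. \<Sum>j<?n. c i * c j * ref_mass p V r $$ (i, j))" .
  have sq: "(\<Sum>I\<in>?P. (C I)\<^sup>2) = (\<Sum>i<?n. (c i)\<^sup>2)"
    unfolding R by (intro sum.cong refl) (simp add: C)
  have "l ^ card (UNIV :: 'd set) * (\<Sum>I\<in>?P. (C I)\<^sup>2) \<le> tensor_form UNIV (\<lambda>k. num_bsplines p (knots V r k)) A C \<and>
     tensor_form UNIV (\<lambda>k. num_bsplines p (knots V r k)) A C \<le> u ^ card (UNIV :: 'd set) * (\<Sum>I\<in>?P. (C I)\<^sup>2)"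
  proof (rule tensor_form_bounds[where b = b and \<mu> = lborel])
    show "finite (UNIV :: 'd set)" by simp
    show "integrable lborel (\<lambda>x. b k i x * b k j x)" for k i j
      unfolding b_def by (rule integrable_cut_bspline_mult)
    show "A k i j = (\<integral>x. b k i x * b k j x \<partial>lborel)" for k i j unfolding A_def ..
  qed (unfold b_def, rule lo, rule up, rule l, rule l)
  then show "l ^ CARD('d) * (\<Sum>i<?n. (c i)\<^sup>2) \<le> (\<Sum>i<?n. \<Sum>j<?n. c i * c j * ref_mass p V r $$ (i, j)) \<and>
      (\<Sum>i<?n. \<Sum>j<?n. c i * c j * ref_mass p V r $$ (i, j)) \<le> u ^ CARD('d) * (\<Sum>i<?n. (c i)\<^sup>2)"
    unfolding T sq .
qed

lemma quasi_uniform_knots_of_mesh: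
  fixes g :: "'d::finite geometry"
  assumes "1 \<le> p" "0 < \<alpha>" "conforming_discretization p g V" "quasi_uniform \<alpha> g V" "r < npatch g"
  shows "quasi_uniform_knots p (knots V r k) (mesh_size g V) \<alpha>"
proof
  have fin: "finite (all_span_lengths g V)"
  proof -
    have "span_lengths \<xi> = (\<lambda>i. \<xi> ! (i + 1) - \<xi> ! i) ` {i. i + 1 < length \<xi>}" for \<xi>
      unfolding span_lengths_def by auto
    moreover have "finite {i. i + 1 < n}" for n :: nat by (rule finite_subset[of _ "{..<n}"]) auto
    ultimately show ?thesis unfolding all_span_lengths_def by auto
  qed
  show "1 \<le> p" by (rule assms(1))
  show "0 < \<alpha>" by (rule assms(2))
  show "open_knot_vector p (knots V r k)" using assms(3,5) by (simp add: conforming_discretization_def)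
  fix i assume i: "i + 1 < length (knots V r k)"
  have s: "knots V r k ! (i + 1) - knots V r k ! i \<in> all_span_lengths g V"
    unfolding all_span_lengths_def span_lengths_def using assms(5) i by blast
  then show "knots V r k ! (i + 1) - knots V r k ! i \<le> mesh_size g V"
    unfolding mesh_size_def using fin by simp
  assume "knots V r k ! (i + 1) \<noteq> knots V r k ! i"
  then show "\<alpha> * mesh_size g V \<le> knots V r k ! (i + 1) - knots V r k ! i"
    using assms(4) s unfolding quasi_uniform_def by auto
qed

lemma ref_mass_form_bounds:
  fixes V :: "'d::finite discretization"
  assumes V: "conforming_discretization p g V" and qu: "quasi_uniform \<alpha> g V" and p: "1 \<le> p" and \<alpha>: "0 < \<alpha>"
    and r: "r < npatch g" and \<gamma>0: "0 < \<gamma>"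
    and \<gamma>: "\<And>\<xi> h c. quasi_uniform_knots p \<xi> h \<alpha> \<Longrightarrow> \<gamma> * h * (\<Sum>i<num_bsplines p \<xi>. (c i)\<^sup>2)
      \<le> integral {0..1} (\<lambda>x. (\<Sum>i<num_bsplines p \<xi>. c i * bspline \<xi> p i x)\<^sup>2)"
  shows "form_bounds (ndof p V r) (ref_mass p V r)
     ((\<gamma> * mesh_size g V) ^ CARD('d)) (((real p + 1)\<^sup>2 * mesh_size g V) ^ CARD('d))"
    and "0 < mesh_size g V"
proof -
  note qk = quasi_uniform_knots_of_mesh[OF p \<alpha> V qu r]
  show h: "0 < mesh_size g V" using quasi_uniform_knots.h_pos[OF qk] by blast
  have bij: "bij_betw (numbering V r) {..<ndof p V r} (multi_indices p (knots V r))"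
    using V r by (simp add: conforming_discretization_def)
  note int = cut_bspline_sq_integral[OF quasi_uniform_knots.spline_sq_integrals(1)[OF qk]]
  show "form_bounds (ndof p V r) (ref_mass p V r)
     ((\<gamma> * mesh_size g V) ^ CARD('d)) (((real p + 1)\<^sup>2 * mesh_size g V) ^ CARD('d))"
  proof (rule ref_mass_tensor_form_bounds[OF bij])
    fix k and c :: "nat \<Rightarrow> real"
    show "\<gamma> * mesh_size g V * (\<Sum>i<num_bsplines p (knots V r k). (c i)\<^sup>2)
      \<le> (\<integral>x. (\<Sum>i<num_bsplines p (knots V r k). c i * cut_bspline p (knots V r k) i x)\<^sup>2 \<partial>lborel)"
      unfolding int by (rule \<gamma>[OF qk])
    show "(\<integral>x. (\<Sum>i<num_bsplines p (knots V r k). c i * cut_bspline p (knots V r k) i x)\<^sup>2 \<partial>lborel)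
      \<le> (real p + 1)\<^sup>2 * mesh_size g V * (\<Sum>i<num_bsplines p (knots V r k). (c i)\<^sup>2)"
      unfolding int by (rule quasi_uniform_knots.spline_L2_upper[OF qk])
  qed (use h \<gamma>0 in auto)
qed

section \<open>Mass matrix and preconditioner of one patch\<close>

lemma borel_measurable_ref_basis [measurable]: "ref_basis p V r i \<in> borel_measurable borel"
  unfolding ref_basis_def tensor_bspline_def[abs_def] by measurable

lemma ref_basis_bounded:
  fixes V :: "'d::finite discretization"
  shows "\<exists>B. \<forall>x\<in>cbox 0 1. \<bar>ref_basis p V r i x\<bar> \<le> B"
proof -
  have "\<forall>k. \<exists>B. \<forall>x\<in>{0..1}. \<bar>bspline (knots V r k) p (numbering V r i k) x\<bar> \<le> B" using bspline_bounded by blast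
  then obtain B where B: "\<And>k x. x \<in> {0..1} \<Longrightarrow> \<bar>bspline (knots V r k) p (numbering V r i k) x\<bar> \<le> B k" by metis
  have "\<bar>ref_basis p V r i x\<bar> \<le> (\<Prod>k\<in>UNIV. B k)" if "x \<in> cbox 0 1" for x
    unfolding ref_basis_def tensor_bspline_def abs_prod
    using that by (intro prod_mono) (auto simp: mem_box_cart intro!: B)
  then show ?thesis by blast
qed

lemma continuous_on_determinant:
  fixes A :: "'a::topological_space \<Rightarrow> real ^ 'n::finite ^ 'n"
  assumes "continuous_on S A"
  shows "continuous_on S (\<lambda>x. Determinants.det (A x))"
  unfolding Determinants.det_def
  by (intro continuous_intros continuous_on_component assms)

lemma null_cube_boundary: "cbox 0 1 - box 0 (1 :: real ^ 'd::finite) \<in> null_sets lborel"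
proof -
  have "negligible (cbox 0 1 - box 0 (1 :: real ^ 'd))" by (rule negligible_frontier_interval)
  then show ?thesis using null_sets_completion_iff[of "cbox 0 1 - box 0 (1 :: real ^ 'd)" lborel] negligible_iff_null_sets by auto
qed

lemma set_integral_sum_finite:
  fixes f :: "'i \<Rightarrow> 'a \<Rightarrow> real"
  assumes "\<And>i. i \<in> I \<Longrightarrow> set_integrable M A (f i)"
  shows "set_integrable M A (\<lambda>x. \<Sum>i\<in>I. f i x)" "(LINT x:A|M. (\<Sum>i\<in>I. f i x)) = (\<Sum>i\<in>I. LINT x:A|M. f i x)"
  using assms unfolding set_integrable_def set_lebesgue_integral_def scaleR_sum_right
  by (auto intro: integrable_sum integral_sum)

lemma set_integral_quadratic_form:
  fixes f :: "nat \<Rightarrow> nat \<Rightarrow> 'a \<Rightarrow> real"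
  assumes "\<And>i j. set_integrable M A (f i j)"
  shows "set_integrable M A (\<lambda>x. \<Sum>i<n. \<Sum>j<n. c i * c j * f i j x)"
    and "(LINT x:A|M. (\<Sum>i<n. \<Sum>j<n. c i * c j * f i j x)) = (\<Sum>i<n. \<Sum>j<n. c i * c j * (LINT x:A|M. f i j x))"
proof -
  have i: "set_integrable M A (\<lambda>x. c i * c j * f i j x)" for i j
    using assms by (intro set_integrable_mult_right)
  have j: "set_integrable M A (\<lambda>x. \<Sum>j<n. c i * c j * f i j x)" for i
    by (rule set_integral_sum_finite(1)[OF i])
  show "set_integrable M A (\<lambda>x. \<Sum>i<n. \<Sum>j<n. c i * c j * f i j x)"
    by (rule set_integral_sum_finite(1)[OF j])
  show "(LINT x:A|M. (\<Sum>i<n. \<Sum>j<n. c i * c j * f i j x)) = (\<Sum>i<n. \<Sum>j<n. c i * c j * (LINT x:A|M. f i j x))"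
    unfolding set_integral_sum_finite(2)[OF j] set_integral_sum_finite(2)[OF i] by simp
qed

text \<open>The constants \<open>jm\<close> and \<open>jM\<close> are the bounds for the Jacobian determinant through which alone the
geometry enters the estimates.\<close>

locale patch_map =
  fixes g :: "('d::finite) geometry" and r :: nat and jm jM :: real
  assumes inj: "inj_on (param g r) (cbox 0 1)"
    and C1: "C1_on_cube (param g r)"
    and jm: "0 < jm"
    and det: "\<And>x. x \<in> cbox 0 1 \<Longrightarrow> jm \<le> jac_det (param g r) x \<and> jac_det (param g r) x \<le> jM"
begin

abbreviation "K \<equiv> param g r ` cbox 0 1"

lemma continuous_param: "continuous_on (cbox 0 1) (param g r)"
  using C1 unfolding C1_on_cube_def by (simp add: differentiable_imp_continuous_on)

lemma compact_K: "compact K"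
  using continuous_param by (intro compact_continuous_image) auto

lemma K_borel [measurable]: "K \<in> sets borel"
  using compact_K by (rule borel_compact)

lemma open_patch: "open (patch g r)"
  unfolding patch_def using continuous_param inj
  by (intro invariance_of_domain continuous_on_subset[OF continuous_param] inj_on_subset[OF inj] box_subset_cbox) auto

lemma patch_subset_K: "patch g r \<subseteq> K"
  unfolding patch_def using box_subset_cbox by (intro image_mono)

lemma null_K_minus_patch: "K - patch g r \<in> null_sets lborel"
proof -
  have "K - patch g r = param g r ` (cbox 0 1 - box 0 1)"
    unfolding patch_def by (rule inj_on_image_set_diff[OF inj, symmetric]) (use box_subset_cbox in auto)
  then show ?thesis using null_image_cube_boundary[of "param g r"] C1 unfolding C1_on_cube_def by simp
qed

lemma loc_basis_param: "x \<in> cbox 0 1 \<Longrightarrow> loc_basis p g V r i (param g r x) = ref_basis p V r i x"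
  unfolding loc_basis_def using inj by simp

lemma borel_measurable_loc_basis: "loc_basis p g V r i \<in> borel_measurable borel"
proof -
  \<comment> \<open>The inverse of the parametrization, extended by 0 from the compact image of the cube.\<close>
  define psi where "psi x = indicator K x *\<^sub>R inv_into (cbox 0 1) (param g r) x" for x
  have "continuous_on K (inv_into (cbox 0 1) (param g r))"
    using continuous_param inj by (intro continuous_on_inv) auto
  then have [measurable]: "psi \<in> borel_measurable borel"
    unfolding psi_def by (rule borel_measurable_continuous_on_indicator[OF K_borel])
  have "loc_basis p g V r i = (\<lambda>x. indicator K x * ref_basis p V r i (psi x))"
    unfolding loc_basis_def psi_def by (auto simp: fun_eq_iff indicator_def)
  then show ?thesis by simp
qed

lemma measurable_jac_det: "(\<lambda>x. indicator (cbox 0 1) x * jac_det (param g r) x) \<in> borel_measurable borel"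
  using borel_measurable_continuous_on_indicator[of "cbox 0 1" "jac_det (param g r)"]
    continuous_on_determinant[of "cbox 0 1" "jacobian (param g r)"] C1
  unfolding C1_on_cube_def jac_det_def[abs_def] by simp

lemma jm_le_jM: "jm \<le> jM" using det[of 0] by (auto simp: mem_box_cart)

lemma set_integrable_cube_ref:
  "set_integrable lborel (cbox 0 1) (\<lambda>x. ref_basis p V r i x * ref_basis p V r j x)"
  "set_integrable lborel (cbox 0 1) (\<lambda>x. jac_det (param g r) x * (ref_basis p V r i x * ref_basis p V r j x))"
proof -
  let ?f = "\<lambda>x. ref_basis p V r i x * ref_basis p V r j x"
  obtain B where B: "\<And>x. x \<in> cbox 0 1 \<Longrightarrow> \<bar>ref_basis p V r i x\<bar> \<le> B" using ref_basis_bounded by blast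
  obtain C where C: "\<And>x. x \<in> cbox 0 1 \<Longrightarrow> \<bar>ref_basis p V r j x\<bar> \<le> C" using ref_basis_bounded by blast
  have BC: "\<bar>?f x\<bar> \<le> B * C" if "x \<in> cbox 0 1" for x
    unfolding abs_mult using B[OF that] C[OF that] by (intro mult_mono) auto
  show "set_integrable lborel (cbox 0 1) ?f"
    unfolding set_integrable_def
    by (rule integrable_lborel_bounded_on[where S = "cbox 0 1" and B = "B * C"]) (use BC in auto)
  have m: "(\<lambda>x. indicator (cbox 0 1) x * jac_det (param g r) x * ?f x) \<in> borel_measurable borel"
    using borel_measurable_times[OF measurable_jac_det, of "\<lambda>x. ?f x"] by simp
  show "set_integrable lborel (cbox 0 1) (\<lambda>x. jac_det (param g r) x * ?f x)"
    unfolding set_integrable_def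
  proof (rule integrable_lborel_bounded_on[where S = "cbox 0 1" and B = "jM * (B * C)"])
    fix x :: "real ^ 'd" assume x: "x \<in> cbox 0 1"
    have "\<bar>jac_det (param g r) x\<bar> \<le> jM" using det[OF x] jm by auto
    then have "\<bar>jac_det (param g r) x * ?f x\<bar> \<le> jM * (B * C)"
      unfolding abs_mult[of "jac_det (param g r) x"] using BC[OF x] by (intro mult_mono) auto
    then show "\<bar>indicator (cbox 0 1) x *\<^sub>R (jac_det (param g r) x * ?f x)\<bar> \<le> jM * (B * C)"
      using x by simp
  qed (use m in \<open>auto simp: mult.assoc\<close>)
qed

text \<open>The formula is applied on the closed cube, where the one-sided derivative is available; the boundary
is a null set, and so is its image.\<close>

lemma loc_mass_entry:
  shows "set_integrable lborel (patch g r) (\<lambda>x. loc_basis p g V r i x * loc_basis p g V r j x)"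
    and "(LINT x:patch g r|lborel. loc_basis p g V r i x * loc_basis p g V r j x)
      = (LINT x:cbox 0 1|lborel. jac_det (param g r) x * (ref_basis p V r i x * ref_basis p V r j x))"
proof -
  let ?f = "\<lambda>x. loc_basis p g V r i x * loc_basis p g V r j x"
  let ?G' = "\<lambda>x. frechet_derivative (param g r) (at x within cbox 0 1)"
  have D: "\<bar>Determinants.det (matrix (?G' x))\<bar> = jac_det (param g r) x" if "x \<in> cbox 0 1" for x
    using det[OF that] jm unfolding jac_det_def jacobian_def by simp
  have e: "indicator (cbox 0 1) x *\<^sub>R (\<bar>Determinants.det (matrix (?G' x))\<bar> * ?f (param g r x))
     = indicator (cbox 0 1) x *\<^sub>R (jac_det (param g r) x * (ref_basis p V r i x * ref_basis p V r j x))" for x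
    using D[of x] loc_basis_param[of x p V] by (auto simp: indicator_def)
  have m[measurable]: "?f \<in> borel_measurable borel"
    by (intro borel_measurable_times borel_measurable_loc_basis)
  have mK: "(\<lambda>x. indicator K x * ?f x) \<in> borel_measurable borel" by measurable
  have der: "(param g r has_derivative ?G' x) (at x within cbox 0 1)" if "x \<in> cbox 0 1" for x
    using C1 that unfolding C1_on_cube_def differentiable_on_def by (simp add: frechet_derivative_works[symmetric])
  have i: "set_integrable lborel (cbox 0 1) (\<lambda>x. \<bar>Determinants.det (matrix (?G' x))\<bar> * ?f (param g r x))"
    using set_integrable_cube_ref(2)[of p V i j] unfolding set_integrable_def e .
  note cov = change_of_variables_compact[OF compact_cbox der inj i mK]
  show "set_integrable lborel (patch g r) ?f"
    by (rule set_integrable_subset[OF cov(1)]) (use open_patch patch_subset_K in auto)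
  have "(LINT x:patch g r|lborel. ?f x) = (LINT x:K|lborel. ?f x)"
    by (rule set_integral_null_diff) (use mK open_patch patch_subset_K null_K_minus_patch in auto)
  also have "\<dots> = (LINT x:cbox 0 1|lborel. jac_det (param g r) x * (ref_basis p V r i x * ref_basis p V r j x))"
    using cov(2) unfolding set_lebesgue_integral_def e .
  finally show "(LINT x:patch g r|lborel. ?f x) = (LINT x:cbox 0 1|lborel. jac_det (param g r) x * (ref_basis p V r i x * ref_basis p V r j x))" .
qed

lemma loc_mass_form:
  fixes V :: "'d discretization" and c :: "nat \<Rightarrow> real" and n p :: nat
  defines "R \<equiv> (\<Sum>i<n. \<Sum>j<n. c i * c j * (LINT x:box 0 1|lborel. ref_basis p V r i x * ref_basis p V r j x))"
  defines "L \<equiv> (\<Sum>i<n. \<Sum>j<n. c i * c j * (LINT x:patch g r|lborel. loc_basis p g V r i x * loc_basis p g V r j x))"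
  shows "jm * R \<le> L \<and> L \<le> jM * R"
proof -
  define f where "f x = (\<Sum>i<n. c i * ref_basis p V r i x)" for x
  have f2: "(f x)\<^sup>2 = (\<Sum>i<n. \<Sum>j<n. c i * c j * (ref_basis p V r i x * ref_basis p V r j x))" for x
    unfolding f_def power2_eq_square sum_product by (intro sum.cong refl) simp
  have box: "(LINT x:box 0 1|lborel. ref_basis p V r i x * ref_basis p V r j x)
      = (LINT x:cbox 0 1|lborel. ref_basis p V r i x * ref_basis p V r j x)" for i j
    by (rule set_integral_null_diff) (use null_cube_boundary box_subset_cbox in auto)
  have R: "R = (LINT x:cbox 0 1|lborel. (f x)\<^sup>2)" and iR: "set_integrable lborel (cbox 0 1) (\<lambda>x. (f x)\<^sup>2)"
    unfolding R_def f2 box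
    by (rule set_integral_quadratic_form(2)[symmetric], rule set_integrable_cube_ref)
       (rule set_integral_quadratic_form(1), rule set_integrable_cube_ref)
  have L: "L = (LINT x:cbox 0 1|lborel. jac_det (param g r) x * (f x)\<^sup>2)"
    and iL: "set_integrable lborel (cbox 0 1) (\<lambda>x. jac_det (param g r) x * (f x)\<^sup>2)"
  proof -
    have f3: "jac_det (param g r) x * (f x)\<^sup>2
       = (\<Sum>i<n. \<Sum>j<n. c i * c j * (jac_det (param g r) x * (ref_basis p V r i x * ref_basis p V r j x)))" for x
      unfolding f2 sum_distrib_left by (intro sum.cong refl) simp
    show "L = (LINT x:cbox 0 1|lborel. jac_det (param g r) x * (f x)\<^sup>2)"
      unfolding L_def f3 loc_mass_entry(2)
      by (rule set_integral_quadratic_form(2)[symmetric], rule set_integrable_cube_ref)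
    show "set_integrable lborel (cbox 0 1) (\<lambda>x. jac_det (param g r) x * (f x)\<^sup>2)"
      unfolding f3 by (rule set_integral_quadratic_form(1), rule set_integrable_cube_ref)
  qed
  have "(LINT x:cbox 0 1|lborel. jm * (f x)\<^sup>2) = jm * R" "(LINT x:cbox 0 1|lborel. jM * (f x)\<^sup>2) = jM * R"
    unfolding R by (rule set_integral_mult_right)+
  moreover have "(LINT x:cbox 0 1|lborel. jm * (f x)\<^sup>2) \<le> L"
    unfolding L by (intro set_integral_mono set_integrable_mult_right iR iL) (use det in \<open>auto intro!: mult_right_mono\<close>)
  moreover have "L \<le> (LINT x:cbox 0 1|lborel. jM * (f x)\<^sup>2)"
    unfolding L by (intro set_integral_mono set_integrable_mult_right iR iL) (use det in \<open>auto intro!: mult_right_mono\<close>)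
  ultimately show ?thesis by linarith
qed

end

text \<open>The diagonal scaling in the preconditioner is harmless: the quotients of the diagonal entries of the
two mass matrices lie between the same bounds \<open>jm\<close> and \<open>jM\<close> as those of the forms.\<close>

lemma (in patch_map) loc_mass_form_bounds:
  fixes V :: "'d discretization"
  assumes R: "form_bounds (ndof p V r) (ref_mass p V r) r1 r2" "0 < r1" "0 \<le> r2"
  shows "form_bounds (ndof p V r) (loc_mass p g V r) (jm * r1) (jM * r2)"
    and "form_bounds (ndof p V r) (loc_precond p g V r) (jm * r1) (jM * r2)"
proof -
  let ?n = "ndof p V r" and ?R = "ref_mass p V r" and ?M = "loc_mass p g V r"
  note RD = form_boundsD[OF R(1)]
  have M: "?M \<in> carrier_mat ?n ?n" unfolding loc_mass_def by simp
  have form: "jm * (\<Sum>i<?n. \<Sum>j<?n. c i * c j * ?R $$ (i, j)) \<le> (\<Sum>i<?n. \<Sum>j<?n. c i * c j * ?M $$ (i, j)) \<and>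
       (\<Sum>i<?n. \<Sum>j<?n. c i * c j * ?M $$ (i, j)) \<le> jM * (\<Sum>i<?n. \<Sum>j<?n. c i * c j * ?R $$ (i, j))" for c
    using loc_mass_form[where c = c and n = ?n and p = p and V = V] unfolding loc_mass_def ref_mass_def by simp
  have jM: "0 < jM" using jm jm_le_jM by simp
  show "form_bounds ?n ?M (jm * r1) (jM * r2)"
  proof (rule form_boundsI[OF M])
    show "?M $$ (i, j) = ?M $$ (j, i)" if "i < ?n" "j < ?n" for i j
      using that unfolding loc_mass_def by (simp add: mult.commute)
    fix c :: "nat \<Rightarrow> real"
    show "jm * r1 * (\<Sum>i<?n. (c i)\<^sup>2) \<le> (\<Sum>i<?n. \<Sum>j<?n. c i * c j * ?M $$ (i, j)) \<and>
       (\<Sum>i<?n. \<Sum>j<?n. c i * c j * ?M $$ (i, j)) \<le> jM * r2 * (\<Sum>i<?n. (c i)\<^sup>2)"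
      using form[of c] mult_left_mono[OF RD(3)[of c], of jm] mult_left_mono[OF RD(4)[of c], of jM] jm jM
      by (simp only: mult.assoc) linarith
  qed
  show "form_bounds ?n (loc_precond p g V r) (jm * r1) (jM * r2)"
    unfolding loc_precond_def by (rule diag_scaled_form_bounds[OF R(1,2) M jm R(3) form])
qed

section \<open>Assembly over the patches\<close>

text \<open>The global mass matrix and the inverse Schwarz preconditioner are both of this form, so that one
estimate serves both.\<close>

definition assemble :: "nat \<Rightarrow> ('d::finite) geometry \<Rightarrow> 'd discretization \<Rightarrow> (nat \<Rightarrow> real mat) \<Rightarrow> real mat" where
  "assemble p g V X = Matrix.mat (ndim V) (ndim V) (\<lambda>ij. \<Sum>r<npatch g.
     (transpose_mat (restriction p V r) * X r * restriction p V r) $$ ij)"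

lemma restricted_entry:
  assumes X: "X \<in> carrier_mat (ndof p V r) (ndof p V r)" and l: "l < ndim V" "l' < ndim V"
  shows "(transpose_mat (restriction p V r) * X * restriction p V r) $$ (l, l')
    = (\<Sum>i<ndof p V r. \<Sum>j<ndof p V r. of_bool (loc_glob V r i = l) * of_bool (loc_glob V r j = l') * X $$ (i, j))" (is "_ = ?R")
proof -
  let ?n = "ndof p V"
  have "(transpose_mat (restriction p V r) * X * restriction p V r) $$ (l, l')
    = (\<Sum>j<?n r. (\<Sum>i<?n r. of_bool (loc_glob V r i = l) * X $$ (i, j)) * of_bool (loc_glob V r j = l'))"
    using X l by (simp add: restriction_def scalar_prod_def atLeast0LessThan of_bool_def)
  also have "\<dots> = (\<Sum>j<?n r. \<Sum>i<?n r. of_bool (loc_glob V r i = l) * of_bool (loc_glob V r j = l') * X $$ (i, j))"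
    unfolding sum_distrib_right by (intro sum.cong refl) simp
  also have "\<dots> = ?R"
    by (rule sum.swap)
  finally show ?thesis .
qed

lemma sum_of_bool_eq:
  fixes f :: "nat \<Rightarrow> real"
  assumes "k < n"
  shows "(\<Sum>l<n. f l * of_bool (k = l)) = f k"
proof -
  have "(\<Sum>l<n. f l * of_bool (k = l)) = (\<Sum>l<n. if l = k then f k else 0)" by (intro sum.cong) auto
  then show ?thesis using assms by simp
qed

lemma restricted_form:
  assumes X: "X \<in> carrier_mat (ndof p V r) (ndof p V r)"
    and G: "\<And>i. i < ndof p V r \<Longrightarrow> loc_glob V r i < ndim V"
  shows "(\<Sum>l<ndim V. \<Sum>l'<ndim V. c l * c l' * (transpose_mat (restriction p V r) * X * restriction p V r) $$ (l, l'))
    = (\<Sum>i<ndof p V r. \<Sum>j<ndof p V r. c (loc_glob V r i) * c (loc_glob V r j) * X $$ (i, j))"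
proof -
  let ?n = "ndof p V r" and ?N = "ndim V" and ?G = "loc_glob V r"
  let ?t = "\<lambda>l l' i j. c l * c l' * (of_bool (?G i = l) * of_bool (?G j = l') * X $$ (i, j))"
  have "(\<Sum>l<?N. \<Sum>l'<?N. c l * c l' * (transpose_mat (restriction p V r) * X * restriction p V r) $$ (l, l'))
    = (\<Sum>l<?N. \<Sum>l'<?N. \<Sum>i<?n. \<Sum>j<?n. ?t l l' i j)"
    by (intro sum.cong refl) (simp add: restricted_entry[OF X] sum_distrib_left)
  also have "\<dots> = (\<Sum>l<?N. \<Sum>i<?n. \<Sum>l'<?N. \<Sum>j<?n. ?t l l' i j)"
    by (intro sum.cong refl sum.swap)
  also have "\<dots> = (\<Sum>l<?N. \<Sum>i<?n. \<Sum>j<?n. \<Sum>l'<?N. ?t l l' i j)"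
    by (intro sum.cong refl sum.swap)
  also have "\<dots> = (\<Sum>i<?n. \<Sum>l<?N. \<Sum>j<?n. \<Sum>l'<?N. ?t l l' i j)"
    by (rule sum.swap)
  also have "\<dots> = (\<Sum>i<?n. \<Sum>j<?n. \<Sum>l<?N. \<Sum>l'<?N. ?t l l' i j)"
    by (intro sum.cong refl sum.swap)
  also have "\<dots> = (\<Sum>i<?n. \<Sum>j<?n. (\<Sum>l<?N. c l * of_bool (?G i = l)) * (\<Sum>l'<?N. c l' * of_bool (?G j = l')) * X $$ (i, j))"
    unfolding sum_product unfolding sum_distrib_right by (intro sum.cong refl) (simp only: mult_ac)
  also have "\<dots> = (\<Sum>i<?n. \<Sum>j<?n. c (?G i) * c (?G j) * X $$ (i, j))"
    using G by (intro sum.cong refl) (simp add: sum_of_bool_eq)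
  finally show ?thesis .
qed

lemma finite_index_pairs: "finite (index_pairs p g V l)"
proof (rule finite_subset)
  show "index_pairs p g V l \<subseteq> (SIGMA r:{..<npatch g}. {..<ndof p V r})" unfolding index_pairs_def by auto
qed auto

text \<open>This is the identity \<open>\<Sum>\<^sub>r R\<^sub>r\<^sup>T R\<^sub>r = diag (n\<^sub>l)\<close>.\<close>

lemma sum_over_local_indices:
  fixes f :: "nat \<Rightarrow> real"
  assumes G: "\<And>r i. r < npatch g \<Longrightarrow> i < ndof p V r \<Longrightarrow> loc_glob V r i < ndim V"
  shows "(\<Sum>r<npatch g. \<Sum>i<ndof p V r. f (loc_glob V r i)) = (\<Sum>l<ndim V. real (card (index_pairs p g V l)) * f l)"
proof -
  let ?n = "ndof p V"
  let ?S = "SIGMA r:{..<npatch g}. {..<?n r}"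
  let ?G = "\<lambda>(r, i). loc_glob V r i"
  have "(\<Sum>r<npatch g. \<Sum>i<?n r. f (loc_glob V r i)) = (\<Sum>x\<in>?S. f (?G x))"
    by (subst sum.Sigma) (auto simp: case_prod_unfold)
  also have "\<dots> = (\<Sum>l<ndim V. \<Sum>x\<in>{x\<in>?S. ?G x = l}. f (?G x))"
    by (rule sum.group[symmetric]) (use G in auto)
  also have "\<dots> = (\<Sum>l<ndim V. real (card (index_pairs p g V l)) * f l)"
  proof (intro sum.cong refl)
    fix l
    have S: "{x\<in>?S. ?G x = l} = index_pairs p g V l" unfolding index_pairs_def by auto
    have "(\<Sum>x\<in>{x\<in>?S. ?G x = l}. f (?G x)) = (\<Sum>x\<in>{x\<in>?S. ?G x = l}. f l)" by (rule sum.cong) auto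
    also have "\<dots> = real (card {x\<in>?S. ?G x = l}) * f l" by (rule sum_constant)
    finally show "(\<Sum>x\<in>{x\<in>?S. ?G x = l}. f (?G x)) = real (card (index_pairs p g V l)) * f l" unfolding S .
  qed
  finally show ?thesis .
qed

text \<open>Replacing each local matrix by its bound leaves the diagonal matrix of the multiplicities.  These
are at least 1, because every global index comes from some patch.\<close>

lemma assemble_form_bounds:
  assumes cov: "(\<Union>r<npatch g. loc_glob V r ` {..<ndof p V r}) = {..<ndim V}"
    and X: "\<And>r. r < npatch g \<Longrightarrow> form_bounds (ndof p V r) (X r) a b" and a: "0 \<le> a" and b: "0 \<le> b"
  shows "form_bounds (ndim V) (assemble p g V X) a (b * real (N_adj p g V))"
proof (rule form_boundsI)
  let ?N = "ndim V"
  let ?Y = "\<lambda>r. transpose_mat (restriction p V r) * X r * restriction p V r"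
  have G: "loc_glob V r i < ?N" if "r < npatch g" "i < ndof p V r" for r i
    using cov that by blast
  note XD = form_boundsD[OF X]
  show "assemble p g V X \<in> carrier_mat ?N ?N" unfolding assemble_def by simp
  show "assemble p g V X $$ (l, l') = assemble p g V X $$ (l', l)" if l: "l < ?N" "l' < ?N" for l l'
  proof -
    have "?Y r $$ (l, l') = ?Y r $$ (l', l)" if r: "r < npatch g" for r
      unfolding restricted_entry[OF XD(1)[OF r] l] restricted_entry[OF XD(1)[OF r] l(2,1)]
      by (subst sum.swap, intro sum.cong refl) (use XD(2)[OF r] in \<open>simp add: mult_ac\<close>)
    then show ?thesis unfolding assemble_def using l by simp
  qed
  fix c :: "nat \<Rightarrow> real"
  let ?Q = "(\<Sum>l<?N. \<Sum>l'<?N. c l * c l' * assemble p g V X $$ (l, l'))"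
  have form: "?Q
    = (\<Sum>r<npatch g. \<Sum>i<ndof p V r. \<Sum>j<ndof p V r. c (loc_glob V r i) * c (loc_glob V r j) * X r $$ (i, j))"
  proof -
    have "?Q
      = (\<Sum>l<?N. \<Sum>l'<?N. \<Sum>r<npatch g. c l * c l' * ?Y r $$ (l, l'))"
      unfolding assemble_def by (intro sum.cong refl) (simp add: sum_distrib_left)
    also have "\<dots> = (\<Sum>l<?N. \<Sum>r<npatch g. \<Sum>l'<?N. c l * c l' * ?Y r $$ (l, l'))"
      by (intro sum.cong refl sum.swap)
    also have "\<dots> = (\<Sum>r<npatch g. \<Sum>l<?N. \<Sum>l'<?N. c l * c l' * ?Y r $$ (l, l'))"
      by (rule sum.swap)
    also have "\<dots> = (\<Sum>r<npatch g. \<Sum>i<ndof p V r. \<Sum>j<ndof p V r. c (loc_glob V r i) * c (loc_glob V r j) * X r $$ (i, j))"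
      using G XD(1) by (intro sum.cong refl restricted_form) auto
    finally show ?thesis .
  qed
  let ?n = "\<lambda>l. real (card (index_pairs p g V l))"
  have n1: "1 \<le> ?n l" if l: "l < ?N" for l
  proof -
    have "l \<in> (\<Union>r<npatch g. loc_glob V r ` {..<ndof p V r})" using cov l by simp
    then have "index_pairs p g V l \<noteq> {}" unfolding index_pairs_def by auto
    then have "card (index_pairs p g V l) \<noteq> 0" using finite_index_pairs[of p g V l] by auto
    then show ?thesis by linarith
  qed
  have nN: "?n l \<le> real (N_adj p g V)" if l: "l < ?N" for l
    unfolding N_adj_def using l by (intro of_nat_mono Max_ge) auto
  have sq: "(\<Sum>r<npatch g. \<Sum>i<ndof p V r. (c (loc_glob V r i))\<^sup>2) = (\<Sum>l<?N. ?n l * (c l)\<^sup>2)"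
    using sum_over_local_indices[where f = "\<lambda>l. (c l)\<^sup>2", OF G] by simp
  have "a * (\<Sum>l<?N. (c l)\<^sup>2) \<le> a * (\<Sum>l<?N. ?n l * (c l)\<^sup>2)"
    using n1 a by (intro mult_left_mono sum_mono) (auto simp: mult_le_cancel_right1)
  also have "\<dots> \<le> ?Q"
    unfolding form sq[symmetric] sum_distrib_left[of a _ "{..<npatch g}"] by (intro sum_mono XD(3)) auto
  finally have lo: "a * (\<Sum>l<?N. (c l)\<^sup>2) \<le> ?Q" .
  have "?Q \<le> b * (\<Sum>l<?N. ?n l * (c l)\<^sup>2)"
    unfolding form sq[symmetric] sum_distrib_left[of b _ "{..<npatch g}"] by (intro sum_mono XD(4)) auto
  also have "\<dots> \<le> b * (\<Sum>l<?N. real (N_adj p g V) * (c l)\<^sup>2)"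
    using nN b by (intro mult_left_mono sum_mono mult_right_mono) auto
  finally show "a * (\<Sum>l<?N. (c l)\<^sup>2) \<le> ?Q \<and>
     ?Q \<le> b * real (N_adj p g V) * (\<Sum>l<?N. (c l)\<^sup>2)"
    using lo by (simp add: sum_distrib_left[symmetric] mult.assoc)
qed

section \<open>The global mass matrix\<close>

text \<open>An open patch does not meet the closure of another one, and a global index has at most one local
index on a patch.  So the choice in the definition of the basis function is forced.\<close>

lemma glob_basis_on_patch:
  assumes disj: "\<And>s. s < npatch g \<Longrightarrow> s \<noteq> r \<Longrightarrow> patch g r \<inter> patch g s = {}"
    and op: "open (patch g r)" and r: "r < npatch g" and inj: "inj_on (loc_glob V r) {..<ndof p V r}"
    and x: "x \<in> patch g r"
  shows "glob_basis p g V l x = (\<Sum>i<ndof p V r. of_bool (loc_glob V r i = l) * loc_basis p g V r i x)"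
proof -
  let ?n = "ndof p V"
  have pairs: "s = r" if "(s, i) \<in> index_pairs p g V l" "x \<in> closure (patch g s)" for s i
  proof (rule ccontr)
    assume "s \<noteq> r"
    then have "patch g r \<inter> patch g s = {}" using disj that(1) unfolding index_pairs_def by auto
    then have "patch g r \<inter> closure (patch g s) = {}" using open_Int_closure_eq_empty[OF op] by blast
    then show False using x that(2) by blast
  qed
  have xc: "x \<in> closure (patch g r)" using x closure_subset by blast
  show ?thesis
  proof (cases "\<exists>i<?n r. loc_glob V r i = l")
    case True
    then obtain i where i: "i < ?n r" "loc_glob V r i = l" by blast
    have u: "j = i" if "(r, j) \<in> index_pairs p g V l" for j
      using inj_onD[OF inj, of j i] that i unfolding index_pairs_def by auto
    have p: "(r, i) \<in> index_pairs p g V l" using r i unfolding index_pairs_def by simp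
    have ex: "\<exists>(s, j)\<in>index_pairs p g V l. x \<in> closure (patch g s)" using p xc by blast
    have "(SOME y. \<exists>(s, j)\<in>index_pairs p g V l. x \<in> closure (patch g s) \<and> y = loc_basis p g V s j x) = loc_basis p g V r i x"
    proof (rule some_equality)
      show "\<exists>(s, j)\<in>index_pairs p g V l. x \<in> closure (patch g s) \<and> loc_basis p g V r i x = loc_basis p g V s j x"
        using p xc by blast
      fix y assume "\<exists>(s, j)\<in>index_pairs p g V l. x \<in> closure (patch g s) \<and> y = loc_basis p g V s j x"
      then show "y = loc_basis p g V r i x" using pairs u by fastforce
    qed
    then have "glob_basis p g V l x = loc_basis p g V r i x" unfolding glob_basis_def using ex by simp
    moreover have "(\<Sum>j<?n r. of_bool (loc_glob V r j = l) * loc_basis p g V r j x)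
       = (\<Sum>j<?n r. if j = i then loc_basis p g V r i x else 0)"
      using inj_onD[OF inj] i by (intro sum.cong refl) auto
    ultimately show ?thesis using i by simp
  next
    case False
    then have none: "\<not> (\<exists>(s, j)\<in>index_pairs p g V l. x \<in> closure (patch g s))"
      using pairs unfolding index_pairs_def by fastforce
    then have "glob_basis p g V l x = 0" unfolding glob_basis_def by simp
    moreover have "(\<Sum>j<?n r. of_bool (loc_glob V r j = l) * loc_basis p g V r j x) = 0"
      using False by (intro sum.neutral) auto
    ultimately show ?thesis by simp
  qed
qed

text \<open>The patches cover the domain up to the images of the cube boundaries, which are null sets; on each
patch the global basis functions are the local ones.\<close>

lemma mass_matrix_assemble:
  fixes g :: "'d::finite geometry"
  assumes g: "multipatch_domain g" and V: "conforming_discretization p g V"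
    and pm: "\<And>r. r < npatch g \<Longrightarrow> patch_map g r jm jM"
  shows "mass_matrix p g V = assemble p g V (loc_mass p g V)"
proof (rule eq_matI)
  let ?n = "ndof p V"
  fix l l' assume "l < dim_row (assemble p g V (loc_mass p g V))" "l' < dim_col (assemble p g V (loc_mass p g V))"
  then have l: "l < ndim V" "l' < ndim V" unfolding assemble_def by auto
  let ?gg = "\<lambda>x. glob_basis p g V l x * glob_basis p g V l' x"
  let ?ll = "\<lambda>r i j x. loc_basis p g V r i x * loc_basis p g V r j x"
  let ?w = "\<lambda>r i j. of_bool (loc_glob V r i = l) * of_bool (loc_glob V r j = l') :: real"
  let ?fr = "\<lambda>r x. \<Sum>i<?n r. \<Sum>j<?n r. ?w r i j * (indicator (patch g r) x *\<^sub>R ?ll r i j x)"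
  let ?f = "\<lambda>x. \<Sum>r<npatch g. ?fr r x"
  have dom: "open (domain g)" "closure (domain g) = (\<Union>r<npatch g. closure (patch g r))"
    "\<And>r. r < npatch g \<Longrightarrow> patch g r \<subseteq> domain g"
    "\<And>r s. r < npatch g \<Longrightarrow> s < npatch g \<Longrightarrow> r \<noteq> s \<Longrightarrow> patch g r \<inter> patch g s = {}"
    using g unfolding multipatch_domain_def by auto
  have injG: "inj_on (loc_glob V r) {..<?n r}" if "r < npatch g" for r
    using V that by (simp add: conforming_discretization_def)
  define Z where "Z = (\<Union>r<npatch g. param g r ` cbox 0 1 - patch g r)"
  have Z: "Z \<in> null_sets lborel" unfolding Z_def
    by (intro null_sets_UN') (auto intro: patch_map.null_K_minus_patch[OF pm])
  have cover: "\<exists>r<npatch g. x \<in> patch g r" if "x \<in> domain g" "x \<notin> Z" for x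
  proof -
    have "x \<in> closure (domain g)" using that(1) closure_subset by blast
    then obtain r where r: "r < npatch g" "x \<in> closure (patch g r)" using dom(2) by auto
    have "closure (patch g r) \<subseteq> param g r ` cbox 0 1"
      using patch_map.patch_subset_K[OF pm[OF r(1)]] compact_imp_closed[OF patch_map.compact_K[OF pm[OF r(1)]]]
      by (rule closure_minimal)
    then show ?thesis using r that(2) unfolding Z_def by blast
  qed
  have gl: "?gg x = (\<Sum>i<?n r. \<Sum>j<?n r. ?w r i j * ?ll r i j x)"
    if r: "r < npatch g" and x: "x \<in> patch g r" for r x
  proof -
    have gb: "glob_basis p g V l x = (\<Sum>i<?n r. of_bool (loc_glob V r i = l) * loc_basis p g V r i x)" for l
      using dom(4) r x injG[OF r] patch_map.open_patch[OF pm[OF r]] by (intro glob_basis_on_patch) auto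
    show ?thesis unfolding gb sum_product by (intro sum.cong refl) simp
  qed
  have int: "integrable lborel ?f"
    using patch_map.loc_mass_entry(1)[OF pm]
    by (intro integrable_sum integrable_mult_right) (auto simp: set_integrable_def)
  have "mass_matrix p g V $$ (l, l') = (\<integral>x. indicator (domain g) x *\<^sub>R ?gg x \<partial>lborel)"
    unfolding mass_matrix_def set_lebesgue_integral_def using l by simp
  also have "\<dots> = (\<integral>x. ?f x \<partial>lborel)"
  proof (rule integral_cong_AE)
    have "continuous_on (domain g) (glob_basis p g V l)" if "l < ndim V" for l
      using V that by (simp add: conforming_discretization_def is_basis_on_def global_space_def)
    then have "continuous_on (domain g) ?gg" using l by (intro continuous_intros)
    then show "(\<lambda>x. indicator (domain g) x *\<^sub>R ?gg x) \<in> borel_measurable lborel"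
      using dom(1) borel_measurable_continuous_on_indicator[of "domain g" ?gg] by simp
    show "?f \<in> borel_measurable lborel"
      using int by (rule borel_measurable_integrable)
    have eq: "indicator (domain g) x *\<^sub>R ?gg x = ?f x"
      if xZ: "x \<notin> Z" for x
    proof (cases "x \<in> domain g")
      case True
      then obtain s where s: "s < npatch g" "x \<in> patch g s" using cover xZ by blast
      have "indicator (patch g r) x = (if r = s then 1 else 0 :: real)" if "r < npatch g" for r
        using dom(4)[OF that s(1)] s(2) by (auto simp: indicator_def)
      then have "?f x
        = (\<Sum>r<npatch g. if r = s then (\<Sum>i<?n s. \<Sum>j<?n s. ?w s i j * ?ll s i j x) else 0)"
        by (intro sum.cong refl) auto
      also have "\<dots> = ?gg x" using s(1) gl[OF s] by simp
      finally show ?thesis using True by simp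
    next
      case False
      then have "x \<notin> patch g r" if "r < npatch g" for r using dom(3)[OF that] by blast
      then show ?thesis using False by (simp add: sum.neutral)
    qed
    show "AE x in lborel. indicator (domain g) x *\<^sub>R ?gg x = ?f x"
      by (rule AE_I'[OF Z]) (use eq in blast)
  qed
  also have "\<dots> = (\<Sum>r<npatch g. \<Sum>i<?n r. \<Sum>j<?n r. ?w r i j * (LINT x:patch g r|lborel. ?ll r i j x))"
  proof -
    have i3: "integrable lborel (\<lambda>x. ?w r i j * (indicator (patch g r) x *\<^sub>R ?ll r i j x))" if "r < npatch g" for r i j
      using patch_map.loc_mass_entry(1)[OF pm[OF that]] unfolding set_integrable_def by (intro integrable_mult_right)
    have i2: "integrable lborel (\<lambda>x. \<Sum>j<?n r. ?w r i j * (indicator (patch g r) x *\<^sub>R ?ll r i j x))" if "r < npatch g" for r i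
      by (intro integrable_sum i3[OF that])
    have i1: "integrable lborel (?fr r)" if "r < npatch g" for r
      by (intro integrable_sum i2[OF that])
    show ?thesis
    proof (subst integral_sum)
      show "integrable lborel (?fr r)"
        if "r \<in> {..<npatch g}" for r using i1 that by simp
      have "(\<integral>x. ?fr r x \<partial>lborel)
        = (\<Sum>i<?n r. \<Sum>j<?n r. ?w r i j * (LINT x:patch g r|lborel. ?ll r i j x))" if r: "r < npatch g" for r
        unfolding integral_sum[OF i2[OF r]] integral_sum[OF i3[OF r]]
        unfolding set_lebesgue_integral_def by (intro sum.cong refl integral_mult_right_zero)
      then show "(\<Sum>r<npatch g. \<integral>x. ?fr r x \<partial>lborel)
        = (\<Sum>r<npatch g. \<Sum>i<?n r. \<Sum>j<?n r. ?w r i j * (LINT x:patch g r|lborel. ?ll r i j x))"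
        by (intro sum.cong refl) auto
    qed
  qed
  also have "\<dots> = assemble p g V (loc_mass p g V) $$ (l, l')"
  proof -
    have c: "loc_mass p g V r \<in> carrier_mat (?n r) (?n r)" for r unfolding loc_mass_def by simp
    show ?thesis unfolding assemble_def using l
      by (simp add: restricted_entry[OF c l]) (intro sum.cong refl, simp add: loc_mass_def)
  qed
  finally show "mass_matrix p g V $$ (l, l') = assemble p g V (loc_mass p g V) $$ (l, l')" .
qed (simp_all add: mass_matrix_def assemble_def)

section \<open>The condition number\<close>

text \<open>The determinants form a compact set, a finite union of continuous images of the closed cube; so
their infimum is attained and positive.\<close>

lemma jac_dets_bounds:
  fixes g :: "'d::finite geometry"
  assumes g: "0 < npatch g"
    and J: "\<And>r. r < npatch g \<Longrightarrow> C1_on_cube (param g r) \<and> (\<forall>x\<in>cbox 0 1. 0 < jac_det (param g r) x)"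
  shows "0 < Inf (jac_dets g)"
    and "\<And>r x. r < npatch g \<Longrightarrow> x \<in> cbox 0 1 \<Longrightarrow> Inf (jac_dets g) \<le> jac_det (param g r) x \<and> jac_det (param g r) x \<le> Sup (jac_dets g)"
proof -
  have e: "jac_dets g = (\<Union>r<npatch g. jac_det (param g r) ` cbox 0 1)" unfolding jac_dets_def by auto
  have "continuous_on (cbox 0 1) (jac_det (param g r))" if "r < npatch g" for r
    unfolding jac_det_def[abs_def] using J[OF that] unfolding C1_on_cube_def
    by (intro continuous_on_determinant) simp
  then have K: "compact (jac_dets g)" unfolding e
    by (intro compact_UN compact_continuous_image) auto
  have "0 \<in> cbox 0 (1 :: real ^ 'd)" by (simp add: mem_box_cart)
  then have ne: "jac_dets g \<noteq> {}" unfolding e using g by blast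
  have "Inf (jac_dets g) \<in> jac_dets g"
    using closed_contains_Inf[OF ne] K by (simp add: compact_imp_closed bounded_imp_bdd_below compact_imp_bounded)
  then show "0 < Inf (jac_dets g)" using J unfolding e by auto
  fix r x assume "r < npatch g" "x \<in> cbox (0 :: real ^ 'd) 1"
  then have "jac_det (param g r) x \<in> jac_dets g" unfolding e by blast
  then show "Inf (jac_dets g) \<le> jac_det (param g r) x \<and> jac_det (param g r) x \<le> Sup (jac_dets g)"
    using K by (auto intro!: cInf_lower cSup_upper simp: bounded_imp_bdd_below bounded_imp_bdd_above compact_imp_bounded)
qed

theorem theorem3:
  fixes p :: nat and \<alpha> :: real
  assumes "1 \<le> p" and "0 < \<alpha>"
  shows "\<exists>C :: real \<Rightarrow> real \<Rightarrow> real.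
    \<forall>(g :: 'd::finite geometry) (V :: 'd discretization).
      multipatch_domain g \<longrightarrow>
      (\<forall>r<npatch g. C1_on_cube (param g r) \<and> (\<forall>x\<in>cbox 0 1. 0 < jac_det (param g r) x)) \<longrightarrow>
      conforming_discretization p g V \<longrightarrow>
      quasi_uniform \<alpha> g V \<longrightarrow>
      cond_number (spd_sqrt (schwarz_inv p g V) * mass_matrix p g V * spd_sqrt (schwarz_inv p g V))
        \<le> C (Inf (jac_dets g)) (Sup (jac_dets g)) * (real (N_adj p g V))\<^sup>2"
proof -
  obtain \<gamma> where \<gamma>0: "0 < \<gamma>"
    and \<gamma>: "\<And>\<xi> h c. quasi_uniform_knots p \<xi> h \<alpha> \<Longrightarrow> \<gamma> * h * (\<Sum>i<num_bsplines p \<xi>. (c i)\<^sup>2)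
      \<le> integral {0..1} (\<lambda>x. (\<Sum>i<num_bsplines p \<xi>. c i * bspline \<xi> p i x)\<^sup>2)"
    using spline_L2_stability[OF assms] by auto
  define d where "d = CARD('d)"
  define C where "C a b = ((real p + 1)\<^sup>2 / \<gamma>) ^ (2 * d) * (b / a)\<^sup>2" for a b :: real
  \<comment> \<open>\<open>C\<close> is the square of the quotient of the upper and the lower local bound, in which the mesh size cancels.\<close>
  have main: "cond_number (spd_sqrt (schwarz_inv p g V) * mass_matrix p g V * spd_sqrt (schwarz_inv p g V))
      \<le> C (Inf (jac_dets g)) (Sup (jac_dets g)) * (real (N_adj p g V))\<^sup>2"
    if g: "multipatch_domain g"
      and J: "\<forall>r<npatch g. C1_on_cube (param g r) \<and> (\<forall>x\<in>cbox 0 1. 0 < jac_det (param g r) x)"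
      and V: "conforming_discretization p g V" and qu: "quasi_uniform \<alpha> g V"
    for g :: "'d geometry" and V :: "'d discretization"
  proof -
    define h where "h = mesh_size g V"
    define jm where "jm = Inf (jac_dets g)"
    define jM where "jM = Sup (jac_dets g)"
    define N where "N = real (N_adj p g V)"
    define r1 where "r1 = (\<gamma> * h) ^ d"
    define r2 where "r2 = ((real p + 1)\<^sup>2 * h) ^ d"
    have np: "0 < npatch g" using g unfolding multipatch_domain_def by blast
    note jb = jac_dets_bounds[OF np, folded jm_def jM_def]
    have jm: "0 < jm" using J by (intro jb(1)) auto
    have pm: "patch_map g r jm jM" if r: "r < npatch g" for r
    proof
      show "inj_on (param g r) (cbox 0 1)" using g r unfolding multipatch_domain_def by blast
      show "C1_on_cube (param g r)" using J r by blast
      show "0 < jm" by (rule jm)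
      show "jm \<le> jac_det (param g r) x \<and> jac_det (param g r) x \<le> jM" if "x \<in> cbox 0 1" for x
        using J r that by (intro jb(2)) auto
    qed
    have jM: "0 < jM" using patch_map.jm_le_jM[OF pm[OF np]] jm by simp
    note rb = ref_mass_form_bounds[OF V qu assms _ \<gamma>0 \<gamma>, folded h_def d_def, folded r1_def r2_def]
    have h: "0 < h" using rb(2)[OF np] .
    have r1: "0 < r1" and r2: "0 < r2" unfolding r1_def r2_def using h \<gamma>0 by auto
    have loc: "form_bounds (ndof p V r) (loc_mass p g V r) (jm * r1) (jM * r2)"
      "form_bounds (ndof p V r) (loc_precond p g V r) (jm * r1) (jM * r2)" if r: "r < npatch g" for r
      using patch_map.loc_mass_form_bounds[OF pm[OF r] rb(1)[OF r] r1 less_imp_le[OF r2]] by auto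
    have inv: "form_bounds (ndof p V r) (the (mat_inverse (loc_precond p g V r))) (1 / (jM * r2)) (1 / (jm * r1))"
      if r: "r < npatch g" for r
      using form_bounds_inverse[OF loc(2)[OF r]] jm jM r1 r2 by auto
    have cov: "(\<Union>r<npatch g. loc_glob V r ` {..<ndof p V r}) = {..<ndim V}"
      using V by (simp add: conforming_discretization_def)
    have A: "form_bounds (ndim V) (schwarz_inv p g V) (1 / (jM * r2)) (1 / (jm * r1) * N)"
      using assemble_form_bounds[OF cov inv] jm jM r1 r2 unfolding schwarz_inv_def assemble_def N_def by simp
    have mass: "mass_matrix p g V = assemble p g V (loc_mass p g V)" by (rule mass_matrix_assemble[OF g V pm])
    have M: "form_bounds (ndim V) (mass_matrix p g V) (jm * r1) (jM * r2 * N)"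
      unfolding mass N_def
      using assemble_form_bounds[OF cov loc(1)] jm jM r1 r2 by simp
    have nd: "0 < ndim V"
    proof -
      have "0 < num_bsplines p (knots V 0 k)" for k
        using quasi_uniform_knots.knot_props(2)[OF quasi_uniform_knots_of_mesh[OF assms V qu np]] by (meson le_less_trans zero_le)
      then have "0 < ndof p V 0" unfolding ndof_def by (simp add: prod_pos)
      then have "loc_glob V 0 0 \<in> (\<Union>r<npatch g. loc_glob V r ` {..<ndof p V r})" using np by blast
      then show ?thesis using cov by auto
    qed
    have "cond_number (spd_sqrt (schwarz_inv p g V) * mass_matrix p g V * spd_sqrt (schwarz_inv p g V))
       \<le> (1 / (jm * r1) * N * (jM * r2 * N)) / (1 / (jM * r2) * (jm * r1))"
      by (rule cond_number_bound[OF A _ M _ nd]) (use jm jM r1 r2 in auto)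
    also have "\<dots> = (r2 / r1)\<^sup>2 * (jM / jm)\<^sup>2 * N\<^sup>2"
      using jm jM r1 r2 by (simp add: power2_eq_square field_simps)
    also have "r2 / r1 = ((real p + 1)\<^sup>2 / \<gamma>) ^ d"
      unfolding r1_def r2_def using h by (simp add: power_mult_distrib power_divide)
    also have "(((real p + 1)\<^sup>2 / \<gamma>) ^ d)\<^sup>2 = ((real p + 1)\<^sup>2 / \<gamma>) ^ (2 * d)"
      by (simp only: power_mult[symmetric] mult.commute)
    finally show ?thesis unfolding C_def jm_def jM_def N_def .
  qed
  show ?thesis by (intro exI[of _ C] allI impI main) auto
qed

end
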